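(* For $t<1$, with continuous values at $t=0$, \begin{align*} A_2\!\left(\frac{t}{1-t}\right)&=2\pi^2(1-t)^{-1/t-1},\\ A_4\!\left(\frac{t}{1-t}\right)&=-\frac{2\pi^4}{3}(2t^2-5t+5)(1-t)^{-1/t-3}. \end{align*} In particular: (1) $t=1/p\in(0,1)$ gives the positive-exponent finite Hardy constants, i.e. $\Lambda_N(1/p)$ is the supremum over $a_1,\ldots,a_N>0$ of $\sum_{n=1}^N\left(\frac1n\sum_{k=1}^n a_k\right)^p\big/\sum_{n=1}^N a_n^p$. (2) $t=0$ gives, as $N\to\infty$, $$e-\Lambda_N(0)=\frac{2e\pi^2}{(\log N+\kappa(0))^2}-\frac{10e\pi^4/3}{(\log N+\kappa(0))^4}+O\!\left((\log N)^{-5}\right).$$ (3) $t=-1/r<0$ gives the negative-exponent branch, i.e. $\Lambda_N(-1/r)$ is the supremum over $a_1,\ldots,a_N>0$ of $\sum_{n=1}^N\left(\frac1n\sum_{k=1}^n a_k\right)^{-r}\big/\sum_{n=1}^N a_n^{-r}$. At $p=2$ (that is, $t=1/2$, $q=1$) one has $A_2(1)=16\pi^2$ and $A_4(1)=-64\pi^4$.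
   Context: For $t<1$ and $x_1,\ldots,x_n>0$ the power mean is $P_t(x_1,\ldots,x_n)=\left(\frac1n\sum_{k=1}^n x_k^t\right)^{1/t}$ if $t\ne0$, and $P_0(x_1,\ldots,x_n)=(x_1\cdots x_n)^{1/n}$. The finite Hardy constant is $$\Lambda_N(t)=\sup_{x_1,\ldots,x_N>0}\frac{\sum_{n=1}^N P_t(x_1,\ldots,x_n)}{\sum_{n=1}^N x_n},$$ and for $q\in(-1,\infty)$ one writes $\lambda_N(q)=\Lambda_N\!\left(\frac{q}{1+q}\right)$. The parameters are related by $q=t/(1-t)$. Further $\Lambda_*(q)=(1+q)^{(1+q)/q}$ for $q\ne0$, $q>-1$, and $\Lambda_*(0)=e$. The functions $\kappa$ and $A_j$ ($j\ge2$) on $(-1,\infty)$ are the unique real-analytic functions with $A_3\equiv0$ such that for every compact $Q\subset(-1,\infty)$ and every fixed $L\ge2$, $\Lambda_*(q)-\lambda_N(q)=\sum_{j=2}^{L}A_j(q)(\log N+\kappa(q))^{-j}+O_{Q,L}((\log N)^{-L-1})$ as $N\to\infty$, uniformly for $q\in Q$ (the paper's main theorem asserts that they exist and are unique). *)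

theory Defs
  imports "HOL-Analysis.Analysis" "HOL-Library.Landau_Symbols"
begin

definition power_mean :: "real \<Rightarrow> nat \<Rightarrow> (nat \<Rightarrow> real) \<Rightarrow> real" where
  "power_mean t n x =
     (if t = 0 then (\<Prod>k=1..n. x k) powr (1 / real n)
      else ((\<Sum>k=1..n. x k powr t) / real n) powr (1 / t))"

text \<open>Tuples of length \<open>N\<close> are sequences of which only the entries \<open>1, \<dots>, N\<close> matter.\<close>

definition pos_tuples :: "nat \<Rightarrow> (nat \<Rightarrow> real) set" where
  "pos_tuples N = {x. \<forall>n\<in>{1..N}. x n > 0}"

definition hardy_const :: "nat \<Rightarrow> real \<Rightarrow> real" where
  "hardy_const N t =
     (SUP x\<in>pos_tuples N. (\<Sum>n=1..N. power_mean t n x) / (\<Sum>n=1..N. x n))"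

definition hardy_lambda :: "nat \<Rightarrow> real \<Rightarrow> real" where
  "hardy_lambda N q = hardy_const N (q / (1 + q))"

definition hardy_limit :: "real \<Rightarrow> real" where
  "hardy_limit q = (if q = 0 then exp 1 else (1 + q) powr ((1 + q) / q))"

definition real_analytic_on :: "(real \<Rightarrow> real) \<Rightarrow> real set \<Rightarrow> bool" where
  "real_analytic_on f S \<longleftrightarrow> (\<forall>x\<in>S. \<exists>F. (\<lambda>h. f (x + h)) has_fps_expansion F)"

text \<open>
  The characterisation of \<open>\<kappa>\<close> and of the family \<open>A\<^sub>j\<close>, \<open>j \<ge> 2\<close>, on \<open>(-1, \<infinity>)\<close>. The values \<open>A 0\<close> and
  \<open>A 1\<close>, and all values at arguments \<open>\<le> -1\<close>, are unconstrained and never used. The constant and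
  the threshold for \<open>N\<close> depend on \<open>Q\<close> and \<open>L\<close> but not on \<open>q\<close>; as \<open>\<kappa>\<close> is bounded on \<open>Q\<close>, the
  denominators are eventually positive.
\<close>

definition hardy_expansion :: "(real \<Rightarrow> real) \<Rightarrow> (nat \<Rightarrow> real \<Rightarrow> real) \<Rightarrow> bool" where
  "hardy_expansion \<kappa> A \<longleftrightarrow>
     real_analytic_on \<kappa> {-1<..} \<and>
     (\<forall>j\<ge>2. real_analytic_on (A j) {-1<..}) \<and>
     (\<forall>q>-1. A 3 q = 0) \<and>
     (\<forall>Q L. compact Q \<longrightarrow> Q \<subseteq> {-1<..} \<longrightarrow> 2 \<le> L \<longrightarrow>
        (\<exists>C. \<forall>\<^sub>F N in sequentially. \<forall>q\<in>Q.
           \<bar>hardy_limit q - hardy_lambda N q - (\<Sum>j=2..L. A j q / (ln (real N) + \<kappa> q) ^ j)\<bar>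
             \<le> C / ln (real N) ^ (L + 1)))"

text \<open>
  The supremum in \<^const>\<open>hardy_const\<close> is a genuine one: the set of quotients is nonempty and
  bounded above.
\<close>

lemma pos_tuples_nonempty: "pos_tuples N \<noteq> {}"
proof -
  have "(\<lambda>_. 1) \<in> pos_tuples N" by (simp add: pos_tuples_def)
  thus ?thesis by blast
qed

lemma power_mean_le:
  assumes n: "n \<ge> 1" and x: "\<And>k. k \<in> {1..n} \<Longrightarrow> 0 < x k \<and> x k \<le> M"
  shows "power_mean t n x \<le> M"
proof -
  have M: "M > 0" using x[of 1] n by force
  have card: "(\<Sum>k=1..n. c) / real n = c" for c :: real using n by simp
  consider "t = 0" | "t > 0" | "t < 0" by linarith
  thus ?thesis
  proof cases
    case 1
    have "(\<Prod>k=1..n. x k) \<le> (\<Prod>k=1..n. M)" using x by (intro prod_mono) (auto intro: less_imp_le)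
    hence "(\<Prod>k=1..n. x k) powr (1 / n) \<le> (M ^ n) powr (1 / n)"
      using x by (intro powr_mono2 prod_nonneg) (auto intro: less_imp_le)
    also have "\<dots> = M" using M n by (simp add: powr_powr flip: powr_realpow)
    finally show ?thesis using 1 by (simp add: power_mean_def)
  next
    case 2
    have "(\<Sum>k=1..n. x k powr t) / n \<le> (\<Sum>k=1..n. M powr t) / n"
      using x 2 by (intro divide_right_mono sum_mono powr_mono2) (auto intro: less_imp_le)
    hence "(\<Sum>k=1..n. x k powr t) / n \<le> M powr t" using card by simp
    hence "((\<Sum>k=1..n. x k powr t) / n) powr (1 / t) \<le> (M powr t) powr (1 / t)"
      using 2 by (intro powr_mono2) (auto intro!: divide_nonneg_nonneg sum_nonneg)
    also have "\<dots> = M" using M 2 by (simp add: powr_powr)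
    finally show ?thesis using 2 by (simp add: power_mean_def)
  next
    case 3
    have "(\<Sum>k=1..n. M powr t) / n \<le> (\<Sum>k=1..n. x k powr t) / n"
      using x 3 by (intro divide_right_mono sum_mono powr_mono2') auto
    hence "M powr t \<le> (\<Sum>k=1..n. x k powr t) / n" using card by simp
    hence "((\<Sum>k=1..n. x k powr t) / n) powr (1 / t) \<le> (M powr t) powr (1 / t)"
      using 3 M by (intro powr_mono2') auto
    also have "\<dots> = M" using M 3 by (simp add: powr_powr)
    finally show ?thesis using 3 by (simp add: power_mean_def)
  qed
qed

lemma hardy_quotients_bdd_above:
  "bdd_above ((\<lambda>x. (\<Sum>n=1..N. power_mean t n x) / (\<Sum>n=1..N. x n)) ` pos_tuples N)"
proof (rule bdd_aboveI2)
  fix x assume "x \<in> pos_tuples N"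
  hence pos: "\<And>n. n \<in> {1..N} \<Longrightarrow> x n > 0" by (simp add: pos_tuples_def)
  define S where "S = (\<Sum>n=1..N. x n)"
  have le: "x k \<le> S" if "k \<in> {1..N}" for k
    unfolding S_def using that pos by (intro member_le_sum) (auto intro: less_imp_le)
  have "power_mean t n x \<le> S" if "n \<in> {1..N}" for n
    using that pos le by (intro power_mean_le) auto
  hence "(\<Sum>n=1..N. power_mean t n x) \<le> (\<Sum>n=1..N. S)" by (intro sum_mono)
  hence "(\<Sum>n=1..N. power_mean t n x) \<le> real N * S" by simp
  moreover have "S \<ge> 0" unfolding S_def using pos by (intro sum_nonneg) (auto intro: less_imp_le)
  ultimately have "(\<Sum>n=1..N. power_mean t n x) / S \<le> real N"
    by (cases "S = 0") (auto simp: divide_le_eq)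
  thus "(\<Sum>n=1..N. power_mean t n x) / (\<Sum>n=1..N. x n) \<le> real N" by (simp add: S_def)
qed

end

theory Submission
  imports Defs "HOL-Real_Asymp.Real_Asymp"
begin

text \<open>
  Why the coefficients come out as they do. Write \<open>t = q / (1 + q)\<close> and, for a candidate constant
  \<open>\<lambda>\<close>, put \<open>\<mu> = 1 / \<lambda>\<close>. The reverse Hoelder inequality peels off the last entry of a tuple: if
  \<open>v\<^sub>0 = 1\<close> and \<open>v\<^sub>k\<^sub>+\<^sub>1 = P\<^sub>k(v\<^sub>k) - \<mu> / (k + 1)\<close>, where \<open>P\<^sub>k(v)\<close> is the power mean with exponent \<open>-q\<close> of
  \<open>k\<close> copies of \<open>v\<close> and one \<open>1\<close>, then the sum of \<open>x\<^sub>n - \<mu> P\<^sub>t(x\<^sub>1, \<dots>, x\<^sub>n)\<close> over \<open>n \<le> k\<close> is at least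
  \<open>k v\<^sub>k P\<^sub>t(x\<^sub>1, \<dots>, x\<^sub>k)\<close> as long as the earlier \<open>v\<^sub>j\<close> are positive, and a suitable tuple attains this
  (\<open>sum_minus_power_means_ge\<close>, \<open>extremal_tuple_exists\<close>). Hence \<open>\<lambda>\<close> lies between the finite Hardy
  constants with \<open>N - 1\<close> and with \<open>N\<close> entries, where \<open>N\<close> is the first index with \<open>v\<^sub>N \<le> 0\<close>.

  The finite Hardy constant is thus encoded in the extinction time of a scalar recursion. To first
  order a step of the recursion is \<open>v\<^sub>k\<^sub>+\<^sub>1 - v\<^sub>k = - (gap v\<^sub>k + \<eta>) / (k + 1)\<close>, where \<open>\<eta>\<close> is the excess
  of \<open>\<mu>\<close> over its critical value \<open>mustar = 1 / hardy_limit q\<close> and \<open>gap\<close> is a nonnegative convex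
  function on \<open>[0, 1]\<close> with a single zero, a double one. In the logarithmic time \<open>ln k\<close> the orbit
  therefore runs from \<open>1\<close> to \<open>0\<close> with speed \<open>gap + \<eta>\<close>, and the bottleneck at the double zero
  determines how long this takes: \<open>ln N\<close> is the integral of \<open>1 / (gap + \<eta>)\<close> over \<open>[0, 1]\<close>, up to a
  constant and an error \<open>o(sqrt \<eta>)\<close> (\<open>ln_extinction_asymp\<close>). The constant collects the discretisation
  errors, which are made while \<open>k\<close> is small and there depend on \<open>\<eta>\<close> only to higher order.

  A polynomial chart in which \<open>gap\<close> is a pure square up to fifth order gives the integral as
  \<open>a / sqrt \<eta> + const + b * sqrt \<eta> + o(sqrt \<eta>)\<close> with explicit \<open>a\<close> and \<open>b\<close>
  (\<open>total_passage_time_asymp\<close>). Inserting the resulting expansion of \<open>ln N\<close> into the assumed expansion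
  of \<open>hardy_limit q - \<lambda>\<close> leaves three orders to compare: the first yields \<open>A\<^sub>2\<close>, the second, where
  \<open>A\<^sub>3 = 0\<close> enters, shows that \<open>\<kappa>\<close> cancels the unknown constant, and the third yields \<open>A\<^sub>4\<close>
  (\<open>hardy_expansion_coefficients\<close>). This settles all \<open>q \<noteq> 0\<close>; the value \<open>q = 0\<close> follows by continuity
  of the analytic coefficients.
\<close>

section \<open>The tangent-line inequality for powers\<close>

text \<open>
  Bernoulli's inequality for real exponents: a convex power lies above its tangent at \<open>1\<close>. Both the
  reverse Hoelder inequality and the one-step bounds for the recursion are instances of it.
\<close>

lemma powr_ge_tangent:
  fixes x a :: real
  assumes x: "x > 0" and a: "a \<le> 0 \<or> 1 \<le> a"
  shows "1 + a * (x - 1) \<le> x powr a"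
proof -
  have "convex_on {0<..} (\<lambda>x. x powr a)"
  proof (rule f''_ge0_imp_convex)
    show "((\<lambda>x. x powr a) has_real_derivative a * y powr (a - 1)) (at y)"
      if "y \<in> {0<..}" for y
      using that by (auto intro!: derivative_eq_intros)
    show "((\<lambda>x. a * x powr (a - 1)) has_real_derivative a * ((a - 1) * y powr (a - 2))) (at y)"
      if "y \<in> {0<..}" for y
      using that by (auto intro!: derivative_eq_intros simp: algebra_simps)
    show "0 \<le> a * ((a - 1) * y powr (a - 2))" if "y \<in> {0<..}" for y
    proof -
      have "0 \<le> a * (a - 1)" using a by (auto simp: zero_le_mult_iff)
      hence "0 \<le> (a * (a - 1)) * y powr (a - 2)" by (rule mult_nonneg_nonneg) simp
      thus ?thesis by (simp add: mult.assoc)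
    qed
  qed auto
  hence "x powr a - 1 powr a \<ge> a * (x - 1)"
    by (rule convex_on_imp_above_tangent[where c = 1 and A = "{0<..}"])
       (use x in \<open>auto intro!: derivative_eq_intros simp: interior_open\<close>)
  thus ?thesis by simp
qed

section \<open>Peeling off the last entry by reverse Hoelder\<close>

text \<open>
  The power mean with exponent \<open>-q\<close> of \<open>k\<close> copies of \<open>v\<close> and one \<open>1\<close>. The exponent is the conjugate of
  \<open>t = q / (1 + q)\<close>, in the sense that \<open>1 / t + 1 / (- q) = 1\<close>.
\<close>

definition mean_step :: "real \<Rightarrow> nat \<Rightarrow> real \<Rightarrow> real" where
  "mean_step q k v = ((real k * v powr (- q) + 1) / real (Suc k)) powr (- 1 / q)"

text \<open>
  Since \<open>mean_step q 0 v = 1\<close>, the orbit passes through \<open>1 - \<mu>\<close> at index \<open>1\<close>; the value at index \<open>0\<close> only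
  has to be positive.
\<close>

primrec dual_orbit :: "real \<Rightarrow> real \<Rightarrow> nat \<Rightarrow> real" where
  "dual_orbit q \<mu> 0 = 1"
| "dual_orbit q \<mu> (Suc k) = mean_step q k (dual_orbit q \<mu> k) - \<mu> / real (Suc k)"

text \<open>
  The tangent inequality applied to the quotient of the two normalised powers. The exponent \<open>- 1 / q\<close>
  lies outside the interval from \<open>0\<close> to \<open>1\<close> for all admissible \<open>q\<close>, which is why the inequality goes in the
  direction opposite to Young's.
\<close>

lemma reverse_young:
  fixes q f g A B :: real
  assumes q: "q > -1" "q \<noteq> 0" and pos: "f > 0" "g > 0" "A > 0" "B > 0"
  defines "t \<equiv> q / (1 + q)"
  shows "A powr (-1/q) * B powr (1/t) * ((1 + 1/q) * (g powr t / B) - (1/q) * (f powr (-q) / A)) \<le> f * g"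
proof -
  define y where "y = (f powr (-q) / A) / (g powr t / B)"
  define R where "R = A powr (-1/q) * B powr (1/t)"
  have y: "y > 0" and R: "R > 0" using pos by (auto simp: y_def R_def)
  have exponent: "-1/q \<le> 0 \<or> 1 \<le> -1/q" using q by (cases "q > 0") (auto simp: field_simps)
  have "1 + (-1/q) * (y - 1) \<le> y powr (-1/q)" by (rule powr_ge_tangent[OF y exponent])
  hence "R * (g powr t / B) * (1 + (-1/q) * (y - 1)) \<le> R * (g powr t / B) * y powr (-1/q)"
    using R pos by (intro mult_left_mono) auto
  moreover have "R * (g powr t / B) * (1 + (-1/q) * (y - 1))
      = R * ((1 + 1/q) * (g powr t / B) - (1/q) * (f powr (-q) / A))"
    using pos q by (simp add: y_def field_simps)
  moreover have "R * (g powr t / B) * y powr (-1/q) = f * g"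
  proof -
    have q1: "1 + 1/q = (1 + q) / q" using q by (simp add: field_simps)
    have t: "1 / t = 1 + 1/q" "t * (1 + 1/q) = 1" unfolding q1 t_def using q by simp_all
    have "ln (R * (g powr t / B) * y powr (-1/q)) = (-1/q) * ln A + (1 + 1/q) * ln B + (t * ln g - ln B)
            + (-1/q) * ((- q * ln f - ln A) - (t * ln g - ln B))"
      using pos y R unfolding R_def y_def by (simp add: ln_mult ln_div t(1))
    also have "\<dots> = ln f + (t * (1 + 1/q)) * ln g" using q by (simp add: field_simps)
    also have "\<dots> = ln (f * g)" using pos unfolding t(2) by (simp add: ln_mult)
    finally have "ln (R * (g powr t / B) * y powr (-1/q)) = ln (f * g)" .
    thus ?thesis using pos y R by (subst (asm) ln_inj_iff) auto
  qed
  ultimately show ?thesis by (simp add: R_def)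
qed

text \<open>
  The coefficients \<open>1 + 1/q\<close> and \<open>- 1/q\<close> in \<open>reverse_young\<close> add up to \<open>1\<close>; so averaging it over \<open>k\<close>
  copies of the pair \<open>(v, M)\<close> and the pair \<open>(1, x)\<close> replaces the normalised powers by \<open>1\<close>.
\<close>

lemma reverse_holder_step:
  fixes q v M x :: real and k :: nat
  assumes q: "q > -1" "q \<noteq> 0" and pos: "v > 0" "M > 0" "x > 0"
  defines "t \<equiv> q / (1 + q)"
  shows "real (Suc k) * mean_step q k v * ((real k * M powr t + x powr t) / real (Suc k)) powr (1/t)
           \<le> real k * v * M + x"
proof -
  define A where "A = (real k * v powr (- q) + 1) / real (Suc k)"
  define B where "B = (real k * M powr t + x powr t) / real (Suc k)"
  define R where "R = A powr (-1/q) * B powr (1/t)"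
  have AB: "A > 0" "B > 0" unfolding A_def B_def
    by (intro divide_pos_pos add_nonneg_pos mult_nonneg_nonneg; use pos in simp)+
  have 1: "R * ((1 + 1/q) * (M powr t / B) - (1/q) * (v powr (-q) / A)) \<le> v * M"
    unfolding R_def t_def by (rule reverse_young) (use q pos AB in auto)
  have 2: "R * ((1 + 1/q) * (x powr t / B) - (1/q) * (1 powr (-q) / A)) \<le> 1 * x"
    unfolding R_def t_def by (rule reverse_young) (use q pos AB in auto)
  have "real k * (R * ((1 + 1/q) * (M powr t / B) - (1/q) * (v powr (-q) / A)))
          + R * ((1 + 1/q) * (x powr t / B) - (1/q) * (1 powr (-q) / A))
      = R * ((1 + 1/q) * ((real k * M powr t + x powr t) / B) - (1/q) * ((real k * v powr (-q) + 1) / A))"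
    using AB q by (simp add: field_simps)
  also have "(real k * M powr t + x powr t) / B = real (Suc k)"
    using AB by (simp add: B_def field_simps)
  also have "(real k * v powr (-q) + 1) / A = real (Suc k)"
    using AB by (simp add: A_def field_simps)
  also have "R * ((1 + 1/q) * real (Suc k) - (1/q) * real (Suc k)) = real (Suc k) * R"
    using q by (simp add: field_simps)
  finally have "real (Suc k) * R \<le> real k * (v * M) + 1 * x"
    using mult_left_mono[OF 1, of "real k"] 2 by linarith
  thus ?thesis by (simp add: R_def A_def B_def mean_step_def mult.assoc)
qed

text \<open>
  Equality holds as soon as the normalised powers of both pairs agree, which singles out
  \<open>x = M * v powr (1 + q)\<close>.
\<close>

lemma reverse_holder_step_eq:
  fixes q v M :: real and k :: nat
  assumes q: "q > -1" "q \<noteq> 0" and pos: "v > 0" "M > 0"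
  defines "t \<equiv> q / (1 + q)"
  defines "x \<equiv> M * v powr (1 + q)"
  shows "real (Suc k) * mean_step q k v * ((real k * M powr t + x powr t) / real (Suc k)) powr (1/t)
           = real k * v * M + x"
proof -
  define A where "A = (real k * v powr (- q) + 1) / real (Suc k)"
  have A: "A > 0" unfolding A_def by (intro divide_pos_pos add_nonneg_pos mult_nonneg_nonneg) auto
  have xt: "x powr t = M powr t * v powr q"
    using pos q by (simp add: x_def t_def powr_mult powr_powr)
  have v1: "v powr q * v powr (-q) = 1" using pos by (simp flip: powr_add)
  have B: "(real k * M powr t + x powr t) / real (Suc k) = M powr t * v powr q * A"
    unfolding xt A_def by (simp add: field_simps) (use v1 in simp)
  have "A powr (-1/q) * (M powr t * v powr q * A) powr (1/t) = M * v powr (1 + q) * A"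
  proof -
    have q1: "1 + 1/q = (1 + q) / q" using q by (simp add: field_simps)
    have t: "1 / t = 1 + 1/q" "t / t = 1" "q / t = 1 + q" unfolding q1 t_def using q by simp_all
    have "ln (A powr (-1/q) * (M powr t * v powr q * A) powr (1/t))
        = (-1/q) * ln A + (1/t) * (t * ln M + q * ln v + ln A)"
      using pos A by (simp add: ln_mult)
    also have "\<dots> = (1/t - 1/q) * ln A + (t / t) * ln M + (q / t) * ln v"
      by (simp add: ring_distribs add_divide_distrib)
    also have "\<dots> = ln (M * v powr (1 + q) * A)"
      unfolding t using pos A by (simp add: ln_mult)
    finally have "ln (A powr (-1/q) * (M powr t * v powr q * A) powr (1/t)) = ln (M * v powr (1 + q) * A)" .
    thus ?thesis using pos A by (subst (asm) ln_inj_iff) auto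
  qed
  moreover have "real (Suc k) * (M * v powr (1 + q) * A) = real k * v * M + x"
  proof -
    have "v powr (1 + q) * v powr (-q) = v" using pos by (simp flip: powr_add)
    thus ?thesis unfolding A_def x_def by (simp add: field_simps)
  qed
  ultimately show ?thesis unfolding B unfolding mean_step_def A_def[symmetric] by (simp add: mult.assoc)
qed

lemma power_mean_pos:
  assumes "n \<ge> 1" "\<And>k. k \<in> {1..n} \<Longrightarrow> x k > 0"
  shows "power_mean t n x > 0"
proof -
  have "x k powr t > 0" if "k \<in> {1..n}" for k using assms(2)[OF that] by simp
  hence "(\<Sum>k=1..n. x k powr t) > 0" using assms by (intro sum_pos) auto
  moreover have "(\<Prod>k=1..n. x k) > 0" using assms by (intro prod_pos) auto
  moreover have "0 < y / n" if "0 < y" for y :: real using that assms(1) by simp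
  ultimately show ?thesis unfolding power_mean_def by (simp only: powr_gt_zero split: if_split) (metis less_irrefl)
qed

lemma power_mean_Suc:
  assumes t: "t \<noteq> 0" and x: "\<And>j. j \<in> {1..Suc k} \<Longrightarrow> x j > 0"
  shows "power_mean t (Suc k) x
           = ((real k * power_mean t k x powr t + x (Suc k) powr t) / real (Suc k)) powr (1/t)"
proof (cases "k = 0")
  case False
  have "x j powr t > 0" if "j \<in> {1..k}" for j using x[of j] that by simp
  hence "(\<Sum>j=1..k. x j powr t) > 0" using False by (intro sum_pos) auto
  hence "real k * power_mean t k x powr t = (\<Sum>j=1..k. x j powr t)"
    using t False by (simp add: power_mean_def powr_powr)
  thus ?thesis using t by (simp add: power_mean_def)
qed (use t in \<open>simp add: power_mean_def\<close>)

text \<open>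
  Dynamic programming over the number of entries: for fixed mean \<open>M\<close> of the first \<open>k\<close> entries the bound
  \<open>k * v * M\<close> is all that has to be remembered of them, and \<open>reverse_holder_step\<close> minimises over the
  next entry. The sign of the last \<open>dual_orbit\<close> value decides the sign of the lower bound.
\<close>

lemma sum_minus_power_means_ge:
  fixes q \<mu> :: real
  assumes q: "q > -1" "q \<noteq> 0" and x: "\<And>j. j \<in> {1..k} \<Longrightarrow> x j > 0"
    and orbit: "\<And>j. j < k \<Longrightarrow> dual_orbit q \<mu> j > 0"
  defines "t \<equiv> q / (1 + q)"
  shows "real k * dual_orbit q \<mu> k * power_mean t k x \<le> (\<Sum>n=1..k. x n - \<mu> * power_mean t n x)"
  using x orbit
proof (induction k)
  case (Suc k)
  define v where "v = dual_orbit q \<mu> k"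
  define M where "M = power_mean t k x"
  define M' where "M' = power_mean t (Suc k) x"
  have t: "t \<noteq> 0" using q by (simp add: t_def)
  have v: "v > 0" using Suc.prems(2) by (simp add: v_def)
  have M': "M' = ((real k * M powr t + x (Suc k) powr t) / real (Suc k)) powr (1/t)"
    unfolding M'_def M_def by (rule power_mean_Suc[OF t Suc.prems(1)])
  have "real (Suc k) * mean_step q k v * M' \<le> real k * v * M + x (Suc k)"
  proof (cases "k = 0")
    case True
    thus ?thesis using Suc.prems(1)[of 1] t by (simp add: M' mean_step_def powr_powr)
  next
    case False
    have "M > 0" unfolding M_def using False Suc.prems(1) by (intro power_mean_pos) auto
    thus ?thesis unfolding M' t_def
      by (intro reverse_holder_step q v) (use Suc.prems(1) in auto)
  qed
  moreover have "real k * v * M \<le> (\<Sum>n=1..k. x n - \<mu> * power_mean t n x)"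
    unfolding v_def M_def by (rule Suc.IH) (use Suc.prems in auto)
  moreover have "real (Suc k) * dual_orbit q \<mu> (Suc k) * M' = real (Suc k) * mean_step q k v * M' - \<mu> * M'"
    by (simp add: v_def field_simps del: of_nat_Suc)
  ultimately show ?case by (simp add: M'_def del: dual_orbit.simps of_nat_Suc)
qed simp

text \<open>
  The minimiser of each step of the dynamic program, chained together; it shows that
  \<open>sum_minus_power_means_ge\<close> is sharp.
\<close>

lemma extremal_tuple_exists:
  fixes q \<mu> :: real
  assumes q: "q > -1" "q \<noteq> 0" and orbit: "\<And>j. j < k \<Longrightarrow> dual_orbit q \<mu> j > 0"
  defines "t \<equiv> q / (1 + q)"
  shows "\<exists>x. (\<forall>n. x n > 0) \<and>
           (\<Sum>n=1..k. x n - \<mu> * power_mean t n x) = real k * dual_orbit q \<mu> k * power_mean t k x"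
  using orbit
proof (induction k)
  case (Suc k)
  have t: "t \<noteq> 0" using q by (simp add: t_def)
  obtain x where x: "\<And>n. x n > 0" and eq:
    "(\<Sum>n=1..k. x n - \<mu> * power_mean t n x) = real k * dual_orbit q \<mu> k * power_mean t k x"
    using Suc.IH Suc.prems by auto
  define v where "v = dual_orbit q \<mu> k"
  have v: "v > 0" using Suc.prems by (simp add: v_def)
  define M where "M = (if k = 0 then 1 else power_mean t k x)"
  have M: "M > 0" using x by (auto simp: M_def intro!: power_mean_pos)
  define y where "y = x(Suc k := M * v powr (1 + q))"
  have y: "y n > 0" for n using x M v by (simp add: y_def)
  have same: "power_mean t n y = power_mean t n x" if "n \<le> k" for n
  proof -
    have *: "y j = x j" if "j \<in> {1..n}" for j using that \<open>n \<le> k\<close> by (auto simp: y_def)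
    have "(\<Sum>j=1..n. y j powr t) = (\<Sum>j=1..n. x j powr t)" by (intro sum.cong) (auto simp: *)
    thus ?thesis using t by (simp add: power_mean_def)
  qed
  define M' where "M' = power_mean t (Suc k) y"
  have M': "M' = ((real k * M powr t + y (Suc k) powr t) / real (Suc k)) powr (1/t)"
    unfolding M'_def using y power_mean_Suc[OF t, of k y] same[of k] by (simp add: M_def)
  have "real (Suc k) * mean_step q k v * M' = real k * v * M + y (Suc k)"
    unfolding M' using reverse_holder_step_eq[OF q v M, of k] by (simp add: y_def t_def)
  moreover have "(\<Sum>n=1..k. y n - \<mu> * power_mean t n y) = real k * v * M"
  proof -
    have "(\<Sum>n=1..k. y n - \<mu> * power_mean t n y) = (\<Sum>n=1..k. x n - \<mu> * power_mean t n x)"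
      by (intro sum.cong) (auto simp: same, auto simp: y_def)
    thus ?thesis using eq by (simp add: v_def M_def)
  qed
  moreover have "real (Suc k) * dual_orbit q \<mu> (Suc k) * M' = real (Suc k) * mean_step q k v * M' - \<mu> * M'"
    by (simp add: v_def field_simps del: of_nat_Suc)
  ultimately have "(\<Sum>n=1..Suc k. y n - \<mu> * power_mean t n y)
      = real (Suc k) * dual_orbit q \<mu> (Suc k) * power_mean t (Suc k) y"
    by (simp add: M'_def del: dual_orbit.simps of_nat_Suc)
  thus ?case using y by blast
qed (auto intro!: exI[of _ "\<lambda>_. 1"])

lemma hardy_const_le:
  fixes q \<mu> :: real
  assumes q: "q > -1" "q \<noteq> 0" and \<mu>: "\<mu> > 0" and N: "N \<ge> 1"
    and orbit: "\<And>j. j \<le> N \<Longrightarrow> dual_orbit q \<mu> j > 0"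
  shows "hardy_lambda N q \<le> 1 / \<mu>"
  unfolding hardy_lambda_def hardy_const_def
proof (rule cSUP_least[OF pos_tuples_nonempty])
  fix x assume "x \<in> pos_tuples N"
  hence x: "\<And>j. j \<in> {1..N} \<Longrightarrow> x j > 0" by (auto simp: pos_tuples_def)
  let ?t = "q / (1 + q)"
  have "0 \<le> real N * dual_orbit q \<mu> N * power_mean ?t N x"
    using orbit[of N] power_mean_pos[OF N x] by (intro mult_nonneg_nonneg) (auto intro: less_imp_le)
  also have "\<dots> \<le> (\<Sum>n=1..N. x n - \<mu> * power_mean ?t n x)"
    by (rule sum_minus_power_means_ge[OF q]) (use x orbit in auto)
  finally have "\<mu> * (\<Sum>n=1..N. power_mean ?t n x) \<le> (\<Sum>n=1..N. x n)"
    by (simp add: sum_subtractf sum_distrib_left)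
  moreover have "(\<Sum>n=1..N. x n) > 0" using N x by (intro sum_pos) auto
  ultimately show "(\<Sum>n=1..N. power_mean ?t n x) / (\<Sum>n=1..N. x n) \<le> 1 / \<mu>"
    using \<mu> by (simp add: field_simps)
qed

lemma hardy_const_ge:
  fixes q \<mu> :: real
  assumes q: "q > -1" "q \<noteq> 0" and \<mu>: "\<mu> > 0" and k: "1 \<le> k" "k \<le> N"
    and orbit: "\<And>j. j < k \<Longrightarrow> dual_orbit q \<mu> j > 0" and last: "dual_orbit q \<mu> k \<le> 0"
  shows "1 / \<mu> \<le> hardy_lambda N q"
proof -
  let ?t = "q / (1 + q)"
  obtain x where x: "\<And>n. x n > 0" and eq:
    "(\<Sum>n=1..k. x n - \<mu> * power_mean ?t n x) = real k * dual_orbit q \<mu> k * power_mean ?t k x"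
    using extremal_tuple_exists[OF q orbit] by blast
  have pm: "power_mean ?t n y > 0" if "n \<ge> 1" "\<And>n. y n > 0" for n y
    using that by (intro power_mean_pos) auto
  define S where "S = (\<Sum>n=1..k. x n)"
  define T where "T = (\<Sum>n=1..k. power_mean ?t n x)"
  have S: "S > 0" unfolding S_def using k x by (intro sum_pos) auto
  have "real k * dual_orbit q \<mu> k * power_mean ?t k x \<le> 0"
    using last pm[of k x] k x by (intro mult_nonpos_nonneg mult_nonneg_nonpos) (auto intro: less_imp_le)
  hence ST: "S \<le> \<mu> * T" using eq by (simp add: S_def T_def sum_subtractf sum_distrib_left)
  hence T: "T > 0" using S \<mu> by (smt (verit) zero_less_mult_pos)
  define e where "e = hardy_lambda N q"
  \<comment> \<open>continue the extremal \<open>k\<close>-tuple by constant entries \<open>d\<close> and let \<open>d\<close> tend to \<open>0\<close>\<close>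
  have bound: "T / (S + real N * d) \<le> e" if d: "d > 0" for d
  proof -
    define y where "y n = (if n \<le> k then x n else d)" for n
    have y: "y n > 0" for n using x d by (simp add: y_def)
    have sub: "{1..N} = {1..k} \<union> {k+1..N}" "{1..k} \<inter> {k+1..N} = {}" using k by auto
    have "power_mean ?t n y = power_mean ?t n x" if "n \<le> k" for n
    proof -
      have "(\<Sum>j=1..n. y j powr ?t) = (\<Sum>j=1..n. x j powr ?t)"
        using that by (intro sum.cong) (auto simp: y_def)
      thus ?thesis using q by (simp add: power_mean_def)
    qed
    hence "T = (\<Sum>n=1..k. power_mean ?t n y)" unfolding T_def by (intro sum.cong) auto
    also have "\<dots> \<le> (\<Sum>n=1..N. power_mean ?t n y)"
      using k y by (intro sum_mono2 less_imp_le[OF pm]) auto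
    finally have Tle: "T \<le> (\<Sum>n=1..N. power_mean ?t n y)" .
    have "(\<Sum>n=1..N. y n) = S + (\<Sum>n=k+1..N. d)"
      unfolding S_def sub(1) by (subst sum.union_disjoint) (auto simp: y_def)
    also have "\<dots> \<le> S + real N * d" using d by (simp add: of_nat_diff k)
    finally have Sle: "(\<Sum>n=1..N. y n) \<le> S + real N * d" .
    have Spos: "(\<Sum>n=1..N. y n) > 0" using k y by (intro sum_pos) auto
    have "T / (S + real N * d) \<le> (\<Sum>n=1..N. power_mean ?t n y) / (\<Sum>n=1..N. y n)"
      using Tle Sle Spos T by (intro frac_le) auto
    also have "\<dots> \<le> e"
      unfolding e_def hardy_lambda_def hardy_const_def
      by (rule cSUP_upper[OF _ hardy_quotients_bdd_above]) (use y in \<open>auto simp: pos_tuples_def\<close>)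
    finally show ?thesis .
  qed
  have "((\<lambda>d. T / (S + real N * d)) \<longlongrightarrow> T / (S + real N * 0)) (at_right 0)"
    using S by (intro tendsto_intros) auto
  hence "T / S \<le> e"
    by (intro tendsto_upperbound[where F = "at_right 0"])
       (auto simp: eventually_at_right_less intro!: eventually_mono[OF eventually_at_right_less] bound)
  moreover have "1 / \<mu> \<le> T / S" using ST S \<mu> by (simp add: field_simps)
  ultimately show ?thesis by (simp add: e_def)
qed

section \<open>The limiting drift and its double zero\<close>

text \<open>
  The exponent \<open>q = 0\<close>, where power means degenerate to geometric means, is reached at the end as a limit.
\<close>

locale hardy_parameter =
  fixes q :: real
  assumes q_gt: "q > -1" and q_nz: "q \<noteq> 0"
begin

text \<open>
  For large \<open>k\<close> the displacement \<open>mean_step q k v - v\<close> is about \<open>drift v / (k + 1)\<close>. The drift attains its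
  maximum \<open>mustar = 1 / hardy_limit q\<close> at \<open>wstar\<close>, and \<open>gap\<close> measures how far it stays below this maximum;
  so the orbit for \<open>\<mu> = mustar + \<eta>\<close> descends with speed \<open>gap + \<eta>\<close> in the time \<open>ln k\<close>.
\<close>

definition wstar :: real where "wstar = (1 + q) powr (- 1 / q)"
definition mustar :: real where "mustar = wstar / (1 + q)"
definition drift :: "real \<Rightarrow> real" where "drift v = (v - v powr (q + 1)) / q"
definition gap :: "real \<Rightarrow> real" where "gap v = mustar - drift v"
definition gap' :: "real \<Rightarrow> real" where "gap' v = ((q + 1) * v powr q - 1) / q"

lemma wstar_pos: "wstar > 0" and mustar_pos: "mustar > 0"
  using q_gt by (auto simp: wstar_def mustar_def)

lemma wstar_powr: "wstar powr q = 1 / (1 + q)"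
  unfolding wstar_def powr_powr using q_gt q_nz by (simp add: powr_minus_divide)

lemma powr_q_mono_sign:
  assumes "0 < u" "u < v"
  shows "u powr q / q < v powr q / q"
proof (cases "q > 0")
  case True
  thus ?thesis using assms by (simp add: divide_strict_right_mono powr_less_mono2)
next
  case False
  hence "v powr q < u powr q" using assms q_nz by (intro powr_less_mono2_neg) auto
  thus ?thesis using False q_nz by (simp add: divide_strict_right_mono_neg)
qed

lemma gap'_strict_mono:
  assumes "0 < u" "u < v"
  shows "gap' u < gap' v"
proof -
  have "(q + 1) * (u powr q / q) < (q + 1) * (v powr q / q)"
    by (rule mult_strict_left_mono[OF powr_q_mono_sign[OF assms]]) (use q_gt in auto)
  thus ?thesis by (simp add: gap'_def diff_divide_distrib)
qed

lemma gap'_wstar: "gap' wstar = 0" and gap'_1: "gap' 1 = 1"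
  using q_gt q_nz by (auto simp: gap'_def wstar_powr)

lemma wstar_less_1: "wstar < 1"
proof (rule ccontr)
  assume "\<not> wstar < 1"
  hence "wstar = 1 \<or> gap' 1 < gap' wstar" using gap'_strict_mono[of 1 wstar] by force
  thus False using gap'_wstar gap'_1 by auto
qed

lemma gap_deriv: "v > 0 \<Longrightarrow> (gap has_real_derivative gap' v) (at v)"
  unfolding gap_def[abs_def] drift_def[abs_def] gap'_def using q_nz
  by (auto intro!: derivative_eq_intros simp: field_simps)

lemma continuous_on_gap: "continuous_on {0..} gap"
  unfolding gap_def[abs_def] drift_def[abs_def] using q_gt q_nz
  by (auto intro!: continuous_intros continuous_on_powr')

lemma gap_wstar: "gap wstar = 0"
proof -
  have "wstar powr (q + 1) = wstar / (1 + q)"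
    using wstar_pos by (simp add: powr_add wstar_powr)
  thus ?thesis using q_gt q_nz by (simp add: gap_def drift_def mustar_def field_simps)
qed

lemma gap_1: "gap 1 = mustar" and gap_0: "gap 0 = mustar"
  using q_gt by (simp_all add: gap_def drift_def)

lemma gap_mvt:
  assumes "0 \<le> u" "u < v"
  obtains z where "u < z" "z < v" "gap v - gap u = (v - u) * gap' z"
proof -
  have "\<exists>l z. u < z \<and> z < v \<and> DERIV gap z :> l \<and> gap v - gap u = (v - u) * l"
  proof (rule MVT)
    show "gap differentiable (at x)" if "u < x" "x < v" for x
      unfolding real_differentiable_def using gap_deriv[of x] that assms by auto
  qed (use assms in \<open>auto intro!: continuous_on_subset[OF continuous_on_gap]\<close>)
  then obtain l z where z: "u < z" "z < v" "DERIV gap z :> l" "gap v - gap u = (v - u) * l" by blast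
  moreover have "l = gap' z" using z assms by (intro DERIV_unique[OF z(3) gap_deriv]) auto
  ultimately show ?thesis using that by blast
qed

lemma gap_strict_mono: "wstar \<le> u \<Longrightarrow> u < v \<Longrightarrow> gap u < gap v"
  using wstar_pos gap'_wstar gap'_strict_mono
  by (smt (verit) gap_mvt zero_less_mult_iff)

lemma gap_mono: "wstar \<le> u \<Longrightarrow> u \<le> v \<Longrightarrow> gap u \<le> gap v"
  using gap_strict_mono by (cases "u = v") (auto intro: less_imp_le)

lemma gap_strict_antimono: "0 \<le> u \<Longrightarrow> u < v \<Longrightarrow> v \<le> wstar \<Longrightarrow> gap v < gap u"
proof -
  assume *: "0 \<le> u" "u < v" "v \<le> wstar"
  obtain z where z: "u < z" "z < v" "gap v - gap u = (v - u) * gap' z" using gap_mvt * by blast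
  have "gap' z < 0" using gap'_strict_mono[of z wstar] gap'_wstar z * by auto
  hence "(v - u) * gap' z < 0" using * by (simp add: mult_pos_neg)
  thus ?thesis using z by simp
qed

lemma gap_pos: "0 \<le> v \<Longrightarrow> v \<noteq> wstar \<Longrightarrow> gap v > 0"
  using gap_strict_mono[of wstar v] gap_strict_antimono[of v wstar] gap_wstar by (cases v wstar rule: linorder_cases) auto

lemma gap_nonneg: "0 \<le> v \<Longrightarrow> gap v \<ge> 0"
  using gap_pos[of v] gap_wstar by (cases "v = wstar") auto

lemma gap_le_mustar:
  assumes "0 \<le> v" "v \<le> 1" shows "gap v \<le> mustar"
proof (cases "v \<le> wstar")
  case True
  thus ?thesis using gap_strict_antimono[of 0 v] gap_0 assms by (cases "v = 0") auto
next
  case False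
  thus ?thesis using gap_mono[of v 1] gap_1 assms by auto
qed

lemma drift_nonneg: "0 \<le> v \<Longrightarrow> v \<le> 1 \<Longrightarrow> drift v \<ge> 0"
  using gap_le_mustar[of v] by (simp add: gap_def)

lemma drift_neg: "1 < v \<Longrightarrow> drift v < 0"
  using gap_strict_mono[of 1 v] gap_1 wstar_less_1 by (simp add: gap_def)

lemma drift_le_mustar: "0 \<le> v \<Longrightarrow> drift v \<le> mustar"
  using gap_nonneg[of v] by (simp add: gap_def)

text \<open>
  The derivative of \<open>gap\<close> increases and reaches the value \<open>1\<close> only at \<open>1\<close>. This is what keeps the
  critical orbit above \<open>wstar\<close> from the very first step.
\<close>

lemma gap_less_linear:
  assumes "wstar < v" "v \<le> 1"
  shows "gap v < v - wstar"
proof -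
  obtain z where z: "wstar < z" "z < v" "gap v - gap wstar = (v - wstar) * gap' z"
    using gap_mvt[of wstar v] wstar_pos assms by auto
  have "gap' z < 1" using gap'_strict_mono[of z 1] gap'_1 z assms wstar_pos by auto
  hence "(v - wstar) * gap' z < (v - wstar) * 1" using assms by (intro mult_strict_left_mono) auto
  thus ?thesis using z gap_wstar by simp
qed

text \<open>
  The zero of \<open>gap\<close> at \<open>wstar\<close> is exactly double: \<open>gap\<close> minus a small and a large multiple of the square
  is convex and concave, respectively, with horizontal tangent at \<open>wstar\<close>.
\<close>

lemma gap_quadratic:
  obtains a B where "a > 0" "B > 0"
    "\<And>v. wstar \<le> v \<Longrightarrow> v \<le> 1 \<Longrightarrow> a * (v - wstar)^2 \<le> gap v"
    "\<And>v. wstar \<le> v \<Longrightarrow> v \<le> 1 \<Longrightarrow> gap v \<le> B * (v - wstar)^2"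
proof -
  define gap'' where "gap'' v = (q + 1) * v powr (q - 1)" for v
  have d2: "(gap' has_real_derivative gap'' v) (at v)" if "v > 0" for v
    unfolding gap'_def[abs_def] gap''_def using that q_nz
    by (auto intro!: derivative_eq_intros simp: field_simps)
  define I where "I = {wstar / 2 .. 1}"
  have cont: "continuous_on I gap''"
    unfolding gap''_def[abs_def] I_def using wstar_pos by (intro continuous_intros) auto
  have I: "compact I" "I \<noteq> {}" "wstar \<in> I" "convex I" "connected I"
    using wstar_less_1 wstar_pos by (auto simp: I_def)
  have pos: "gap'' v > 0" if "v \<in> I" for v using that q_gt wstar_pos by (auto simp: gap''_def I_def)
  obtain v1 where v1: "v1 \<in> I" "\<And>v. v \<in> I \<Longrightarrow> gap'' v1 \<le> gap'' v"
    using continuous_attains_inf[OF I(1,2) cont] by blast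
  obtain v2 where v2: "v2 \<in> I" "\<And>v. v \<in> I \<Longrightarrow> gap'' v \<le> gap'' v2"
    using continuous_attains_sup[OF I(1,2) cont] by blast
  have int: "wstar \<in> interior I" using wstar_less_1 wstar_pos by (simp add: I_def interior_atLeastAtMost_real)
  define a where "a = gap'' v1 / 2"
  define B where "B = gap'' v2 / 2"
  have low: "a * (v - wstar)^2 \<le> gap v" if v: "v \<in> I" for v
  proof -
    define f where "f x = gap x - a * (x - wstar)^2" for x
    have "convex_on I f"
    proof (rule f''_ge0_imp_convex[OF I(4)])
      show "(f has_real_derivative gap' x - 2 * a * (x - wstar)) (at x)" if "x \<in> I" for x
        unfolding f_def using that wstar_pos
        by (auto intro!: derivative_eq_intros gap_deriv simp: I_def)
      show "((\<lambda>x. gap' x - 2 * a * (x - wstar)) has_real_derivative gap'' x - 2 * a) (at x)"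
        if "x \<in> I" for x
        using that wstar_pos by (auto intro!: derivative_eq_intros d2 simp: I_def)
      show "0 \<le> gap'' x - 2 * a" if "x \<in> I" for x using v1(2)[OF that] by (simp add: a_def)
    qed
    hence "f v - f wstar \<ge> 0 * (v - wstar)"
    proof (rule convex_on_imp_above_tangent[OF _ I(5) int v])
      have "(f has_real_derivative 0) (at wstar)"
        unfolding f_def using wstar_pos by (auto intro!: derivative_eq_intros gap_deriv simp: gap'_wstar)
      thus "(f has_real_derivative 0) (at wstar within I)"
        by (rule has_field_derivative_at_within)
    qed
    thus ?thesis by (simp add: f_def gap_wstar)
  qed
  have up: "gap v \<le> B * (v - wstar)^2" if v: "v \<in> I" for v
  proof -
    define f where "f x = B * (x - wstar)^2 - gap x" for x
    have "convex_on I f"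
    proof (rule f''_ge0_imp_convex[OF I(4)])
      show "(f has_real_derivative 2 * B * (x - wstar) - gap' x) (at x)" if "x \<in> I" for x
        unfolding f_def using that wstar_pos
        by (auto intro!: derivative_eq_intros gap_deriv simp: I_def)
      show "((\<lambda>x. 2 * B * (x - wstar) - gap' x) has_real_derivative 2 * B - gap'' x) (at x)"
        if "x \<in> I" for x
        using that wstar_pos by (auto intro!: derivative_eq_intros d2 simp: I_def)
      show "0 \<le> 2 * B - gap'' x" if "x \<in> I" for x using v2(2)[OF that] by (simp add: B_def)
    qed
    hence "f v - f wstar \<ge> 0 * (v - wstar)"
    proof (rule convex_on_imp_above_tangent[OF _ I(5) int v])
      have "(f has_real_derivative 0) (at wstar)"
        unfolding f_def using wstar_pos by (auto intro!: derivative_eq_intros gap_deriv simp: gap'_wstar)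
      thus "(f has_real_derivative 0) (at wstar within I)"
        by (rule has_field_derivative_at_within)
    qed
    thus ?thesis by (simp add: f_def gap_wstar)
  qed
  show ?thesis
  proof (rule that)
    show "a > 0" "B > 0" using pos v1(1) v2(1) by (auto simp: a_def B_def)
  qed (use low up wstar_pos in \<open>auto simp: I_def\<close>)
qed

text \<open>
  The factor \<open>1 / \<delta>\<close> is the price for \<open>q < 0\<close>, where the derivative of \<open>gap\<close> is unbounded near \<open>0\<close>.
\<close>

lemma gap_lipschitz:
  obtains C where "C > 0"
    "\<And>\<delta> u v. 0 < \<delta> \<Longrightarrow> \<delta> \<le> u \<Longrightarrow> \<delta> \<le> v \<Longrightarrow> u \<le> 1 \<Longrightarrow> v \<le> 1 \<Longrightarrow> \<bar>gap u - gap v\<bar> \<le> C / \<delta> * \<bar>u - v\<bar>"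
proof -
  define C where "C = ((q + 1) + 1) / \<bar>q\<bar>"
  have C: "C > 0" using q_gt q_nz by (simp add: C_def)
  have bound: "\<bar>gap' z\<bar> \<le> C / \<delta>" if z: "0 < \<delta>" "\<delta> \<le> z" "z \<le> 1" for \<delta> z
  proof -
    have "z powr q \<le> z powr (-1)" using z q_gt by (intro powr_mono') auto
    also have "\<dots> \<le> 1 / \<delta>" using z by (simp add: powr_minus_divide frac_le)
    finally have 1: "(q + 1) * z powr q \<le> (q + 1) * (1 / \<delta>)"
      using q_gt by (intro mult_left_mono) auto
    have "1 \<le> 1 / \<delta>" using z by simp
    moreover have "0 \<le> (q + 1) * z powr q" using q_gt by simp
    ultimately have "\<bar>(q + 1) * z powr q - 1\<bar> \<le> (q + 1) * (1 / \<delta>) + 1 / \<delta>"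
      using 1 by linarith
    also have "\<dots> = ((q + 1) + 1) / \<delta>" by (simp add: add_divide_distrib)
    finally have "\<bar>(q + 1) * z powr q - 1\<bar> / \<bar>q\<bar> \<le> ((q + 1) + 1) / \<delta> / \<bar>q\<bar>"
      by (intro divide_right_mono) auto
    thus ?thesis by (simp add: gap'_def C_def abs_divide mult.commute)
  qed
  have less: "\<bar>gap v - gap u\<bar> \<le> C / \<delta> * (v - u)"
    if uv: "0 < \<delta>" "\<delta> \<le> u" "u < v" "v \<le> 1" for \<delta> u v
  proof -
    obtain z where z: "u < z" "z < v" "gap v - gap u = (v - u) * gap' z"
      using gap_mvt[of u v] uv by auto
    have "\<bar>gap v - gap u\<bar> = (v - u) * \<bar>gap' z\<bar>" using uv by (simp add: z(3) abs_mult)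
    also have "\<dots> \<le> (v - u) * (C / \<delta>)" using uv z bound[of \<delta> z] by (intro mult_left_mono) auto
    finally show ?thesis by (simp add: mult.commute)
  qed
  show ?thesis
  proof (rule that[OF C])
    fix \<delta> u v :: real
    assume *: "0 < \<delta>" "\<delta> \<le> u" "\<delta> \<le> v" "u \<le> 1" "v \<le> 1"
    show "\<bar>gap u - gap v\<bar> \<le> C / \<delta> * \<bar>u - v\<bar>"
      using less[of \<delta> u v] less[of \<delta> v u] * by (cases u v rule: linorder_cases) (auto simp: abs_minus_commute)
  qed
qed

lemma hardy_limit_eq: "hardy_limit q = 1 / mustar"
proof -
  have "(1 + q) / q = 1 + 1/q" using q_nz by (simp add: field_simps)
  hence "hardy_limit q = (1 + q) * (1 + q) powr (1/q)"
    using q_gt q_nz by (simp add: hardy_limit_def powr_add)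
  also have "\<dots> = 1 / mustar" using q_gt by (simp add: mustar_def wstar_def powr_minus_divide)
  finally show ?thesis .
qed

end

section \<open>One step of the dual recursion\<close>

context hardy_parameter
begin

lemma mean_step_pos: "mean_step q k v > 0"
proof -
  have "(real k * v powr (- q) + 1) / real (Suc k) > 0" by (intro divide_pos_pos add_nonneg_pos) auto
  thus ?thesis unfolding mean_step_def powr_gt_zero by (metis less_irrefl)
qed

lemma exponent_ok: "-1/q \<le> 0 \<or> 1 \<le> -1/q" "1 + 1/q \<le> 0 \<or> 1 \<le> 1 + 1/q"
  using q_gt q_nz by (cases "q > 0"; auto simp: field_simps)+

lemma mean_step_ratio:
  assumes v: "v > 0"
  shows "mean_step q k v = v * ((real k + v powr q) / real (Suc k)) powr (-1/q)"
proof -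
  have e: "(real k * v powr (-q) + 1) / real (Suc k) = v powr (-q) * ((real k + v powr q) / real (Suc k))"
    using v by (simp add: field_simps flip: powr_add)
  have v_eq: "(v powr (-q)) powr (-1/q) = v" using v q_nz by (simp add: powr_powr)
  show ?thesis unfolding mean_step_def e powr_mult v_eq ..
qed

text \<open>
  The tangent inequality for the mean of \<open>v powr q\<close> and \<open>1\<close>. There is no second-order error term, so the
  bound is usable near \<open>wstar\<close>, where the main term cancels.
\<close>

lemma mean_step_lower:
  assumes v: "v > 0"
  shows "v + drift v / real (Suc k) \<le> mean_step q k v"
proof -
  define y where "y = (real k + v powr q) / real (Suc k)"
  have y: "y > 0" unfolding y_def using v by (intro divide_pos_pos add_nonneg_pos) auto
  have y1: "y - 1 = (v powr q - 1) / real (Suc k)" by (simp add: y_def field_simps)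
  have "v * (1 + (-1/q) * (y - 1)) \<le> v * y powr (-1/q)"
    using v by (intro mult_left_mono powr_ge_tangent[OF y exponent_ok(1)]) auto
  also have "v * (1 + (-1/q) * (y - 1)) = v + drift v / real (Suc k)"
    unfolding y1 drift_def using v q_nz
    by (simp add: powr_add diff_divide_distrib ring_distribs mult.commute del: of_nat_Suc)
  finally show ?thesis by (simp add: mean_step_ratio[OF v] y_def)
qed

text \<open>
  Solved for \<open>v\<close>, the equation \<open>P = mean_step q k v\<close> exhibits \<open>v\<close> as a mean of \<open>P\<close> and \<open>1\<close> with a negative
  weight on \<open>1\<close>, and the tangent inequality bounds it from below in terms of \<open>P\<close>. The resulting bound is
  implicit in \<open>P\<close> but again free of error terms.
\<close>

lemma mean_step_upper:
  assumes v: "v > 0" and k: "k \<ge> 1"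
  shows "mean_step q k v \<le> v + drift (mean_step q k v) / real k"
proof -
  define P where "P = mean_step q k v"
  have P: "P > 0" unfolding P_def by (rule mean_step_pos)
  define y where "y = (real (Suc k) - P powr q) / real k"
  have "P powr (-q) = (real k * v powr (-q) + 1) / real (Suc k)"
    using q_nz by (simp add: P_def mean_step_def powr_powr add_nonneg_nonneg del: of_nat_Suc)
  hence "v powr (-q) = (real (Suc k) * P powr (-q) - 1) / real k" using k by (simp add: field_simps)
  also have "\<dots> = P powr (-q) * y"
    using P k by (simp add: y_def field_simps flip: powr_add)
  finally have vy: "v powr (-q) = P powr (-q) * y" .
  hence "0 < P powr (-q) * y" using v by (simp flip: vy)
  hence y: "y > 0" by (simp add: zero_less_mult_iff)
  have y1: "y - 1 = (1 - P powr q) / real k" using k by (simp add: y_def field_simps)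
  have "v = (v powr (-q)) powr (-1/q)" using v q_nz by (simp add: powr_powr)
  also have "\<dots> = P * y powr (-1/q)"
    unfolding vy using P y q_nz by (simp add: powr_mult powr_powr)
  finally have "v = P * y powr (-1/q)" .
  moreover have "P * (1 + (-1/q) * (y - 1)) \<le> P * y powr (-1/q)"
    using P by (intro mult_left_mono powr_ge_tangent[OF y exponent_ok(1)]) auto
  moreover have "P * (1 + (-1/q) * (y - 1)) = P - drift P / real k"
    unfolding y1 drift_def using P q_nz k by (simp add: powr_add field_simps)
  ultimately show ?thesis by (simp add: P_def)
qed

lemma mean_step_le_1:
  assumes v: "0 < v" "v \<le> 1"
  shows "mean_step q k v \<le> 1"
proof (cases "k = 0")
  case False
  show ?thesis
  proof (rule ccontr)
    assume "\<not> mean_step q k v \<le> 1"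
    hence "drift (mean_step q k v) / real k < 0" using False drift_neg by (simp add: divide_neg_pos)
    thus False using mean_step_upper[of v k] False v \<open>\<not> mean_step q k v \<le> 1\<close> by auto
  qed
qed (simp add: mean_step_def)

lemma mean_step_ge:
  assumes "0 < v" "v \<le> 1"
  shows "v \<le> mean_step q k v"
  using mean_step_lower[of v k] drift_nonneg[of v] assms
  by (smt (verit) divide_nonneg_nonneg of_nat_0_le_iff)

lemma mean_step_deriv:
  assumes v: "v > 0" and k: "k \<ge> 1"
  shows "(mean_step q k has_real_derivative
           real k / real (Suc k) * ((real k + v powr q) / real (Suc k)) powr (- (1 + 1/q))) (at v)"
proof -
  define Y where "Y v = (real k * v powr (- q) + 1) / real (Suc k)" for v
  define y where "y = (real k + v powr q) / real (Suc k)"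
  have Y: "Y v > 0" unfolding Y_def by (intro divide_pos_pos add_nonneg_pos) auto
  have y: "y > 0" unfolding y_def using v by (intro divide_pos_pos add_nonneg_pos) auto
  have Yy: "Y v = v powr (-q) * y"
    using v by (simp add: Y_def y_def field_simps flip: powr_add)
  have dY: "(Y has_real_derivative real k / real (Suc k) * (- q * v powr (-q - 1))) (at v)"
    unfolding Y_def[abs_def] using v by (auto intro!: derivative_eq_intros)
  have "((\<lambda>v. Y v powr (-1/q)) has_real_derivative
          (-1/q) * Y v powr (-1/q - 1) * (real k / real (Suc k) * (- q * v powr (-q - 1)))) (at v)"
    by (rule DERIV_chain2[OF has_real_derivative_powr[OF Y] dY])
  also have "(-1/q) * Y v powr (-1/q - 1) * (real k / real (Suc k) * (- q * v powr (-q - 1)))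
      = real k / real (Suc k) * (Y v powr (-1/q - 1) * v powr (-q - 1))" using q_nz by simp
  also have "Y v powr (-1/q - 1) = y powr (- (1 + 1/q)) * v powr (q + 1)"
  proof -
    have "Y v powr (-1/q - 1) = v powr (- q * (-1/q - 1)) * y powr (-1/q - 1)"
      unfolding Yy using v y by (simp only: powr_mult powr_powr)
    also have "- q * (-1/q - 1) = q + 1" using q_nz by (simp add: field_simps)
    also have e: "-1/q - 1 = - (1 + 1/q)" by simp
    finally have "Y v powr (- (1 + 1/q)) = v powr (q + 1) * y powr (- (1 + 1/q))" .
    thus ?thesis by (simp only: mult.commute e)
  qed
  also have "y powr (- (1 + 1/q)) * v powr (q + 1) * v powr (- q - 1) = y powr (- (1 + 1/q))"
    using v by (simp add: mult.assoc flip: powr_add)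
  finally show ?thesis unfolding mean_step_def[abs_def] Y_def y_def .
qed

lemma mean_step_deriv_le_1:
  assumes v: "v \<ge> wstar" and k: "k \<ge> 1"
  shows "real k / real (Suc k) * ((real k + v powr q) / real (Suc k)) powr (- (1 + 1/q)) \<le> 1"
proof -
  define y where "y = (real k + v powr q) / real (Suc k)"
  have v0: "v > 0" using v wstar_pos by simp
  have y: "y > 0" unfolding y_def using v0 by (intro divide_pos_pos add_nonneg_pos) auto
  have y1: "y - 1 = (v powr q - 1) / real (Suc k)" by (simp add: y_def field_simps)
  have "wstar powr q / q \<le> v powr q / q"
    using v powr_q_mono_sign[of wstar v] wstar_pos by (cases "v = wstar") auto
  hence "wstar powr q / q - 1 / q \<le> v powr q / q - 1 / q" by simp
  also have "wstar powr q / q - 1 / q = - 1 / (1 + q)"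
  proof -
    have "q * (1 + q) \<noteq> 0" "1 + q \<noteq> 0" using q_gt q_nz by auto
    thus ?thesis unfolding wstar_powr by (simp add: divide_simps)
  qed
  finally have "(1 + q) * (- 1 / (1 + q)) \<le> (1 + q) * (v powr q / q - 1 / q)"
    using q_gt by (intro mult_left_mono) auto
  hence "-1 \<le> (1 + q) * (v powr q / q - 1 / q)" using q_gt by simp
  also have "(1 + q) * (v powr q / q - 1 / q) = (1 + 1/q) * (v powr q - 1)"
    using q_nz by (simp add: field_simps)
  finally have "-1 / real (Suc k) \<le> (1 + 1/q) * (v powr q - 1) / real (Suc k)"
    by (intro divide_right_mono) auto
  hence "1 - 1 / real (Suc k) \<le> 1 + (1 + 1/q) * (y - 1)" by (simp add: y1)
  also have "\<dots> \<le> y powr (1 + 1/q)" by (rule powr_ge_tangent[OF y exponent_ok(2)])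
  finally have "real k / real (Suc k) \<le> y powr (1 + 1/q)" by (simp add: field_simps)
  hence "real k / real (Suc k) * y powr (- (1 + 1/q)) \<le> y powr (1 + 1/q) * y powr (- (1 + 1/q))"
    by (intro mult_right_mono) auto
  also have "\<dots> = 1" using y by (simp flip: powr_add)
  finally show ?thesis by (simp add: y_def)
qed

text \<open>
  At and above \<open>wstar\<close> the derivative of a step is at most \<open>1\<close>, again by the tangent inequality. Hence
  differences between orbits that stay there are not amplified.
\<close>

lemma mean_step_nonexpansive:
  assumes uv: "wstar \<le> u" "u \<le> v"
  shows "mean_step q k u \<le> mean_step q k v" "mean_step q k v - mean_step q k u \<le> v - u"
proof -
  have "mean_step q k u \<le> mean_step q k v \<and> mean_step q k v - mean_step q k u \<le> v - u"
  proof (cases "k = 0 \<or> u = v")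
    case True
    thus ?thesis using uv by (auto simp: mean_step_def)
  next
    case False
    hence k: "k \<ge> 1" and less: "u < v" using uv by auto
    let ?d = "\<lambda>z. real k / real (Suc k) * ((real k + z powr q) / real (Suc k)) powr (- (1 + 1/q))"
    have "\<exists>z. u < z \<and> z < v \<and> mean_step q k v - mean_step q k u = (v - u) * ?d z"
      using less uv wstar_pos k by (intro MVT2 mean_step_deriv) auto
    then obtain z where z: "u < z" "z < v" "mean_step q k v - mean_step q k u = (v - u) * ?d z" by blast
    define D where "D = ?d z"
    have "0 \<le> D" by (simp add: D_def)
    moreover have "D \<le> 1" unfolding D_def using z uv k by (intro mean_step_deriv_le_1) auto
    ultimately have "0 \<le> (v - u) * D" "(v - u) * D \<le> v - u"
      using mult_left_mono[of D 1 "v - u"] less by auto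
    moreover have "mean_step q k v - mean_step q k u = (v - u) * D" using z(3) by (simp only: D_def)
    ultimately show ?thesis by linarith
  qed
  thus "mean_step q k u \<le> mean_step q k v" "mean_step q k v - mean_step q k u \<le> v - u" by auto
qed

abbreviation orbit :: "real \<Rightarrow> nat \<Rightarrow> real" where "orbit \<eta> \<equiv> dual_orbit q (mustar + \<eta>)"

lemma orbit_le_1:
  assumes \<eta>: "\<eta> \<ge> 0" and pos: "\<And>j. j < k \<Longrightarrow> orbit \<eta> j > 0"
  shows "orbit \<eta> k \<le> 1"
  using pos
proof (induction k)
  case (Suc k)
  have "mean_step q k (orbit \<eta> k) \<le> 1" using Suc by (intro mean_step_le_1) auto
  moreover have "(mustar + \<eta>) / real (Suc k) \<ge> 0" using \<eta> mustar_pos by simp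
  ultimately show ?case by (simp del: of_nat_Suc)
qed simp

lemma orbit_Suc_ge:
  assumes "orbit \<eta> k > 0"
  shows "orbit \<eta> k - (gap (orbit \<eta> k) + \<eta>) / real (Suc k) \<le> orbit \<eta> (Suc k)"
  using mean_step_lower[OF assms, of k] by (simp add: gap_def diff_divide_distrib add_divide_distrib del: of_nat_Suc)

text \<open>
  A step lowers the distance to \<open>wstar\<close> by at most \<open>gap v\<close>, which is less than that distance.
\<close>

lemma critical_orbit_bounds: "wstar < orbit 0 k" "orbit 0 k \<le> 1"
proof -
  have "wstar < orbit 0 k \<and> orbit 0 k \<le> 1"
  proof (induction k)
    case 0
    thus ?case using wstar_less_1 by simp
  next
    case (Suc k)
    define v where "v = orbit 0 k"
    have v: "wstar < v" "v \<le> 1" using Suc by (auto simp: v_def)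
    have "gap v / real (Suc k) \<le> gap v"
      using gap_nonneg[of v] v wstar_pos by (simp add: divide_le_eq mult_le_cancel_left1)
    also have "\<dots> < v - wstar" by (rule gap_less_linear[OF v])
    finally have "wstar < v - (gap v + 0) / real (Suc k)" by simp
    also have "\<dots> \<le> orbit 0 (Suc k)"
      unfolding v_def by (rule orbit_Suc_ge) (use v wstar_pos in \<open>auto simp: v_def\<close>)
    finally have "wstar < orbit 0 (Suc k)" .
    have "mean_step q k v \<le> 1" using v wstar_pos by (intro mean_step_le_1) auto
    moreover have "mustar / real (Suc k) \<ge> 0" using mustar_pos by simp
    ultimately have "orbit 0 (Suc k) \<le> 1" by (simp add: v_def del: of_nat_Suc)
    with \<open>wstar < orbit 0 (Suc k)\<close> show ?case by blast
  qed
  thus "wstar < orbit 0 k" "orbit 0 k \<le> 1" by auto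
qed

end

section \<open>Passage times\<close>

lemma ln_Suc_diff_bounds:
  assumes "k \<ge> 1"
  shows "1 / real (Suc k) \<le> ln (real (Suc k)) - ln (real k)" "ln (real (Suc k)) - ln (real k) \<le> 1 / real k"
proof -
  have "ln (real k / real (Suc k)) \<le> real k / real (Suc k) - 1" using assms by (intro ln_le_minus_one) auto
  moreover have "ln (real (Suc k) / real k) \<le> real (Suc k) / real k - 1" using assms by (intro ln_le_minus_one) auto
  moreover have "real k / real (Suc k) - 1 = - 1 / real (Suc k)" "real (Suc k) / real k - 1 = 1 / real k"
    using assms by (auto simp: field_simps)
  ultimately show "1 / real (Suc k) \<le> ln (real (Suc k)) - ln (real k)"
    "ln (real (Suc k)) - ln (real k) \<le> 1 / real k"
    using assms by (auto simp: ln_div simp del: of_nat_Suc)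
qed

lemma inverse_diff_le:
  assumes "k \<ge> 1" shows "1 / real k - 1 / real (Suc k) \<le> 1 / real k ^ 2" "1 / real k - 1 / real (Suc k) \<ge> 0"
proof -
  have "1 / real k - 1 / real (Suc k) = 1 / (real k * real (Suc k))"
    using assms by (simp add: field_simps)
  also have "\<dots> \<le> 1 / real k ^ 2"
    using assms unfolding power2_eq_square by (intro divide_left_mono mult_left_mono) auto
  finally show "1 / real k - 1 / real (Suc k) \<le> 1 / real k ^ 2" .
  show "1 / real k - 1 / real (Suc k) \<ge> 0" using assms by (simp add: frac_le)
qed

text \<open>
  The increments are dominated by the telescoping differences of \<open>4 * C / sqrt k\<close>.
\<close>

lemma limit_rate_inverse_sqrt:
  fixes S :: "nat \<Rightarrow> real"
  assumes C: "C \<ge> 0" and step: "\<And>k. k \<ge> 1 \<Longrightarrow> \<bar>S (Suc k) - S k\<bar> \<le> C / (real k * sqrt (real k))"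
  obtains L where "\<And>m. m \<ge> 1 \<Longrightarrow> \<bar>S m - L\<bar> \<le> 4 * C / sqrt (real m)"
proof -
  have tel: "1 / (real k * sqrt (real k)) \<le> 4 * (1 / sqrt (real k) - 1 / sqrt (real (Suc k)))" if k: "k \<ge> 1" for k
  proof -
    define s where "s = sqrt (real k)"
    define r where "r = sqrt (real (Suc k))"
    have s: "s \<ge> 1" "s * s = real k" using k by (auto simp: s_def)
    have r: "r \<ge> s" "r * r = s * s + 1" unfolding s(2) by (auto simp: r_def s_def)
    have "(r * 2) * (r * 2) \<le> (s * 3) * (s * 3)" using r s k by (simp add: algebra_simps)
    hence "r * 2 \<le> s * 3" using s r by (smt (verit) mult_strict_mono)
    hence r2: "r \<le> s * (3/2)" by simp
    have "r * (s + r) \<le> (s * (3/2)) * (s + s * (3/2))"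
      using r2 r s by (intro mult_mono add_mono) auto
    also have "\<dots> \<le> 4 * (s * s)" by simp
    finally have *: "r * (s + r) \<le> 4 * (s * s)" .
    have "(r - s) * (s + r) = 1" using r by (simp add: algebra_simps)
    hence rs: "r - s = 1 / (s + r)" using s r by (simp add: field_simps)
    have "1 / s - 1 / r = (r - s) / (s * r)" using s r by (simp add: field_simps)
    also have "\<dots> = 1 / (s * (r * (s + r)))" unfolding rs by simp
    also have "\<dots> \<ge> 1 / (s * (4 * (s * s)))"
      using s r * by (intro divide_left_mono mult_left_mono mult_pos_pos) auto
    finally have "4 * (1 / (s * (4 * (s * s)))) \<le> 4 * (1 / s - 1 / r)" by (intro mult_left_mono) auto
    moreover have "4 * (1 / (s * (4 * (s * s)))) = 1 / (s * s * s)" using s by simp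
    ultimately have "1 / (s * s * s) \<le> 4 * (1 / s - 1 / r)" by linarith
    thus ?thesis unfolding s(2) unfolding s_def r_def .
  qed
  \<comment> \<open>\<open>U\<close> increases, \<open>V\<close> decreases, and both have the same limit\<close>
  define U where "U k = S (Suc k) - 4 * C / sqrt (real (Suc k))" for k
  define V where "V k = S (Suc k) + 4 * C / sqrt (real (Suc k))" for k
  have st: "\<bar>S (Suc k) - S k\<bar> \<le> 4 * C / sqrt (real k) - 4 * C / sqrt (real (Suc k))" if "k \<ge> 1" for k
  proof -
    have "C * (1 / (real k * sqrt (real k))) \<le> C * (4 * (1 / sqrt (real k) - 1 / sqrt (real (Suc k))))"
      by (rule mult_left_mono[OF tel[OF that] C])
    thus ?thesis using step[OF that] by (simp add: algebra_simps)
  qed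
  have inc: "incseq U"
  proof (rule incseq_SucI)
    show "U k \<le> U (Suc k)" for k using st[of "Suc k"] unfolding U_def abs_le_iff by linarith
  qed
  have dec: "decseq V"
  proof (rule decseq_SucI)
    show "V (Suc k) \<le> V k" for k using st[of "Suc k"] unfolding V_def abs_le_iff by linarith
  qed
  have UV: "U k \<le> V k" for k using C by (simp add: U_def V_def)
  have "U k \<le> V 0" for k using UV[of k] decseqD[OF dec, of 0 k] by linarith
  then obtain L where L: "U \<longlonglongrightarrow> L" "\<And>k. U k \<le> L" using incseq_convergent[OF inc] by blast
  have "(\<lambda>k. 8 * C / sqrt (real (Suc k))) \<longlonglongrightarrow> 0" by real_asymp
  from tendsto_add[OF L(1) this] have "(\<lambda>k. U k + 8 * C / sqrt (real (Suc k))) \<longlonglongrightarrow> L" by simp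
  moreover have "V = (\<lambda>k. U k + 8 * C / sqrt (real (Suc k)))" by (simp add: fun_eq_iff U_def V_def)
  ultimately have "V \<longlonglongrightarrow> L" by simp
  hence VL: "L \<le> V k" for k using decseq_ge[OF dec] by blast
  show ?thesis
  proof (rule that)
    fix m :: nat assume "m \<ge> 1"
    then obtain k where "m = Suc k" by (cases m) auto
    thus "\<bar>S m - L\<bar> \<le> 4 * C / sqrt (real m)" using L(2)[of k] VL[of k] unfolding U_def V_def abs_le_iff by auto
  qed
qed

lemma integral_mean_value:
  fixes f :: "real \<Rightarrow> real"
  assumes "u < v" "continuous_on {u..v} f"
  obtains z where "u < z" "z < v" "integral {u..v} f = (v - u) * f z"
proof -
  have "\<exists>z\<in>{u<..<v}. integral {u..v} f - integral {u..u} f = (\<lambda>h. f z * h) (v - u)"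
  proof (rule mvt_simple[OF assms(1)])
    show "((\<lambda>x. integral {u..x} f) has_derivative (\<lambda>h. f x * h)) (at x within {u..v})"
      if "u \<le> x" "x \<le> v" for x
      using integral_has_real_derivative[OF assms(2), of x] that
      by (simp add: has_field_derivative_def)
  qed
  thus ?thesis using that by (auto simp: mult.commute)
qed

lemma rate_perturb_bounds:
  fixes g \<eta> \<gamma> :: real
  assumes "\<gamma> > 0" "\<gamma> \<le> g" "\<eta> \<ge> 0"
  shows "0 \<le> 1 / g - 1 / (g + \<eta>)" "1 / g - 1 / (g + \<eta>) \<le> \<eta> / \<gamma>^2"
proof -
  show "0 \<le> 1 / g - 1 / (g + \<eta>)" using assms by (simp add: frac_le)
  have "1 / g - 1 / (g + \<eta>) = \<eta> / (g * (g + \<eta>))" using assms by (simp add: field_simps)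
  also have "\<dots> \<le> \<eta> / \<gamma>^2"
    using assms unfolding power2_eq_square by (intro divide_left_mono mult_mono mult_pos_pos) auto
  finally show "1 / g - 1 / (g + \<eta>) \<le> \<eta> / \<gamma>^2" .
qed

lemma integral_rate_perturb:
  fixes g :: "real \<Rightarrow> real"
  assumes xy: "x \<le> y" and g: "continuous_on {x..y} g" "\<And>w. w \<in> {x..y} \<Longrightarrow> \<gamma> \<le> g w"
    and \<gamma>: "\<gamma> > 0" and \<eta>: "\<eta> \<ge> 0"
  shows "\<bar>integral {x..y} (\<lambda>w. 1 / (g w + \<eta>)) - integral {x..y} (\<lambda>w. 1 / g w)\<bar> \<le> (y - x) * (\<eta> / \<gamma>^2)"
proof -
  have pos: "g w > 0" "g w + \<eta> > 0" if "w \<in> {x..y}" for w using g(2)[OF that] \<gamma> \<eta> by auto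
  have int: "(\<lambda>w. 1 / (g w + \<eta>)) integrable_on {x..y}" "(\<lambda>w. 1 / g w) integrable_on {x..y}"
    using pos by (intro integrable_continuous_real continuous_intros g; force)+
  have diff: "integral {x..y} (\<lambda>w. 1 / g w) - integral {x..y} (\<lambda>w. 1 / (g w + \<eta>))
      = integral {x..y} (\<lambda>w. 1 / g w - 1 / (g w + \<eta>))"
    using int by (intro Henstock_Kurzweil_Integration.integral_diff[symmetric]) auto
  have "0 \<le> integral {x..y} (\<lambda>w. 1 / g w - 1 / (g w + \<eta>))"
    using rate_perturb_bounds(1)[OF \<gamma> g(2) \<eta>] int by (intro integral_nonneg integrable_diff) auto
  moreover have "integral {x..y} (\<lambda>w. 1 / g w - 1 / (g w + \<eta>)) \<le> integral {x..y} (\<lambda>w. \<eta> / \<gamma>^2)"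
    using rate_perturb_bounds(2)[OF \<gamma> g(2) \<eta>] int by (intro integral_le integrable_diff) auto
  moreover have "integral {x..y} (\<lambda>w. \<eta> / \<gamma>^2) = (y - x) * (\<eta> / \<gamma>^2)" using xy by simp
  ultimately show ?thesis using diff by linarith
qed

context hardy_parameter
begin

text \<open>
  The time in which the flow with speed \<open>gap + \<eta>\<close> descends from \<open>1\<close> to \<open>v\<close>.
\<close>

definition passage_time :: "real \<Rightarrow> real \<Rightarrow> real" where
  "passage_time \<eta> v = integral {v..1} (\<lambda>w. 1 / (gap w + \<eta>))"

lemma continuous_on_rate:
  assumes "u \<ge> 0" "\<And>w. u \<le> w \<Longrightarrow> w \<le> v \<Longrightarrow> gap w + \<eta> > 0"
  shows "continuous_on {u..v} (\<lambda>w. 1 / (gap w + \<eta>))"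
  using assms
  by (intro continuous_intros continuous_on_subset[OF continuous_on_gap]) (auto simp: less_imp_neq[symmetric])

lemma passage_time_split:
  assumes "0 \<le> u" "u \<le> v" "v \<le> 1" "\<And>w. u \<le> w \<Longrightarrow> w \<le> 1 \<Longrightarrow> gap w + \<eta> > 0"
  shows "passage_time \<eta> u = integral {u..v} (\<lambda>w. 1 / (gap w + \<eta>)) + passage_time \<eta> v"
  unfolding passage_time_def
  by (rule Henstock_Kurzweil_Integration.integral_combine[symmetric])
     (use assms in \<open>auto intro!: integrable_continuous_real continuous_on_rate\<close>)

lemma passage_time_mean_value:
  assumes uv: "0 \<le> u" "0 \<le> v" "u \<le> 1" "v \<le> 1"
    and pos: "\<And>w. min u v \<le> w \<Longrightarrow> w \<le> 1 \<Longrightarrow> gap w + \<eta> > 0"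
  obtains z where "min u v \<le> z" "z \<le> max u v" "passage_time \<eta> u - passage_time \<eta> v = (v - u) / (gap z + \<eta>)"
proof -
  consider "u = v" | "u < v" | "v < u" by linarith
  thus ?thesis
  proof cases
    case 1
    thus ?thesis using that[of u] by simp
  next
    case 2
    obtain z where "u < z" "z < v" "integral {u..v} (\<lambda>w. 1 / (gap w + \<eta>)) = (v - u) * (1 / (gap z + \<eta>))"
      by (rule integral_mean_value[OF 2 continuous_on_rate[of u v \<eta>]]) (use 2 uv pos in auto)
    thus ?thesis using that[of z] passage_time_split[of u v \<eta>] 2 uv pos by auto
  next
    case 3
    obtain z where "v < z" "z < u" "integral {v..u} (\<lambda>w. 1 / (gap w + \<eta>)) = (u - v) * (1 / (gap z + \<eta>))"
      by (rule integral_mean_value[OF 3 continuous_on_rate[of v u \<eta>]]) (use 3 uv pos in auto)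
    moreover have "(u - v) * (1 / (gap z + \<eta>)) = - ((v - u) / (gap z + \<eta>))"
      by (simp add: minus_divide_left)
    ultimately show ?thesis using that[of z] passage_time_split[of v u \<eta>] 3 uv pos by auto
  qed
qed

lemma orbit_pos_step:
  assumes \<eta>: "0 \<le> \<eta>" "\<eta> \<le> 1" and v: "0 < orbit \<eta> k" "orbit \<eta> k \<le> 1"
  shows "orbit \<eta> (Suc k) \<le> 1" "orbit \<eta> (Suc k) \<ge> orbit \<eta> k - (mustar + 1) / real (Suc k)"
proof -
  have "(mustar + \<eta>) / real (Suc k) \<ge> 0" using \<eta> mustar_pos by simp
  thus "orbit \<eta> (Suc k) \<le> 1" using mean_step_le_1[OF v, of k] by (simp del: of_nat_Suc)
  have "(gap (orbit \<eta> k) + \<eta>) / real (Suc k) \<le> (mustar + 1) / real (Suc k)"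
    using gap_le_mustar[of "orbit \<eta> k"] v \<eta> by (intro divide_right_mono) auto
  thus "orbit \<eta> (Suc k) \<ge> orbit \<eta> k - (mustar + 1) / real (Suc k)"
    using orbit_Suc_ge[OF v(1)] by linarith
qed

lemma orbit_step_bounds:
  assumes \<eta>: "0 \<le> \<eta>" and v: "0 < orbit \<eta> k" and k: "k \<ge> 1"
  defines "P \<equiv> mean_step q k (orbit \<eta> k)"
  shows "orbit \<eta> (Suc k) \<le> orbit \<eta> k + drift P / real k - (mustar + \<eta>) / real (Suc k)"
    and "P \<le> orbit \<eta> k + mustar / real k"
proof -
  show "orbit \<eta> (Suc k) \<le> orbit \<eta> k + drift P / real k - (mustar + \<eta>) / real (Suc k)"
    using mean_step_upper[OF v k] by (simp add: P_def del: of_nat_Suc)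
  have "drift P / real k \<le> mustar / real k"
    unfolding P_def by (intro divide_right_mono drift_le_mustar less_imp_le[OF mean_step_pos]) auto
  thus "P \<le> orbit \<eta> k + mustar / real k"
    using mean_step_upper[OF v k] by (simp add: P_def)
qed

text \<open>
  Along an orbit the passage time advances by \<open>1 / (k + 1)\<close> per step, up to second order in \<open>1 / k\<close>. The
  increment is the displacement divided by the speed at some intermediate point; the displacement is
  known from the two one-step bounds, and the speed varies little over so short a way. The constant \<open>C\<close>
  is uniform in \<open>\<eta>\<close>; the lower bounds \<open>\<delta>\<close> for the position and \<open>\<gamma>\<close> for the speed enter explicitly,
  because both will shrink with \<open>\<eta>\<close>.
\<close>

lemma passage_time_step:
  obtains C where "C > 0"
    "\<And>\<eta> k \<delta> \<gamma>. 0 \<le> \<eta> \<Longrightarrow> \<eta> \<le> 1 \<Longrightarrow> k \<ge> 1 \<Longrightarrow> 0 < \<delta> \<Longrightarrow> \<delta> \<le> 1 \<Longrightarrow> 0 < \<gamma> \<Longrightarrow>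
       \<delta> \<le> orbit \<eta> k \<Longrightarrow> orbit \<eta> k \<le> 1 \<Longrightarrow> \<delta> \<le> orbit \<eta> (Suc k) \<Longrightarrow>
       (\<And>w. min (orbit \<eta> k) (orbit \<eta> (Suc k)) \<le> w \<Longrightarrow> w \<le> 1 \<Longrightarrow> \<gamma> \<le> gap w + \<eta>) \<Longrightarrow>
       \<bar>passage_time \<eta> (orbit \<eta> (Suc k)) - passage_time \<eta> (orbit \<eta> k) - 1 / real (Suc k)\<bar>
         \<le> C / (\<delta>^2 * \<gamma> * real k ^ 2)"
proof -
  obtain L where L: "L > 0" and lip:
    "\<And>\<delta> u v. 0 < \<delta> \<Longrightarrow> \<delta> \<le> u \<Longrightarrow> \<delta> \<le> v \<Longrightarrow> u \<le> 1 \<Longrightarrow> v \<le> 1 \<Longrightarrow> \<bar>gap u - gap v\<bar> \<le> L / \<delta> * \<bar>u - v\<bar>"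
    by (rule gap_lipschitz) blast
  define E where "E = mustar * (1 + L)"
  define F where "F = mustar + 1 + E"
  have E: "E > 0" and F: "F > 0" using L mustar_pos by (simp_all add: E_def F_def add_pos_pos)
  show ?thesis
  proof (rule that[of "L * F + E"])
    show "L * F + E > 0" using L E F by (intro add_pos_pos mult_pos_pos) auto
    fix \<eta> k \<delta> \<gamma>
    assume \<eta>: "0 \<le> \<eta>" "\<eta> \<le> 1" and k: "(k::nat) \<ge> 1" and \<delta>: "0 < \<delta>" "\<delta> \<le> 1" and \<gamma>: "0 < \<gamma>"
      and v\<delta>: "\<delta> \<le> orbit \<eta> k" and v1: "orbit \<eta> k \<le> 1" and v'\<delta>: "\<delta> \<le> orbit \<eta> (Suc k)"
      and \<gamma>_le: "\<And>w. min (orbit \<eta> k) (orbit \<eta> (Suc k)) \<le> w \<Longrightarrow> w \<le> 1 \<Longrightarrow> \<gamma> \<le> gap w + \<eta>"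
    define v where "v = orbit \<eta> k"
    define v' where "v' = orbit \<eta> (Suc k)"
    define P where "P = mean_step q k v"
    define \<tau> where "\<tau> = 1 / real (Suc k)"
    define K where "K = real k"
    have K: "K \<ge> 1" using k by (simp add: K_def)
    have v: "0 < v" "v \<le> 1" "\<delta> \<le> v" using v\<delta> v1 \<delta> by (auto simp: v_def)
    have v'1: "v' \<le> 1" unfolding v'_def by (rule orbit_pos_step) (use \<eta> v in \<open>auto simp: v_def\<close>)
    have v'_eq: "v' = P - (mustar + \<eta>) * \<tau>" by (simp add: v'_def P_def v_def \<tau>_def)
    have P: "v \<le> P" "P \<le> 1" unfolding P_def using v by (auto intro: mean_step_ge mean_step_le_1)
    have \<tau>: "0 < \<tau>" "\<tau> \<le> 1 / K" using k by (auto simp: \<tau>_def K_def frac_le)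
    \<comment> \<open>the excess of the step over its linear part; it is nonnegative\<close>
    define e where "e = P - v - drift v * \<tau>"
    have e0: "0 \<le> e" using mean_step_lower[of v k] v by (simp add: e_def P_def \<tau>_def)
    have PvK: "P - v \<le> mustar / K"
      using orbit_step_bounds(2)[of \<eta> k] \<eta> v k by (simp add: P_def v_def K_def)
    have "drift P - drift v \<le> L / \<delta> * (P - v)"
      using lip[of \<delta> v P] \<delta> v P by (simp add: gap_def abs_le_iff)
    also have "\<dots> \<le> L / \<delta> * (mustar / K)" using PvK L \<delta> by (intro mult_left_mono) auto
    finally have dP: "drift P \<le> drift v + L * mustar / (\<delta> * K)" by simp
    have "P - v \<le> drift P / K"
      using mean_step_upper[of v k] v k by (simp add: P_def K_def)
    also have "\<dots> \<le> (drift v + L * mustar / (\<delta> * K)) / K" using dP K by (intro divide_right_mono) auto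
    finally have Pv: "P - v \<le> drift v / K + L * mustar / (\<delta> * K^2)"
      by (simp add: add_divide_distrib power2_eq_square mult.assoc)
    have K2: "1 / K - \<tau> \<le> 1 / K^2" using inverse_diff_le[OF k] by (simp add: K_def \<tau>_def)
    have "e \<le> drift v * (1 / K - \<tau>) + L * mustar / (\<delta> * K^2)"
      using Pv by (simp add: e_def algebra_simps)
    also have "drift v * (1 / K - \<tau>) \<le> mustar * (1 / K^2)"
      using drift_le_mustar[of v] drift_nonneg[of v] v \<tau> K2 by (intro mult_mono) auto
    also have "mustar * (1 / K^2) \<le> mustar / (\<delta> * K^2)"
      using \<delta> mustar_pos K by (simp add: divide_left_mono mult_le_cancel_right1 mult_left_le_one_le)
    also have "mustar / (\<delta> * K^2) + L * mustar / (\<delta> * K^2) = E / (\<delta> * K^2)"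
      by (simp add: E_def add_divide_distrib[symmetric] algebra_simps)
    finally have e1: "e \<le> E / (\<delta> * K^2)" by simp
    have diff: "v - v' = \<tau> * (gap v + \<eta>) - e"
      by (simp add: v'_eq e_def gap_def algebra_simps)
    have "\<bar>v - v'\<bar> \<le> \<tau> * (gap v + \<eta>) + e"
      unfolding diff using \<tau> e0 gap_nonneg[of v] v \<eta> by (simp add: abs_le_iff)
    also have "\<tau> * (gap v + \<eta>) \<le> 1 / K * (mustar + 1)"
      using \<tau> gap_le_mustar[of v] gap_nonneg[of v] v \<eta> K by (intro mult_mono) auto
    also have "1 / K * (mustar + 1) \<le> (mustar + 1) / (\<delta> * K)"
      using \<delta> mustar_pos K by (simp add: divide_left_mono mult_left_le_one_le)
    also have "e \<le> E / (\<delta> * K)"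
    proof -
      have "K \<le> K^2" using K by (simp add: power2_eq_square)
      hence "E / (\<delta> * K^2) \<le> E / (\<delta> * K)" using \<delta> E K by (intro divide_left_mono mult_left_mono) auto
      thus ?thesis using e1 by linarith
    qed
    finally have \<Delta>: "\<bar>v - v'\<bar> \<le> F / (\<delta> * K)" by (simp add: F_def add_divide_distrib)
    obtain z where z: "min v' v \<le> z" "z \<le> max v' v"
      "passage_time \<eta> v' - passage_time \<eta> v = (v - v') / (gap z + \<eta>)"
    proof (rule passage_time_mean_value[of v' v \<eta>])
      show "gap w + \<eta> > 0" if "min v' v \<le> w" "w \<le> 1" for w
        using \<gamma>_le[of w] that \<gamma> by (simp add: v_def v'_def min.commute)
    qed (use v v'1 v'\<delta> \<delta> in \<open>auto simp: v'_def\<close>)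
    have z1: "\<delta> \<le> z" "z \<le> 1" using z v v'1 v'\<delta> by (auto simp: v'_def)
    have gz: "\<gamma> \<le> gap z + \<eta>" using \<gamma>_le[of z] z z1 by (simp add: v_def v'_def min.commute)
    have "\<bar>gap v - gap z\<bar> \<le> L / \<delta> * \<bar>v - z\<bar>" using lip[of \<delta> v z] \<delta> v z1 by auto
    moreover have "\<bar>v - z\<bar> \<le> F / (\<delta> * K)" using z \<Delta> by (auto simp: min_def max_def split: if_splits)
    ultimately have gg: "\<bar>gap v - gap z\<bar> \<le> L / \<delta> * (F / (\<delta> * K))"
      using L \<delta> by (intro order.trans[OF _ mult_left_mono[of "\<bar>v - z\<bar>" "F / (\<delta> * K)" "L / \<delta>"]]) auto
    have "passage_time \<eta> v' - passage_time \<eta> v - \<tau> = (\<tau> * (gap v - gap z) - e) / (gap z + \<eta>)"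
      unfolding z(3) diff using gz \<gamma> by (simp add: field_simps)
    hence "\<bar>passage_time \<eta> v' - passage_time \<eta> v - \<tau>\<bar> = \<bar>\<tau> * (gap v - gap z) - e\<bar> / (gap z + \<eta>)"
      using gz \<gamma> by (simp add: abs_divide)
    also have "\<dots> \<le> (L * F + E) / (\<delta>^2 * K^2) / \<gamma>"
    proof (rule frac_le)
      have "\<bar>\<tau> * (gap v - gap z) - e\<bar> \<le> \<tau> * \<bar>gap v - gap z\<bar> + e"
        using e0 \<tau> abs_triangle_ineq4[of "\<tau> * (gap v - gap z)" e] by (simp add: abs_mult)
      also have "\<tau> * \<bar>gap v - gap z\<bar> \<le> 1 / K * (L / \<delta> * (F / (\<delta> * K)))"
        using \<tau> gg K by (intro mult_mono) auto
      also have "\<dots> = L * F / (\<delta>^2 * K^2)" by (simp add: power2_eq_square)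
      also have "e \<le> E / (\<delta>^2 * K^2)"
      proof -
        have "\<delta>^2 \<le> \<delta>" using \<delta> by (simp add: power2_eq_square mult_left_le_one_le)
        hence "E / (\<delta> * K^2) \<le> E / (\<delta>^2 * K^2)"
          using \<delta> E K by (intro divide_left_mono mult_right_mono) auto
        thus ?thesis using e1 by linarith
      qed
      finally show "\<bar>\<tau> * (gap v - gap z) - e\<bar> \<le> (L * F + E) / (\<delta>^2 * K^2)" by (simp add: add_divide_distrib)
    qed (use gz \<gamma> L F E in auto)
    also have "\<dots> = (L * F + E) / (\<delta>^2 * \<gamma> * K^2)" by (simp add: mult_ac)
    finally show "\<bar>passage_time \<eta> (orbit \<eta> (Suc k)) - passage_time \<eta> (orbit \<eta> k) - 1 / real (Suc k)\<bar>
        \<le> (L * F + E) / (\<delta>^2 * \<gamma> * real k ^ 2)"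
      by (simp only: v_def v'_def \<tau>_def K_def)
  qed
qed

end

section \<open>The critical orbit\<close>

context hardy_parameter
begin

text \<open>
  The distance \<open>D\<close> to \<open>wstar\<close> loses at most \<open>B * D^2 / (k + 1)\<close> in a step; so \<open>1 / D\<close> gains at most
  \<open>2 * B / (k + 1)\<close> and grows no faster than a logarithm. Therefore the speed along the critical orbit
  decays slowly enough for the errors in \<open>passage_time_step\<close> to be summable.
\<close>

lemma critical_orbit_ge_log:
  obtains c where "c > 0" "\<And>k. k \<ge> 1 \<Longrightarrow> c / (1 + ln (real k)) \<le> orbit 0 k - wstar"
proof -
  obtain B where B: "B > 0" "\<And>v. wstar \<le> v \<Longrightarrow> v \<le> 1 \<Longrightarrow> gap v \<le> B * (v - wstar)^2"
    by (rule gap_quadratic) blast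
  define D where "D k = orbit 0 k - wstar" for k
  have D: "0 < D k" "D k \<le> 1" for k
    using critical_orbit_bounds[of k] wstar_pos by (auto simp: D_def)
  define k0 where "k0 = max 1 (nat \<lceil>2 * B\<rceil>)"
  \<comment> \<open>\<open>k0\<close> is so large that a step at most halves \<open>D\<close>; \<open>M\<close> covers the indices before\<close>
  define M where "M = 1 + (\<Sum>j\<le>k0. 1 / D j)"
  have M: "1 / D k \<le> M" if "k \<le> k0" for k
  proof -
    have "1 / D k \<le> (\<Sum>j\<le>k0. 1 / D j)"
      by (rule member_le_sum[of k "{..k0}" "\<lambda>j. 1 / D j"]) (use that less_imp_le[OF D(1)] in auto)
    thus ?thesis by (simp add: M_def)
  qed
  have "M > 0" unfolding M_def by (intro add_pos_nonneg sum_nonneg) (auto intro: less_imp_le D)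
  have inv: "1 / D k \<le> M + 2 * B * ln (real k)" if "k \<ge> 1" for k
    using that
  proof (induction k rule: dec_induct)
    case base
    show ?case using M[of 1] by (simp add: k0_def)
  next
    case (step k)
    show ?case
    proof (cases "Suc k \<le> k0")
      case True
      thus ?thesis using M[of "Suc k"] B(1) by (smt (verit) ln_ge_zero mult_nonneg_nonneg of_nat_1 of_nat_mono step.hyps le_SucI)
    next
      case False
      define \<tau> where "\<tau> = 1 / real (Suc k)"
      have "2 * B \<le> real (Suc k)" using False unfolding k0_def by linarith
      hence B\<tau>: "B * \<tau> \<le> 1/2" by (simp add: \<tau>_def field_simps)
      have \<tau>: "\<tau> > 0" by (simp add: \<tau>_def)
      define y where "y = B * \<tau> * D k"
      have y: "0 \<le> y" "y \<le> 1/2"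
        using mult_mono[OF B\<tau> D(2)[of k]] B(1) \<tau> D(1)[of k] by (auto simp: y_def intro: less_imp_le)
      have "D k - \<tau> * gap (orbit 0 k) \<le> D (Suc k)"
        using orbit_Suc_ge[of 0 k] critical_orbit_bounds[of k] wstar_pos
        by (simp add: D_def \<tau>_def del: dual_orbit.simps of_nat_Suc)
      moreover have "\<tau> * gap (orbit 0 k) \<le> \<tau> * (B * (D k)^2)"
        using critical_orbit_bounds[of k] \<tau> by (intro mult_left_mono) (auto simp: D_def intro!: B(2))
      ultimately have "D k * (1 - y) \<le> D (Suc k)" by (simp add: y_def power2_eq_square algebra_simps)
      moreover have "0 < D k * (1 - y)" using D y by simp
      ultimately have le: "1 / D (Suc k) \<le> 1 / (D k * (1 - y))" by (simp add: frac_le)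
      have "1 \<le> (1 + 2 * y) * (1 - y)"
        using mult_nonneg_nonneg[of y "1 - 2 * y"] y by (simp add: algebra_simps)
      hence "1 / (1 - y) \<le> 1 + 2 * y" using y by (simp add: divide_le_eq)
      hence "(1 / D k) * (1 / (1 - y)) \<le> (1 / D k) * (1 + 2 * y)"
        by (rule mult_left_mono) (simp add: less_imp_le D)
      with le have "1 / D (Suc k) \<le> (1 / D k) * (1 + 2 * y)" by simp
      also have "(1 / D k) * (1 + 2 * y) = 1 / D k + 2 * B * \<tau>" using D[of k] by (simp add: y_def field_simps)
      also have "2 * B * \<tau> \<le> 2 * B * (ln (real (Suc k)) - ln (real k))"
        using ln_Suc_diff_bounds(1)[of k] step.hyps B(1) unfolding \<tau>_def by (intro mult_left_mono) auto
      finally have "1 / D (Suc k) \<le> 1 / D k + 2 * B * (ln (real (Suc k)) - ln (real k))"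
        by simp
      thus ?thesis using step.IH by (simp add: algebra_simps)
    qed
  qed
  define c where "c = 1 / (M + 2 * B)"
  show ?thesis
  proof (rule that[of c])
    show "c > 0" using \<open>M > 0\<close> B(1) by (simp add: c_def)
    fix k :: nat assume k: "k \<ge> 1"
    have ln: "ln (real k) \<ge> 0" using k by simp
    define X where "X = (M + 2 * B) * (1 + ln (real k))"
    have X: "X > 0" unfolding X_def using \<open>M > 0\<close> B(1) ln by (intro mult_pos_pos) auto
    have "0 \<le> M * ln (real k)" using \<open>M > 0\<close> ln by simp
    hence "1 / D k \<le> X" using inv[OF k] B(1) by (simp add: X_def algebra_simps)
    hence "1 / X \<le> D k" using X D(1)[of k] by (simp add: field_simps)
    thus "c / (1 + ln (real k)) \<le> orbit 0 k - wstar" by (simp add: c_def D_def X_def)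
  qed
qed

text \<open>
  By \<open>mean_step_nonexpansive\<close> the two orbits separate by at most \<open>\<eta> / (k + 1)\<close> per step, provided the
  lower one has not come down to \<open>wstar\<close>.
\<close>

lemma orbit_near_critical:
  assumes \<eta>: "\<eta> \<ge> 0" and small: "\<And>j. 1 \<le> j \<Longrightarrow> j \<le> m \<Longrightarrow> \<eta> * (1 + ln (real j)) \<le> orbit 0 j - wstar"
    and k: "1 \<le> k" "k \<le> m"
  shows "orbit 0 k - \<eta> * (1 + ln (real k)) \<le> orbit \<eta> k \<and> orbit \<eta> k \<le> orbit 0 k"
  using k
proof (induction k rule: dec_induct)
  case base
  show ?case using \<eta> by (simp add: mean_step_def)
next
  case (step k)
  define u where "u = orbit \<eta> k"
  define v where "v = orbit 0 k"
  have uv: "v - \<eta> * (1 + ln (real k)) \<le> u" "u \<le> v" using step by (auto simp: u_def v_def)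
  have "wstar \<le> u" using small[of k] uv step by (auto simp: v_def)
  note ne = mean_step_nonexpansive[OF this uv(2), of k]
  have ou: "orbit \<eta> (Suc k) = mean_step q k u - mustar / real (Suc k) - \<eta> / real (Suc k)"
    and ov: "orbit 0 (Suc k) = mean_step q k v - mustar / real (Suc k)"
    by (simp_all add: u_def v_def add_divide_distrib del: of_nat_Suc)
  have "\<eta> / real (Suc k) \<ge> 0" using \<eta> by simp
  moreover have "\<eta> * (1 / real (Suc k)) \<le> \<eta> * (ln (real (Suc k)) - ln (real k))"
    using ln_Suc_diff_bounds(1)[of k] step.hyps \<eta> by (intro mult_left_mono) auto
  ultimately show ?case unfolding ou ov using ne uv by (simp add: algebra_simps del: of_nat_Suc)
qed

text \<open>
  The errors in \<open>passage_time_step\<close> are summable along the critical orbit, because its speed decays only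
  like the inverse square of a logarithm. Their sum enters the limit \<open>K\<close>, which \<open>\<kappa>\<close> will absorb.
\<close>

lemma critical_passage_time_limit:
  obtains C K where "C \<ge> 0"
    "\<And>m. m \<ge> 1 \<Longrightarrow> \<bar>passage_time 0 (orbit 0 m) - ln (real m) - K\<bar> \<le> C / sqrt (real m)"
proof -
  obtain a where a: "a > 0" "\<And>v. wstar \<le> v \<Longrightarrow> v \<le> 1 \<Longrightarrow> a * (v - wstar)^2 \<le> gap v"
    by (rule gap_quadratic) blast
  obtain c where c: "c > 0" "\<And>k. k \<ge> 1 \<Longrightarrow> c / (1 + ln (real k)) \<le> orbit 0 k - wstar"
    by (rule critical_orbit_ge_log) blast
  obtain C where C: "C > 0" and step:
    "\<And>\<eta> k \<delta> \<gamma>. 0 \<le> \<eta> \<Longrightarrow> \<eta> \<le> 1 \<Longrightarrow> k \<ge> 1 \<Longrightarrow> 0 < \<delta> \<Longrightarrow> \<delta> \<le> 1 \<Longrightarrow> 0 < \<gamma> \<Longrightarrow>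
       \<delta> \<le> orbit \<eta> k \<Longrightarrow> orbit \<eta> k \<le> 1 \<Longrightarrow> \<delta> \<le> orbit \<eta> (Suc k) \<Longrightarrow>
       (\<And>w. min (orbit \<eta> k) (orbit \<eta> (Suc k)) \<le> w \<Longrightarrow> w \<le> 1 \<Longrightarrow> \<gamma> \<le> gap w + \<eta>) \<Longrightarrow>
       \<bar>passage_time \<eta> (orbit \<eta> (Suc k)) - passage_time \<eta> (orbit \<eta> k) - 1 / real (Suc k)\<bar>
         \<le> C / (\<delta>^2 * \<gamma> * real k ^ 2)"
    by (rule passage_time_step) blast
  define A where "A = C / (wstar^2 * (a * c^2)) * 32"
  have A: "A \<ge> 0" using C a c by (simp add: A_def)
  define S where "S k = passage_time 0 (orbit 0 k) - ln (real k)" for k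
  have S: "\<bar>S (Suc k) - S k\<bar> \<le> (A + 1) / (real k * sqrt (real k))" if k: "k \<ge> 1" for k
  proof -
    define l where "l = 1 + ln (real (Suc k))"
    have l: "l \<ge> 1" by (simp add: l_def)
    define r where "r = sqrt (sqrt (real (Suc k)))"
    have r: "r > 0" "r * r * (r * r) = real (Suc k)" by (simp_all add: r_def)
    have "ln (r * r * (r * r)) = 4 * ln r" using r(1) by (simp add: ln_mult)
    hence "l \<le> 4 * r" using ln_le_minus_one[OF r(1)] unfolding l_def r(2) by linarith
    hence "l^2 \<le> (4 * r)^2" using l by (intro power_mono) auto
    also have "\<dots> = 16 * sqrt (real (Suc k))" by (simp add: r_def power_mult_distrib)
    also have "sqrt (real (Suc k)) \<le> sqrt (4 * real k)" using k by (intro real_sqrt_le_mono) auto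
    finally have l2: "l^2 \<le> 32 * sqrt (real k)" by (simp add: real_sqrt_mult)
    define \<gamma> where "\<gamma> = a * (c / l)^2"
    have \<gamma>: "\<gamma> > 0" using a c l by (simp add: \<gamma>_def)
    have near: "c / l \<le> orbit 0 j - wstar" if "j \<ge> 1" "j \<le> Suc k" for j
    proof -
      have "c / l \<le> c / (1 + ln (real j))"
      proof (rule divide_left_mono)
        show "1 + ln (real j) \<le> l" using that by (simp add: l_def)
        show "0 < l * (1 + ln (real j))" using l that by (intro mult_pos_pos add_pos_nonneg) auto
      qed (use c in auto)
      also have "\<dots> \<le> orbit 0 j - wstar" by (rule c(2)[OF that(1)])
      finally show ?thesis .
    qed
    have "\<bar>passage_time 0 (orbit 0 (Suc k)) - passage_time 0 (orbit 0 k) - 1 / real (Suc k)\<bar>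
        \<le> C / (wstar^2 * \<gamma> * real k ^ 2)"
    proof (rule step)
      show "wstar \<le> orbit 0 k" "wstar \<le> orbit 0 (Suc k)" "orbit 0 k \<le> 1"
        using critical_orbit_bounds[of k] critical_orbit_bounds[of "Suc k"] by (auto simp del: dual_orbit.simps)
      fix w assume w: "min (orbit 0 k) (orbit 0 (Suc k)) \<le> w" "w \<le> 1"
      have "c / l \<le> w - wstar" using near[of k] near[of "Suc k"] w k by (auto simp: min_le_iff_disj simp del: dual_orbit.simps)
      moreover have "0 \<le> c / l" using c l by simp
      ultimately have "a * (c / l)^2 \<le> a * (w - wstar)^2" "wstar \<le> w"
        using a by (auto intro!: mult_left_mono power_mono)
      thus "\<gamma> \<le> gap w + 0" using a(2)[of w] w by (simp add: \<gamma>_def)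
    qed (use k \<gamma> wstar_pos wstar_less_1 in auto)
    also have "C / (wstar^2 * \<gamma> * real k ^ 2) = C / (wstar^2 * (a * c^2)) * (l^2 / real k ^ 2)"
      by (simp add: \<gamma>_def power_divide)
    also have "\<dots> \<le> C / (wstar^2 * (a * c^2)) * (32 * sqrt (real k) / real k ^ 2)"
      using l2 C a c by (intro mult_left_mono divide_right_mono) auto
    also have "\<dots> = A / (real k * sqrt (real k))"
    proof -
      have "sqrt (real k) / real k ^ 2 = 1 / (real k * sqrt (real k))"
        using k by (simp add: power2_eq_square field_simps)
      hence "A * (sqrt (real k) / real k ^ 2) = A / (real k * sqrt (real k))" by simp
      thus ?thesis by (simp add: A_def)
    qed
    finally have 1: "\<bar>passage_time 0 (orbit 0 (Suc k)) - passage_time 0 (orbit 0 k) - 1 / real (Suc k)\<bar>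
        \<le> A / (real k * sqrt (real k))" .
    have "1 / real k ^ 2 \<le> 1 / (real k * sqrt (real k))"
    proof -
      have "sqrt (real k) \<le> real k" using k by (simp add: real_le_lsqrt power2_eq_square)
      thus ?thesis using k unfolding power2_eq_square by (intro divide_left_mono mult_left_mono) auto
    qed
    hence "\<bar>1 / real (Suc k) - (ln (real (Suc k)) - ln (real k))\<bar> \<le> 1 / (real k * sqrt (real k))"
      using ln_Suc_diff_bounds[OF k] inverse_diff_le[OF k] unfolding abs_le_iff by linarith
    with 1 show ?thesis unfolding S_def add_divide_distrib by linarith
  qed
  obtain K where K: "\<And>m. m \<ge> 1 \<Longrightarrow> \<bar>S m - K\<bar> \<le> 4 * (A + 1) / sqrt (real m)"
    using limit_rate_inverse_sqrt[OF _ S] A by (metis add_nonneg_nonneg zero_le_one)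
  show ?thesis by (rule that[of "4 * (A + 1)" K]) (use A K in \<open>auto simp: S_def\<close>)
qed

text \<open>
  The drift never exceeds \<open>mustar\<close>, so each step descends by at least \<open>\<eta> / (k + 1)\<close> up to a telescoping
  term, and the harmonic series diverges.
\<close>

lemma orbit_hits_zero:
  assumes \<eta>: "\<eta> > 0"
  shows "\<exists>k. orbit \<eta> k \<le> 0"
proof (rule ccontr)
  assume "\<not> (\<exists>k. orbit \<eta> k \<le> 0)"
  hence pos: "orbit \<eta> k > 0" for k by (auto simp: not_le)
  define U where "U k = orbit \<eta> k + mustar / real k + \<eta> * ln (real k)" for k
  have "U (Suc k) \<le> U k + \<eta> * (1 / real k - 1 / real (Suc k))" if k: "k \<ge> 1" for k
  proof -
    have "drift (mean_step q k (orbit \<eta> k)) / real k \<le> mustar / real k"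
      by (intro divide_right_mono drift_le_mustar less_imp_le[OF mean_step_pos]) auto
    moreover have "\<eta> * (ln (real (Suc k)) - ln (real k)) \<le> \<eta> * (1 / real k)"
      using ln_Suc_diff_bounds[OF k] \<eta> by (intro mult_left_mono) auto
    ultimately show ?thesis using orbit_step_bounds(1)[of \<eta> k] \<eta> pos k
      unfolding U_def by (simp add: algebra_simps add_divide_distrib del: dual_orbit.simps of_nat_Suc)
  qed
  hence dec: "U (Suc k) + \<eta> / real (Suc k) \<le> U k + \<eta> / real k" if "k \<ge> 1" for k
    using that by (fastforce simp: right_diff_distrib)
  have bound: "U k + \<eta> / real k \<le> U 1 + \<eta>" if "k \<ge> 1" for k
    using that
  proof (induction k rule: dec_induct)
    case (step k)
    thus ?case using dec[of k] by linarith
  qed simp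
  have "\<eta> * ln (real k) \<le> U 1 + \<eta>" if "k \<ge> 1" for k
    using bound[OF that] pos[of k] mustar_pos \<eta> unfolding U_def
    by (smt (verit) divide_nonneg_nonneg of_nat_0_le_iff)
  moreover have "filterlim (\<lambda>k. \<eta> * ln (real k)) at_top sequentially" using \<eta> by real_asymp
  hence "eventually (\<lambda>k. \<eta> * ln (real k) > U 1 + \<eta>) sequentially"
    by (auto simp: filterlim_at_top_dense)
  hence "eventually (\<lambda>k. \<eta> * ln (real k) > U 1 + \<eta> \<and> k \<ge> 1) sequentially"
    using eventually_ge_at_top[of 1] by eventually_elim auto
  ultimately show False unfolding eventually_sequentially by (meson le_refl not_le)
qed

end

section \<open>The orbit before the bottleneck\<close>

lemma eventually_at_right_0_le_1: "eventually (\<lambda>\<eta>::real. 0 < \<eta> \<and> \<eta> \<le> 1) (at_right 0)"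
  by (intro eventually_conj eventually_at_right_less) (auto simp: eventually_at_right_field intro!: exI[of _ 1])

context hardy_parameter
begin

lemma passage_time_perturb:
  assumes uv: "wstar < u" "u \<le> v" "v \<le> 1" and \<eta>: "\<eta> \<ge> 0" and \<gamma>: "\<gamma> > 0" "\<gamma> \<le> gap u"
  shows "\<bar>passage_time \<eta> u - passage_time 0 v\<bar> \<le> (v - u) / \<gamma> + \<eta> / \<gamma>^2"
proof -
  have g: "\<gamma> \<le> gap w" if "u \<le> w" for w using gap_mono[of u w] uv that \<gamma> by linarith
  have pos: "gap w + \<eta> > 0" if "u \<le> w" for w using g[OF that] \<gamma> \<eta> by linarith
  have u0: "0 \<le> u" using uv wstar_pos by simp
  have int: "(\<lambda>w. 1 / (gap w + \<eta>)) integrable_on {u..v}"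
    by (intro integrable_continuous_real continuous_on_rate) (use u0 pos in auto)
  have rate: "0 \<le> 1 / (gap w + \<eta>)" "1 / (gap w + \<eta>) \<le> 1 / \<gamma>" if "u \<le> w" for w
    using g[OF that] \<gamma> \<eta> by (auto intro!: frac_le)
  have split: "passage_time \<eta> u = integral {u..v} (\<lambda>w. 1 / (gap w + \<eta>)) + passage_time \<eta> v"
    by (rule passage_time_split) (use uv u0 pos in auto)
  have "integral {u..v} (\<lambda>w. 1 / (gap w + \<eta>)) \<le> integral {u..v} (\<lambda>w. 1 / \<gamma>)"
    using rate by (intro integral_le int) auto
  hence 1: "integral {u..v} (\<lambda>w. 1 / (gap w + \<eta>)) \<le> (v - u) / \<gamma>" using uv by simp
  have 2: "0 \<le> integral {u..v} (\<lambda>w. 1 / (gap w + \<eta>))"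
    using rate by (intro integral_nonneg int) auto
  have "\<bar>passage_time \<eta> v - passage_time 0 v\<bar> \<le> (1 - v) * (\<eta> / \<gamma>^2)"
    using integral_rate_perturb[OF uv(3) _ g \<gamma>(1) \<eta>] uv u0 continuous_on_subset[OF continuous_on_gap, of "{v..1}"]
    by (simp add: passage_time_def)
  also have "\<dots> \<le> \<eta> / \<gamma>^2" using uv u0 \<gamma> \<eta> by (intro mult_left_le_one_le) auto
  finally show ?thesis using split 1 2 by linarith
qed

text \<open>
  Up to the index \<open>switch \<eta>\<close> the orbit is compared with the critical one, afterwards with the flow. The
  power \<open>-4\<close> of \<open>\<eta>\<close> is large enough to make the later discretisation errors, of total size
  \<open>\<eta> powr (-3) / switch \<eta>\<close>, harmless, while \<open>ln (switch \<eta>)\<close> is still of the order of \<open>ln (1 / \<eta>)\<close>.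
\<close>

definition switch :: "real \<Rightarrow> nat" where "switch \<eta> = nat \<lceil>1 / \<eta>^4\<rceil>"
definition log_scale :: "real \<Rightarrow> real" where "log_scale \<eta> = 2 + 4 * ln (1 / \<eta>)"

lemma switch_bounds:
  assumes "0 < \<eta>" "\<eta> \<le> 1"
  shows "1 / \<eta>^4 \<le> real (switch \<eta>)" "switch \<eta> \<ge> 1" "1 + ln (real (switch \<eta>)) \<le> log_scale \<eta>" "log_scale \<eta> \<ge> 1"
proof -
  have e: "1 / \<eta>^4 \<ge> 1" using assms by (simp add: power_le_one)
  show 1: "1 / \<eta>^4 \<le> real (switch \<eta>)" unfolding switch_def by linarith
  have "1 \<le> real (switch \<eta>)" using e 1 by linarith
  thus 2: "switch \<eta> \<ge> 1" by simp
  have "real (switch \<eta>) \<le> 1 / \<eta>^4 + 1" unfolding switch_def using e by linarith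
  also have "\<dots> \<le> 2 / \<eta>^4" using e by simp
  finally have "ln (real (switch \<eta>)) \<le> ln (2 / \<eta>^4)" using 2 by (subst ln_le_cancel_iff) (use assms in auto)
  also have "\<dots> = ln 2 + 4 * ln (1 / \<eta>)" using assms by (simp add: ln_div ln_realpow)
  also have "ln (2::real) \<le> 1" using ln_le_minus_one[of 2] by simp
  finally show "1 + ln (real (switch \<eta>)) \<le> log_scale \<eta>" by (simp add: log_scale_def)
  have "ln (1 / \<eta>) \<ge> 0" using assms by simp
  thus "log_scale \<eta> \<ge> 1" by (simp add: log_scale_def)
qed

text \<open>
  The constant \<open>K\<close> is that of the critical orbit: at the index \<open>switch \<eta>\<close> the two orbits differ by
  \<open>\<eta>\<close> times a logarithm, and both keep a distance of a constant over a logarithm from \<open>wstar\<close>, so that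
  their passage times differ by \<open>\<eta>\<close> times a power of a logarithm.
\<close>

lemma initial_phase:
  obtains C K where "C \<ge> 0"
    "eventually (\<lambda>\<eta>. (\<forall>j\<le>switch \<eta>. wstar < orbit \<eta> j) \<and>
       \<bar>passage_time \<eta> (orbit \<eta> (switch \<eta>)) - ln (real (switch \<eta>)) - K\<bar> \<le> C * (\<eta> * log_scale \<eta> ^ 4)) (at_right 0)"
proof -
  obtain a where a: "a > 0" "\<And>v. wstar \<le> v \<Longrightarrow> v \<le> 1 \<Longrightarrow> a * (v - wstar)^2 \<le> gap v"
    by (rule gap_quadratic) blast
  obtain c where c: "c > 0" "\<And>k. k \<ge> 1 \<Longrightarrow> c / (1 + ln (real k)) \<le> orbit 0 k - wstar"
    by (rule critical_orbit_ge_log) blast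
  obtain D K where D: "D \<ge> 0"
    "\<And>m. m \<ge> 1 \<Longrightarrow> \<bar>passage_time 0 (orbit 0 m) - ln (real m) - K\<bar> \<le> D / sqrt (real m)"
    by (rule critical_passage_time_limit) blast
  define b where "b = a * c^2 / 4"
  have b: "b > 0" using a c by (simp add: b_def)
  define C where "C = 1 / b + 1 / b^2 + D"
  have "C \<ge> 0" using b D by (simp add: C_def)
  moreover have "eventually (\<lambda>\<eta>. (\<forall>j\<le>switch \<eta>. wstar < orbit \<eta> j) \<and>
       \<bar>passage_time \<eta> (orbit \<eta> (switch \<eta>)) - ln (real (switch \<eta>)) - K\<bar> \<le> C * (\<eta> * log_scale \<eta> ^ 4)) (at_right 0)"
  proof -
    have "((\<lambda>\<eta>. \<eta> * log_scale \<eta> ^ 2) \<longlongrightarrow> 0) (at_right 0)"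
      unfolding log_scale_def by real_asymp
    hence "eventually (\<lambda>\<eta>. \<eta> * log_scale \<eta> ^ 2 < c / 2) (at_right 0)"
      by (rule order_tendstoD) (use c in auto)
    moreover have "eventually (\<lambda>\<eta>::real. 0 < \<eta> \<and> \<eta> \<le> 1) (at_right 0)"
      by (rule eventually_at_right_0_le_1)
    ultimately show ?thesis
    proof eventually_elim
      case (elim \<eta>)
      define m where "m = switch \<eta>"
      define l where "l = log_scale \<eta>"
      have \<eta>: "0 < \<eta>" "\<eta> \<le> 1" using elim by auto
      note m = switch_bounds[OF \<eta>, folded m_def l_def]
      have small: "\<eta> * (1 + ln (real j)) + c / (2 * l) \<le> orbit 0 j - wstar" if j: "1 \<le> j" "j \<le> m" for j
      proof -
        have "ln (real j) \<le> ln (real m)" "0 \<le> ln (real j)" using j by simp_all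
        hence lj: "1 + ln (real j) \<le> l" "1 \<le> 1 + ln (real j)" using m(3) by linarith+
        have "\<eta> * l \<le> c / (2 * l)" using elim(1) m(4) by (simp add: l_def[symmetric] field_simps power2_eq_square)
        moreover have "\<eta> * (1 + ln (real j)) \<le> \<eta> * l" using lj \<eta> by (intro mult_left_mono) auto
        moreover have "c / (2 * l) + c / (2 * l) = c / l" by simp
        moreover have "c / l \<le> c / (1 + ln (real j))" using lj c by (intro divide_left_mono mult_pos_pos) auto
        ultimately show ?thesis using c(2)[OF j(1)] by linarith
      qed
      have cl: "0 < c / (2 * l)" using c m by simp
      have near: "orbit 0 j - \<eta> * (1 + ln (real j)) \<le> orbit \<eta> j \<and> orbit \<eta> j \<le> orbit 0 j" if "1 \<le> j" "j \<le> m" for j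
      proof (rule orbit_near_critical[where m = m])
        show "\<eta> * (1 + ln (real i)) \<le> orbit 0 i - wstar" if "1 \<le> i" "i \<le> m" for i
          using small[OF that] cl by linarith
      qed (use \<eta> that in auto)
      have above: "wstar + c / (2 * l) \<le> orbit \<eta> j" if "1 \<le> j" "j \<le> m" for j
        using near[OF that] small[OF that] by linarith
      have all: "wstar < orbit \<eta> j" if "j \<le> m" for j
        using above[of j] that cl wstar_less_1 by (cases "j = 0") auto
      define u where "u = orbit \<eta> m"
      define v where "v = orbit 0 m"
      have \<eta>l: "\<eta> * (1 + ln (real m)) \<le> \<eta> * l" using m(3) \<eta> by (intro mult_left_mono) auto
      have uv: "wstar < u" "u \<le> v" "v \<le> 1" "v - u \<le> \<eta> * l"
        using all[of m] near[of m] m(2) critical_orbit_bounds[of m] \<eta>l unfolding u_def v_def by auto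
      have "a * (c / (2 * l))^2 \<le> a * (u - wstar)^2"
        using above[of m] cl m a by (intro mult_left_mono power_mono) (auto simp: u_def)
      also have "\<dots> \<le> gap u" using uv by (intro a) auto
      finally have gu: "b / l^2 \<le> gap u" by (simp add: b_def power_divide power_mult_distrib)
      have "\<bar>passage_time \<eta> u - passage_time 0 v\<bar> \<le> (v - u) / (b / l^2) + \<eta> / (b / l^2)^2"
        by (rule passage_time_perturb) (use uv \<eta> gu b m in auto)
      also have "(v - u) / (b / l^2) \<le> (\<eta> * l) / (b / l^2)" using uv b m by (intro divide_right_mono) auto
      also have "\<dots> = 1 / b * (\<eta> * l^3)" using b by (simp add: power2_eq_square power3_eq_cube)
      also have "\<dots> \<le> 1 / b * (\<eta> * l^4)"
        using b \<eta> m by (intro mult_left_mono power_increasing) auto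
      also have "\<eta> / (b / l^2)^2 = 1 / b^2 * (\<eta> * l^4)" by (simp add: power_divide flip: power_mult)
      finally have 1: "\<bar>passage_time \<eta> u - passage_time 0 v\<bar> \<le> (1 / b + 1 / b^2) * (\<eta> * l^4)"
        by (simp add: algebra_simps)
      have "D / sqrt (real m) \<le> D * (\<eta> * l^4)"
      proof -
        have "sqrt (1 / \<eta>^4) \<le> sqrt (real m)" using m by simp
        moreover have "sqrt (1 / \<eta>^4) = sqrt ((1 / \<eta>^2)^2)" by (simp add: power_divide flip: power_mult)
        hence "sqrt (1 / \<eta>^4) = 1 / \<eta>^2" by simp
        ultimately have "1 / sqrt (real m) \<le> 1 / (1 / \<eta>^2)" using \<eta> by (intro frac_le) auto
        also have "\<dots> \<le> \<eta> * 1" using \<eta> by (simp add: power2_eq_square mult_left_le)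
        also have "\<dots> \<le> \<eta> * l^4" using \<eta> m by (intro mult_left_mono one_le_power) auto
        finally have "D * (1 / sqrt (real m)) \<le> D * (\<eta> * l^4)" by (intro mult_left_mono D)
        thus ?thesis by simp
      qed
      hence 2: "\<bar>passage_time 0 v - ln (real m) - K\<bar> \<le> D * (\<eta> * l^4)"
        using D(2)[OF m(2)] by (simp add: v_def)
      have "\<bar>passage_time \<eta> u - ln (real m) - K\<bar> \<le> C * (\<eta> * l^4)"
        unfolding C_def using 1 2 by (simp add: algebra_simps)
      thus ?case using all by (simp add: u_def m_def l_def)
    qed
  qed
  ultimately show ?thesis using that by blast
qed

end

section \<open>The bottleneck and extinction\<close>

context hardy_parameter
begin

text \<open>
  Once \<open>k \<ge> switch \<eta>\<close>, the crude bounds \<open>\<eta>\<close> for the speed and \<open>\<eta> / 2\<close> for the position suffice in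
  \<open>passage_time_step\<close>, and the passage through the bottleneck needs no further care.
\<close>

lemma middle_phase:
  obtains C where "C \<ge> 0"
    "eventually (\<lambda>\<eta>. (\<forall>j\<le>switch \<eta>. 0 < orbit \<eta> j) \<longrightarrow> (\<exists>n\<ge>switch \<eta>. (\<forall>j\<le>n. 0 < orbit \<eta> j) \<and> orbit \<eta> n < \<eta> \<and>
       \<bar>(passage_time \<eta> (orbit \<eta> n) - ln (real n))
         - (passage_time \<eta> (orbit \<eta> (switch \<eta>)) - ln (real (switch \<eta>)))\<bar> \<le> C * \<eta>)) (at_right 0)"
proof -
  obtain C where C: "C > 0" and time_step:
    "\<And>\<eta> k \<delta> \<gamma>. 0 \<le> \<eta> \<Longrightarrow> \<eta> \<le> 1 \<Longrightarrow> k \<ge> 1 \<Longrightarrow> 0 < \<delta> \<Longrightarrow> \<delta> \<le> 1 \<Longrightarrow> 0 < \<gamma> \<Longrightarrow>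
       \<delta> \<le> orbit \<eta> k \<Longrightarrow> orbit \<eta> k \<le> 1 \<Longrightarrow> \<delta> \<le> orbit \<eta> (Suc k) \<Longrightarrow>
       (\<And>w. min (orbit \<eta> k) (orbit \<eta> (Suc k)) \<le> w \<Longrightarrow> w \<le> 1 \<Longrightarrow> \<gamma> \<le> gap w + \<eta>) \<Longrightarrow>
       \<bar>passage_time \<eta> (orbit \<eta> (Suc k)) - passage_time \<eta> (orbit \<eta> k) - 1 / real (Suc k)\<bar>
         \<le> C / (\<delta>^2 * \<gamma> * real k ^ 2)"
    by (rule passage_time_step) blast
  have "((\<lambda>\<eta>. \<eta>^3 * (2 * (mustar + 1))) \<longlongrightarrow> 0) (at_right 0)" by real_asymp
  hence "eventually (\<lambda>\<eta>. \<eta>^3 * (2 * (mustar + 1)) < 1) (at_right 0)" by (rule order_tendstoD) auto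
  moreover have "eventually (\<lambda>\<eta>::real. 0 < \<eta> \<and> \<eta> \<le> 1) (at_right 0)"
    by (rule eventually_at_right_0_le_1)
  ultimately have "eventually (\<lambda>\<eta>. (\<forall>j\<le>switch \<eta>. 0 < orbit \<eta> j) \<longrightarrow> (\<exists>n\<ge>switch \<eta>. (\<forall>j\<le>n. 0 < orbit \<eta> j) \<and> orbit \<eta> n < \<eta> \<and>
       \<bar>(passage_time \<eta> (orbit \<eta> n) - ln (real n))
         - (passage_time \<eta> (orbit \<eta> (switch \<eta>)) - ln (real (switch \<eta>)))\<bar> \<le> (8 * C + 2) * \<eta>)) (at_right 0)"
  proof eventually_elim
    case (elim \<eta>)
    have \<eta>: "0 < \<eta>" "\<eta> \<le> 1" and \<eta>3: "\<eta>^3 * (2 * (mustar + 1)) \<le> 1" using elim by auto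
    define m where "m = switch \<eta>"
    note m = switch_bounds(1,2)[OF \<eta>, folded m_def]
    have m': "1 / real m \<le> \<eta>^4" using m \<eta> by (simp add: field_simps)
    show ?case
    proof (intro impI, fold m_def)
      assume pos_m: "\<forall>j\<le>m. 0 < orbit \<eta> j"
      obtain k0 where k0: "orbit \<eta> k0 \<le> 0" using orbit_hits_zero \<eta> by blast
      hence "\<not> k0 \<le> m" using pos_m by force
      define n where "n = (LEAST n. n \<ge> m \<and> orbit \<eta> n < \<eta>)"
      have n: "n \<ge> m \<and> orbit \<eta> n < \<eta>"
        unfolding n_def by (rule LeastI[of _ k0]) (use k0 \<open>\<not> k0 \<le> m\<close> \<eta> in auto)
      have ge: "\<eta> \<le> orbit \<eta> j" if "m \<le> j" "j < n" for j
        using not_less_Least[of j "\<lambda>n. n \<ge> m \<and> orbit \<eta> n < \<eta>"] that by (auto simp: n_def not_less)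
      have pos_less: "0 < orbit \<eta> j" if "j < n" for j
        using ge[of j] pos_m that \<eta> by (cases "j \<le> m") auto
      have le1: "orbit \<eta> j \<le> 1" if "j \<le> n" for j
        by (rule orbit_le_1) (use that pos_less \<eta> in auto)
      \<comment> \<open>the step that crosses \<open>\<eta>\<close> overshoots by at most \<open>\<eta> / 2\<close>\<close>
      have half: "\<eta> / 2 \<le> orbit \<eta> (Suc j)" if j: "m \<le> j" "j < n" for j
      proof -
        have "(mustar + 1) / real (Suc j) \<le> (mustar + 1) / real m"
          using j m mustar_pos by (intro divide_left_mono) auto
        also have "\<dots> = (mustar + 1) * (1 / real m)" by simp
        also have "\<dots> \<le> (mustar + 1) * \<eta>^4" using m' mustar_pos by (intro mult_left_mono) auto
        also have "\<dots> = \<eta> / 2 * (\<eta>^3 * (2 * (mustar + 1)))" by (simp add: power4_eq_xxxx power3_eq_cube)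
        also have "\<dots> \<le> \<eta> / 2 * 1" using \<eta>3 \<eta> by (intro mult_left_mono) auto
        finally have "(mustar + 1) / real (Suc j) \<le> \<eta> / 2" by simp
        moreover have "orbit \<eta> (Suc j) \<ge> orbit \<eta> j - (mustar + 1) / real (Suc j)"
          by (rule orbit_pos_step(2)) (use \<eta> le1[of j] pos_less[of j] j in auto)
        ultimately show ?thesis using ge[OF j] by linarith
      qed
      have pos: "0 < orbit \<eta> j" if "j \<le> n" for j
      proof (cases "j \<le> m \<or> j < n")
        case True
        thus ?thesis using pos_m pos_less by blast
      next
        case False
        then obtain i where i: "j = Suc i" by (cases j) auto
        have "m \<le> i" "i < n" using i that False by linarith+
        thus ?thesis using half[of i] \<eta> i by (simp del: dual_orbit.simps)
      qed
      define Q where "Q k = passage_time \<eta> (orbit \<eta> k) - ln (real k)" for k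
      define E where "E = 4 * C / \<eta>^3 + 1"
      have E: "E > 0" using C \<eta> by (simp add: E_def add_pos_pos)
      have Q_step: "\<bar>Q (Suc k) - Q k\<bar> \<le> 2 * E * (1 / real k - 1 / real (Suc k))" if k: "m \<le> k" "k < n" for k
      proof -
        have k1: "k \<ge> 1" using k m by simp
        have "\<bar>passage_time \<eta> (orbit \<eta> (Suc k)) - passage_time \<eta> (orbit \<eta> k) - 1 / real (Suc k)\<bar>
            \<le> C / ((\<eta> / 2)^2 * \<eta> * real k ^ 2)"
        proof (rule time_step)
          fix w assume "min (orbit \<eta> k) (orbit \<eta> (Suc k)) \<le> w"
          hence "0 \<le> w" using ge[OF k] half[OF k] \<eta> by linarith
          thus "\<eta> \<le> gap w + \<eta>" using gap_nonneg by simp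
        qed (use k k1 \<eta> ge[OF k] half[OF k] le1[of k] in \<open>auto simp del: dual_orbit.simps\<close>)
        also have "C / ((\<eta> / 2)^2 * \<eta> * real k ^ 2) = (4 * C / \<eta>^3) * (1 / real k ^ 2)"
          by (simp add: power2_eq_square power3_eq_cube)
        finally have "\<bar>Q (Suc k) - Q k\<bar> \<le> E * (1 / real k ^ 2)"
          using ln_Suc_diff_bounds[OF k1] inverse_diff_le[OF k1] unfolding E_def Q_def distrib_right abs_le_iff
          by linarith
        moreover have "1 / real k ^ 2 \<le> 2 * (1 / real k - 1 / real (Suc k))"
        proof -
          have "1 / (2 * (real k * real k)) \<le> 1 / (real k * real (Suc k))" using k1 by (intro frac_le) auto
          also have "\<dots> = 1 / real k - 1 / real (Suc k)" using k1 by (simp add: field_simps)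
          finally show ?thesis by (simp add: power2_eq_square)
        qed
        hence "E * (1 / real k ^ 2) \<le> E * (2 * (1 / real k - 1 / real (Suc k)))"
          using E by (intro mult_left_mono) auto
        ultimately show ?thesis by (simp only: mult.assoc mult.left_commute[of E 2])
      qed
      have "\<bar>Q k - Q m\<bar> \<le> 2 * E * (1 / real m - 1 / real k)" if "m \<le> k" "k \<le> n" for k
        using that
      proof (induction k rule: dec_induct)
        case (step k)
        have "\<bar>Q (Suc k) - Q m\<bar> \<le> \<bar>Q (Suc k) - Q k\<bar> + \<bar>Q k - Q m\<bar>" by linarith
        also have "\<dots> \<le> 2 * E * (1 / real k - 1 / real (Suc k)) + 2 * E * (1 / real m - 1 / real k)"
          using step Q_step[of k] by (intro add_mono) auto
        also have "\<dots> = 2 * E * (1 / real m - 1 / real (Suc k))" by (simp add: algebra_simps)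
        finally show ?case .
      qed simp
      hence "\<bar>Q n - Q m\<bar> \<le> 2 * E * (1 / real m - 1 / real n)" using n by blast
      also have "\<dots> \<le> 2 * E * \<eta>^4" using m' E by (intro mult_left_mono) (auto intro: order.trans[of _ "1 / real m"])
      also have "\<dots> = 8 * C * \<eta> + 2 * \<eta>^4" using \<eta> by (simp add: E_def field_simps power4_eq_xxxx power3_eq_cube)
      also have "\<eta>^4 \<le> \<eta>^1" using \<eta> by (intro power_decreasing) auto
      finally have "\<bar>Q n - Q m\<bar> \<le> (8 * C + 2) * \<eta>" by (simp add: algebra_simps)
      thus "\<exists>n\<ge>m. (\<forall>j\<le>n. 0 < orbit \<eta> j) \<and> orbit \<eta> n < \<eta> \<and>
         \<bar>(passage_time \<eta> (orbit \<eta> n) - ln (real n)) - (passage_time \<eta> (orbit \<eta> m) - ln (real m))\<bar> \<le> (8 * C + 2) * \<eta>"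
        using n pos unfolding Q_def by blast
    qed
  qed
  thus ?thesis using that[of "8 * C + 2"] C by auto
qed

definition extinction :: "real \<Rightarrow> nat" where "extinction \<eta> = (LEAST k. orbit \<eta> k \<le> 0)"

lemma extinction:
  assumes "\<eta> > 0"
  shows "orbit \<eta> (extinction \<eta>) \<le> 0" "\<And>j. j < extinction \<eta> \<Longrightarrow> orbit \<eta> j > 0"
  using LeastI_ex[OF orbit_hits_zero[OF assms]] not_less_Least[of _ "\<lambda>k. orbit \<eta> k \<le> 0"]
  by (auto simp: extinction_def not_le)

text \<open>
  Below \<open>\<eta>\<close> the drift is small and the speed stays above a constant, so the rest of the way takes only
  time \<open>O(\<eta>)\<close>, both for the orbit and for the flow.
\<close>

lemma final_phase:
  obtains C where "C \<ge> 0"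
    "eventually (\<lambda>\<eta>. \<forall>n\<ge>switch \<eta>. (\<forall>j\<le>n. 0 < orbit \<eta> j) \<longrightarrow> orbit \<eta> n < \<eta> \<longrightarrow>
       \<bar>ln (real (extinction \<eta>)) - ln (real n)\<bar> \<le> C * \<eta> \<and>
       \<bar>passage_time \<eta> 0 - passage_time \<eta> (orbit \<eta> n)\<bar> \<le> C * \<eta>) (at_right 0)"
proof -
  have "\<exists>d>0. \<forall>x\<in>{0..}. dist x 0 < d \<longrightarrow> dist (gap x) (gap 0) < mustar / 4"
    using continuous_on_gap mustar_pos unfolding continuous_on_iff by (metis atLeast_iff divide_pos_pos order_refl zero_less_numeral)
  then obtain d where d: "d > 0" "\<And>x. 0 \<le> x \<Longrightarrow> x < d \<Longrightarrow> \<bar>gap x - mustar\<bar> < mustar / 4"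
    by (auto simp: gap_0 dist_real_def)
  define C where "C = 8 / mustar"
  have C: "C \<ge> 0" using mustar_pos by (simp add: C_def)
  have "((\<lambda>\<eta>. \<eta> + mustar * \<eta>^4) \<longlongrightarrow> 0) (at_right 0)" by real_asymp
  hence "eventually (\<lambda>\<eta>. \<eta> + mustar * \<eta>^4 < d) (at_right 0)" by (rule order_tendstoD) (use d in auto)
  moreover have "((\<lambda>\<eta>. (mustar + 1) * \<eta>^3) \<longlongrightarrow> 0) (at_right 0)" by real_asymp
  hence "eventually (\<lambda>\<eta>. (mustar + 1) * \<eta>^3 < 1) (at_right 0)" by (rule order_tendstoD) auto
  moreover have "eventually (\<lambda>\<eta>::real. 0 < \<eta> \<and> \<eta> \<le> 1) (at_right 0)"
    by (rule eventually_at_right_0_le_1)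
  ultimately have "eventually (\<lambda>\<eta>. \<forall>n\<ge>switch \<eta>. (\<forall>j\<le>n. 0 < orbit \<eta> j) \<longrightarrow> orbit \<eta> n < \<eta> \<longrightarrow>
       \<bar>ln (real (extinction \<eta>)) - ln (real n)\<bar> \<le> C * \<eta> \<and>
       \<bar>passage_time \<eta> 0 - passage_time \<eta> (orbit \<eta> n)\<bar> \<le> C * \<eta>) (at_right 0)"
  proof eventually_elim
    case (elim \<eta>)
    have \<eta>: "0 < \<eta>" "\<eta> \<le> 1" and \<eta>d: "\<eta> + mustar * \<eta>^4 < d" and \<eta>3: "(mustar + 1) * \<eta>^3 < 1" using elim by auto
    define N where "N = extinction \<eta>"
    note N = extinction[OF \<eta>(1), folded N_def]
    note m = switch_bounds(1,2)[OF \<eta>]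
    show ?case
    proof (intro allI impI)
      fix n assume n: "n \<ge> switch \<eta>" and pos: "\<forall>j\<le>n. 0 < orbit \<eta> j" and small: "orbit \<eta> n < \<eta>"
      have nN: "n < N" using N(1) pos by (metis not_le)
      have inv: "1 / real k \<le> \<eta>^4" if "n \<le> k" for k
      proof -
        have "1 / real k \<le> 1 / real (switch \<eta>)" using that n m by (intro frac_le) auto
        also have "\<dots> \<le> \<eta>^4" using m \<eta> by (simp add: field_simps)
        finally show ?thesis .
      qed
      have mu_inv: "(mustar + 1) / real k \<le> \<eta>" if "n \<le> k" for k
      proof -
        have "(mustar + 1) * (1 / real k) \<le> (mustar + 1) * \<eta>^4"
          using inv[OF that] mustar_pos by (intro mult_left_mono) auto
        also have "\<dots> = ((mustar + 1) * \<eta>^3) * \<eta>" by (simp add: power4_eq_xxxx power3_eq_cube)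
        also have "\<dots> \<le> 1 * \<eta>" using \<eta>3 \<eta> by (intro mult_right_mono) auto
        finally show ?thesis by simp
      qed
      have fall: "orbit \<eta> k < \<eta> \<and> orbit \<eta> k + mustar / 4 * ln (real k) \<le> orbit \<eta> n + mustar / 4 * ln (real n)"
        if "n \<le> k" "k \<le> N" for k
        using that
      proof (induction k rule: dec_induct)
        case (step k)
        have k: "k \<ge> 1" "k < N" using step n m by auto
        define P where "P = mean_step q k (orbit \<eta> k)"
        have P: "P > 0" unfolding P_def by (rule mean_step_pos)
        note b = orbit_step_bounds[of \<eta> k, folded P_def]
        have "P \<le> orbit \<eta> k + mustar * (1 / real k)" using b(2) \<eta> N(2)[OF k(2)] k by simp
        also have "\<dots> \<le> orbit \<eta> k + mustar * \<eta>^4" using inv[of k] step mustar_pos by (intro add_left_mono mult_left_mono) auto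
        finally have "P < d" using \<eta>d step by simp
        hence "drift P \<le> mustar / 4" using d(2)[of P] P by (simp add: gap_def abs_less_iff)
        hence "drift P / real k \<le> mustar / 4 / real k" by (intro divide_right_mono) auto
        moreover have "(mustar + \<eta>) / real (Suc k) \<ge> mustar / (2 * real k)"
          using mustar_pos \<eta> k by (intro frac_le) auto
        moreover have "mustar / (2 * real k) = 2 * (mustar / 4 / real k)" by simp
        ultimately have 1: "orbit \<eta> (Suc k) \<le> orbit \<eta> k - mustar / 4 / real k"
          using b(1) \<eta> N(2)[OF k(2)] k by linarith
        moreover have "mustar / 4 / real k \<ge> 0" using mustar_pos by simp
        moreover have "mustar / 4 * (ln (real (Suc k)) - ln (real k)) \<le> mustar / 4 * (1 / real k)"
          using ln_Suc_diff_bounds(2)[OF k(1)] mustar_pos by (intro mult_left_mono) auto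
        ultimately show ?case using step by (simp add: right_diff_distrib del: dual_orbit.simps of_nat_Suc)
      qed (use small in simp)
      have oN: "orbit \<eta> N \<ge> - \<eta>"
      proof -
        obtain i where i: "N = Suc i" "n \<le> i" using nN by (cases N) auto
        have "orbit \<eta> i > 0" "orbit \<eta> i < \<eta>" using N(2)[of i] fall[of i] i by auto
        thus ?thesis using orbit_pos_step(2)[of \<eta> i] \<eta> mu_inv[of "Suc i"] i by (simp del: dual_orbit.simps of_nat_Suc)
      qed
      have "mustar / 4 * (ln (real N) - ln (real n)) \<le> 2 * \<eta>"
        using fall[of N] oN nN small by (simp add: right_diff_distrib)
      hence "ln (real N) - ln (real n) \<le> C * \<eta>" using mustar_pos by (simp add: C_def field_simps)
      moreover have "ln (real n) \<le> ln (real N)" using nN n m by simp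
      ultimately have ln: "\<bar>ln (real N) - ln (real n)\<bar> \<le> C * \<eta>" by simp
      define u where "u = orbit \<eta> n"
      have u: "0 < u" "u < \<eta>" using pos small by (auto simp: u_def)
      have rate: "0 \<le> 1 / (gap w + \<eta>)" "1 / (gap w + \<eta>) \<le> 2 / mustar" if "0 \<le> w" "w \<le> u" for w
      proof -
        have "mustar * \<eta>^4 \<ge> 0" using mustar_pos by simp
        hence "w < d" using that u \<eta>d by linarith
        hence g: "gap w + \<eta> \<ge> mustar / 2" using d(2)[of w] that \<eta> mustar_pos by linarith
        thus "0 \<le> 1 / (gap w + \<eta>)" using mustar_pos by simp
        have "1 / (gap w + \<eta>) \<le> 1 / (mustar / 2)" using g mustar_pos by (intro frac_le) auto
        thus "1 / (gap w + \<eta>) \<le> 2 / mustar" by simp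
      qed
      have int: "(\<lambda>w. 1 / (gap w + \<eta>)) integrable_on {0..u}"
        using gap_nonneg \<eta> by (intro integrable_continuous_real continuous_on_rate) (auto intro: add_nonneg_pos)
      have "passage_time \<eta> 0 = integral {0..u} (\<lambda>w. 1 / (gap w + \<eta>)) + passage_time \<eta> u"
      proof (rule passage_time_split)
        show "gap w + \<eta> > 0" if "0 \<le> w" for w using gap_nonneg[OF that] \<eta> by simp
      qed (use u \<eta> in auto)
      moreover have "0 \<le> integral {0..u} (\<lambda>w. 1 / (gap w + \<eta>))"
        using rate by (intro integral_nonneg int) auto
      moreover have "integral {0..u} (\<lambda>w. 1 / (gap w + \<eta>)) \<le> integral {0..u} (\<lambda>w. 2 / mustar)"
        using rate by (intro integral_le int) auto
      moreover have "integral {0..u} (\<lambda>w. 2 / mustar) = 2 / mustar * u" using u by simp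
      moreover have "2 / mustar * u \<le> C * \<eta>" using u mustar_pos unfolding C_def by (intro mult_mono divide_right_mono) auto
      ultimately have "\<bar>passage_time \<eta> 0 - passage_time \<eta> u\<bar> \<le> C * \<eta>" by linarith
      thus "\<bar>ln (real (extinction \<eta>)) - ln (real n)\<bar> \<le> C * \<eta> \<and>
          \<bar>passage_time \<eta> 0 - passage_time \<eta> (orbit \<eta> n)\<bar> \<le> C * \<eta>"
        using ln by (simp add: u_def N_def)
    qed
  qed
  thus ?thesis using that[OF C] by blast
qed

text \<open>
  The three phases combined: \<open>\<eta>\<close> times a power of \<open>ln (1 / \<eta>)\<close> bounds all errors.
\<close>

theorem ln_extinction_asymp:
  obtains K where "((\<lambda>\<eta>. (ln (real (extinction \<eta>)) - passage_time \<eta> 0 - K) / sqrt \<eta>) \<longlongrightarrow> 0) (at_right 0)"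
proof -
  obtain C1 K where 1: "C1 \<ge> 0"
    "eventually (\<lambda>\<eta>. (\<forall>j\<le>switch \<eta>. wstar < orbit \<eta> j) \<and>
       \<bar>passage_time \<eta> (orbit \<eta> (switch \<eta>)) - ln (real (switch \<eta>)) - K\<bar> \<le> C1 * (\<eta> * log_scale \<eta> ^ 4)) (at_right 0)"
    by (rule initial_phase)
  obtain C2 where 2: "C2 \<ge> 0"
    "eventually (\<lambda>\<eta>. (\<forall>j\<le>switch \<eta>. 0 < orbit \<eta> j) \<longrightarrow> (\<exists>n\<ge>switch \<eta>. (\<forall>j\<le>n. 0 < orbit \<eta> j) \<and> orbit \<eta> n < \<eta> \<and>
       \<bar>(passage_time \<eta> (orbit \<eta> n) - ln (real n))
         - (passage_time \<eta> (orbit \<eta> (switch \<eta>)) - ln (real (switch \<eta>)))\<bar> \<le> C2 * \<eta>)) (at_right 0)"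
    by (rule middle_phase)
  obtain C3 where 3: "C3 \<ge> 0"
    "eventually (\<lambda>\<eta>. \<forall>n\<ge>switch \<eta>. (\<forall>j\<le>n. 0 < orbit \<eta> j) \<longrightarrow> orbit \<eta> n < \<eta> \<longrightarrow>
       \<bar>ln (real (extinction \<eta>)) - ln (real n)\<bar> \<le> C3 * \<eta> \<and>
       \<bar>passage_time \<eta> 0 - passage_time \<eta> (orbit \<eta> n)\<bar> \<le> C3 * \<eta>) (at_right 0)"
    by (rule final_phase)
  define err where "err \<eta> = C1 * (\<eta> * log_scale \<eta> ^ 4) + C2 * \<eta> + 2 * C3 * \<eta>" for \<eta>
  have "eventually (\<lambda>\<eta>. \<bar>ln (real (extinction \<eta>)) - passage_time \<eta> 0 - (- K)\<bar> \<le> err \<eta>) (at_right 0)"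
    using 1(2) 2(2) 3(2)
  proof eventually_elim
    case (elim \<eta>)
    have "\<forall>j\<le>switch \<eta>. 0 < orbit \<eta> j" using elim(1) wstar_pos by (meson less_trans)
    then obtain n where n: "n \<ge> switch \<eta>" "\<forall>j\<le>n. 0 < orbit \<eta> j" "orbit \<eta> n < \<eta>"
      "\<bar>(passage_time \<eta> (orbit \<eta> n) - ln (real n))
         - (passage_time \<eta> (orbit \<eta> (switch \<eta>)) - ln (real (switch \<eta>)))\<bar> \<le> C2 * \<eta>"
      using elim(2) by blast
    hence "\<bar>ln (real (extinction \<eta>)) - ln (real n)\<bar> \<le> C3 * \<eta>"
      "\<bar>passage_time \<eta> 0 - passage_time \<eta> (orbit \<eta> n)\<bar> \<le> C3 * \<eta>" using elim(3) by blast+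
    thus ?case using n(4) conjunct2[OF elim(1)] unfolding err_def abs_le_iff by linarith
  qed
  hence "eventually (\<lambda>\<eta>. norm ((ln (real (extinction \<eta>)) - passage_time \<eta> 0 - (- K)) / sqrt \<eta>) \<le> err \<eta> / sqrt \<eta>) (at_right 0)"
    using eventually_at_right_less[of 0] by eventually_elim (auto simp: abs_divide intro!: divide_right_mono)
  moreover have "((\<lambda>\<eta>. err \<eta> / sqrt \<eta>) \<longlongrightarrow> 0) (at_right 0)"
    unfolding err_def log_scale_def by real_asymp
  ultimately have "((\<lambda>\<eta>. (ln (real (extinction \<eta>)) - passage_time \<eta> 0 - (- K)) / sqrt \<eta>) \<longlongrightarrow> 0) (at_right 0)"
    by (rule Lim_null_comparison)
  thus ?thesis using that by blast
qed

end

section \<open>Integrals of reciprocals near a double zero\<close>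

lemma ln_quadratic_deriv:
  fixes b \<eta> z :: real
  assumes "b > 0" "\<eta> > 0"
  shows "((\<lambda>z. ln (b * z^2 + \<eta>)) has_real_derivative 2 * b * z / (b * z^2 + \<eta>)) (at z within S)"
proof -
  have "b * z^2 + \<eta> > 0" using assms by (simp add: add_nonneg_pos)
  thus ?thesis by (auto intro!: derivative_eq_intros)
qed

lemma integral_abs_over_quadratic:
  fixes b \<delta> \<eta> :: real
  assumes "b > 0" "\<delta> > 0" "\<eta> > 0"
  shows "((\<lambda>z. \<bar>z\<bar> / (b * z^2 + \<eta>)) has_integral (ln (b * \<delta>^2 + \<eta>) - ln \<eta>) / b) {-\<delta>..\<delta>}"
proof -
  define F where "F z = ln (b * z^2 + \<eta>) / (2 * b)" for z
  have F: "(F has_real_derivative z / (b * z^2 + \<eta>)) (at z within S)" for z S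
  proof -
    have "(F has_real_derivative (2 * b * z / (b * z^2 + \<eta>)) / (2 * b)) (at z within S)"
      unfolding F_def by (rule DERIV_cdivide[OF ln_quadratic_deriv]) (use assms in auto)
    also have "(2 * b * z / (b * z^2 + \<eta>)) / (2 * b) = z / (b * z^2 + \<eta>)"
      using assms by (simp only: divide_divide_eq_left mult.commute[of _ "2 * b"]) simp
    finally show ?thesis .
  qed
  have "((\<lambda>z. z / (b * z^2 + \<eta>)) has_integral F \<delta> - F 0) {0..\<delta>}"
    by (rule fundamental_theorem_of_calculus)
       (use assms F in \<open>auto simp flip: has_real_derivative_iff_has_vector_derivative\<close>)
  hence right: "((\<lambda>z. \<bar>z\<bar> / (b * z^2 + \<eta>)) has_integral F \<delta> - F 0) {0..\<delta>}"
    by (rule has_integral_eq[rotated]) auto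
  have "((\<lambda>z. - (z / (b * z^2 + \<eta>))) has_integral - (F 0 - F (-\<delta>))) {-\<delta>..0}"
    by (rule has_integral_neg, rule fundamental_theorem_of_calculus)
       (use assms F in \<open>auto simp flip: has_real_derivative_iff_has_vector_derivative\<close>)
  hence left: "((\<lambda>z. \<bar>z\<bar> / (b * z^2 + \<eta>)) has_integral - (F 0 - F (-\<delta>))) {-\<delta>..0}"
    by (rule has_integral_eq[rotated]) auto
  have "- (F 0 - F (-\<delta>)) + (F \<delta> - F 0) = (ln (b * \<delta>^2 + \<eta>) - ln \<eta>) / b"
    using assms by (simp add: F_def field_simps)
  thus ?thesis using has_integral_combine[OF _ _ left right] assms by simp
qed

lemma integral_quadratic_over_quadratic:
  fixes b \<delta> \<eta> p0 p1 p2 :: real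
  assumes "b > 0" "\<delta> > 0" "\<eta> > 0"
  shows "((\<lambda>z. (p0 + p1 * z + p2 * z^2) / (b * z^2 + \<eta>)) has_integral
           2 * (p0 - p2 * \<eta> / b) / sqrt (b * \<eta>) * arctan (\<delta> * sqrt (b / \<eta>)) + 2 * p2 * \<delta> / b) {-\<delta>..\<delta>}"
proof -
  have pos: "b * z^2 + \<eta> > 0" for z using assms by (simp add: add_nonneg_pos)
  define k where "k = sqrt (b / \<eta>)"
  have k: "k > 0" "k^2 = b / \<eta>" "sqrt (b * \<eta>) = \<eta> * k"
  proof -
    have "b * \<eta> = \<eta>^2 * (b / \<eta>)" using assms by (simp add: power2_eq_square)
    thus "sqrt (b * \<eta>) = \<eta> * k" using assms unfolding k_def by (simp only: real_sqrt_mult) simp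
  qed (use assms in \<open>auto simp: k_def\<close>)
  define F where "F z = (p0 - p2 * \<eta> / b) / (\<eta> * k) * arctan (z * k) + p1 / (2 * b) * ln (b * z^2 + \<eta>) + p2 * z / b" for z
  have F: "(F has_real_derivative (p0 + p1 * z + p2 * z^2) / (b * z^2 + \<eta>)) (at z within S)" for z S
  proof -
    have "(F has_real_derivative (p0 - p2 * \<eta> / b) / (\<eta> * k) * (k / (1 + (z * k)^2))
            + p1 / (2 * b) * ((2 * b * z) / (b * z^2 + \<eta>)) + p2 / b) (at z within S)"
    proof -
      have "((\<lambda>z. arctan (z * k)) has_real_derivative k / (1 + (z * k)^2)) (at z within S)"
        by (auto intro!: derivative_eq_intros simp: divide_inverse mult.commute)
      moreover have "((\<lambda>z. p2 * z / b) has_real_derivative p2 / b) (at z within S)"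
        using assms by (auto intro!: derivative_eq_intros)
      ultimately show ?thesis unfolding F_def using assms
        by (intro DERIV_add DERIV_cmult ln_quadratic_deriv)
    qed
    also have "1 + (z * k)^2 = (b * z^2 + \<eta>) / \<eta>"
      using assms by (simp add: power_mult_distrib k field_simps)
    also have "(p0 - p2 * \<eta> / b) / (\<eta> * k) * (k / ((b * z^2 + \<eta>) / \<eta>)) = (p0 - p2 * \<eta> / b) / (b * z^2 + \<eta>)"
      using assms k pos[of z] by simp
    also have "p1 / (2 * b) * ((2 * b * z) / (b * z^2 + \<eta>)) = p1 * z / (b * z^2 + \<eta>)" using assms by simp
    also have "p2 / b = (p2 * \<eta> / b + p2 * z^2) / (b * z^2 + \<eta>)"
    proof -
      have "p2 * \<eta> / b + p2 * z^2 = p2 / b * (b * z^2 + \<eta>)" using assms by (simp add: field_simps)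
      thus ?thesis using pos[of z] by simp
    qed
    also have "(p0 - p2 * \<eta> / b) / (b * z^2 + \<eta>) + p1 * z / (b * z^2 + \<eta>)
          + (p2 * \<eta> / b + p2 * z^2) / (b * z^2 + \<eta>) = (p0 + p1 * z + p2 * z^2) / (b * z^2 + \<eta>)"
      by (simp flip: add_divide_distrib)
    finally show ?thesis .
  qed
  have "((\<lambda>z. (p0 + p1 * z + p2 * z^2) / (b * z^2 + \<eta>)) has_integral F \<delta> - F (-\<delta>)) {-\<delta>..\<delta>}"
    by (rule fundamental_theorem_of_calculus)
       (use assms F in \<open>auto simp flip: has_real_derivative_iff_has_vector_derivative\<close>)
  moreover have "F \<delta> - F (-\<delta>) = 2 * (p0 - p2 * \<eta> / b) / (\<eta> * k) * arctan (\<delta> * k) + 2 * p2 * \<delta> / b"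
    by (simp add: F_def arctan_minus diff_divide_distrib ring_distribs mult_ac)
  ultimately show ?thesis by (simp add: k(3) flip: k_def)
qed

text \<open>
  Replacing \<open>H\<close> by its quadratic part changes the reciprocal by a function that is bounded uniformly in
  \<open>\<eta>\<close> and converges as \<open>\<eta>\<close> tends to \<open>0\<close>, since \<open>H\<close> agrees with the square up to fifth order. The
  change in the integral is thus a constant up to \<open>O(\<eta> ln (1 / \<eta>))\<close>; what remains is elementary, and
  its odd part vanishes by symmetry of the interval.
\<close>

lemma near_double_zero_integral:
  fixes H :: "real \<Rightarrow> real" and b C \<delta> p0 p1 p2 :: real
  assumes b: "b > 0" and \<delta>: "\<delta> > 0" and C: "C \<ge> 0"
    and cont: "continuous_on {-\<delta>..\<delta>} H"
    and approx: "\<And>z. \<bar>z\<bar> \<le> \<delta> \<Longrightarrow> \<bar>H z - b * z^2\<bar> \<le> C * \<bar>z\<bar>^5"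
    and lower: "\<And>z. \<bar>z\<bar> \<le> \<delta> \<Longrightarrow> b / 2 * z^2 \<le> H z"
  obtains K where
    "((\<lambda>\<eta>. (integral {-\<delta>..\<delta>} (\<lambda>z. (p0 + p1 * z + p2 * z^2) / (H z + \<eta>))
        - (p0 * pi / sqrt b / sqrt \<eta> + K - p2 * pi / (b * sqrt b) * sqrt \<eta>)) / sqrt \<eta>) \<longlongrightarrow> 0) (at_right 0)"
proof -
  define p where "p z = p0 + p1 * z + p2 * z^2" for z
  define P where "P = \<bar>p0\<bar> + \<bar>p1\<bar> * \<delta> + \<bar>p2\<bar> * \<delta>^2"
  have P: "\<bar>p z\<bar> \<le> P" if "\<bar>z\<bar> \<le> \<delta>" for z
  proof -
    have "\<bar>p z\<bar> \<le> \<bar>p0\<bar> + \<bar>p1\<bar> * \<bar>z\<bar> + \<bar>p2\<bar> * \<bar>z\<bar>^2"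
      unfolding p_def abs_mult[symmetric] power_abs[symmetric] by linarith
    also have "\<dots> \<le> P" unfolding P_def using that by (intro add_mono mult_left_mono power_mono) auto
    finally show ?thesis .
  qed
  have P0: "P \<ge> 0" using P[of 0] \<delta> by linarith
  \<comment> \<open>the correction to the rate, at \<open>\<eta>\<close> and in the limit\<close>
  define E where "E \<eta> z = 1 / (H z + \<eta>) - 1 / (b * z^2 + \<eta>)" for \<eta> z
  define E0 where "E0 z = (if z = 0 then 0 else 1 / H z - 1 / (b * z^2))" for z
  have Hpos: "H z > 0" if "\<bar>z\<bar> \<le> \<delta>" "z \<noteq> 0" for z
    using lower[OF that(1)] that(2) b by (smt (verit) half_gt_zero mult_pos_pos zero_less_power2)
  have H0: "H 0 = 0" using approx[of 0] \<delta> by simp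
  have E0_bound: "\<bar>E0 z\<bar> \<le> 2 * C / b^2 * \<bar>z\<bar>" if z: "\<bar>z\<bar> \<le> \<delta>" for z
  proof (cases "z = 0")
    case False
    have "E0 z = (b * z^2 - H z) / (H z * (b * z^2))"
      using False Hpos[OF z False] b by (simp add: E0_def field_simps)
    hence "\<bar>E0 z\<bar> = \<bar>H z - b * z^2\<bar> / (H z * (b * z^2))"
      using Hpos[OF z False] b False by (simp add: abs_divide abs_mult abs_minus_commute)
    also have "\<dots> \<le> (C * \<bar>z\<bar>^5) / ((b / 2 * z^2) * (b * z^2))"
      using approx[OF z] lower[OF z] b False C by (intro frac_le mult_right_mono mult_pos_pos) auto
    also have "\<dots> = 2 * C / b^2 * \<bar>z\<bar>"
    proof -
      have "\<bar>z\<bar>^5 = \<bar>z\<bar> * (z^2 * z^2)" by (simp add: power_numeral_reduce power2_eq_square)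
      thus ?thesis using False b by (simp add: power2_eq_square)
    qed
    finally show ?thesis .
  qed (use b C in \<open>simp add: E0_def\<close>)
  have E0_cont: "continuous_on {-\<delta>..\<delta>} E0"
    unfolding continuous_on_eq_continuous_within
  proof
    fix z assume z: "z \<in> {-\<delta>..\<delta>}"
    show "continuous (at z within {-\<delta>..\<delta>}) E0"
    proof (cases "z = 0")
      case True
      have "(E0 \<longlongrightarrow> 0) (at 0 within {-\<delta>..\<delta>})"
      proof (rule Lim_null_comparison)
        show "eventually (\<lambda>z. norm (E0 z) \<le> 2 * C / b^2 * \<bar>z\<bar>) (at 0 within {-\<delta>..\<delta>})"
          using E0_bound by (auto simp: eventually_at_filter intro!: always_eventually)
        show "((\<lambda>z. 2 * C / b^2 * \<bar>z\<bar>) \<longlongrightarrow> 0) (at 0 within {-\<delta>..\<delta>})"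
          using b by (auto intro!: tendsto_eq_intros)
      qed
      thus ?thesis using True by (simp add: continuous_within E0_def)
    next
      case False
      have "continuous (at z within {-\<delta>..\<delta>}) (\<lambda>z. 1 / H z - 1 / (b * z^2))"
      proof (intro continuous_intros)
        show "continuous (at z within {-\<delta>..\<delta>}) H"
          using cont z by (simp add: continuous_on_eq_continuous_within)
        show "H z \<noteq> 0" using Hpos[of z] False z by fastforce
      qed (use b False in auto)
      moreover have "eventually (\<lambda>x. x \<noteq> 0) (at z within {-\<delta>..\<delta>})"
        using False by (intro eventually_neq_at_within)
      hence "eventually (\<lambda>x. E0 x = 1 / H x - 1 / (b * x^2)) (at z within {-\<delta>..\<delta>})"
        by eventually_elim (simp add: E0_def)
      moreover have "E0 z = 1 / H z - 1 / (b * z^2)" using False by (simp add: E0_def)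
      ultimately show ?thesis by (simp add: continuous_within tendsto_cong)
    qed
  qed
  have int_E0: "(\<lambda>z. p z * E0 z) integrable_on {-\<delta>..\<delta>}"
    unfolding p_def by (intro integrable_continuous_real continuous_intros E0_cont)
  have E_diff: "\<bar>E \<eta> z - E0 z\<bar> \<le> 6 * C / b^2 * \<eta> * (\<bar>z\<bar> / (b * z^2 + \<eta>))" if z: "\<bar>z\<bar> \<le> \<delta>" and \<eta>: "\<eta> > 0" for z \<eta>
  proof (cases "z = 0")
    case False
    define X where "X = b * z^2"
    define h where "h = H z"
    have X: "X > 0" using b False by (simp add: X_def)
    have h: "h > 0" "X / 2 \<le> h" using Hpos[OF z False] lower[OF z] by (simp_all add: h_def X_def)
    have "E \<eta> z - E0 z = (1 / (h + \<eta>) - 1 / (X + \<eta>)) - (1 / h - 1 / X)"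
      using False by (simp add: E_def E0_def X_def h_def)
    also have "\<dots> = (h - X) * \<eta> / (h * X) * (1 / (X + \<eta>) + 1 / (h + \<eta>) - \<eta> / ((h + \<eta>) * (X + \<eta>)))"
      using X h \<eta> by (simp add: divide_simps) (simp add: algebra_simps power2_eq_square)
    finally have "\<bar>E \<eta> z - E0 z\<bar> = \<bar>h - X\<bar> * (\<eta> / (h * X))
        * \<bar>1 / (X + \<eta>) + 1 / (h + \<eta>) - \<eta> / ((h + \<eta>) * (X + \<eta>))\<bar>"
      using X h \<eta> by (simp add: abs_mult)
    also have "\<dots> \<le> (C * \<bar>z\<bar>^5) * (\<eta> / (X / 2 * X)) * (3 / (X + \<eta>))"
    proof (intro mult_mono)
      show "\<bar>h - X\<bar> \<le> C * \<bar>z\<bar>^5" using approx[OF z] by (simp add: h_def X_def)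
      show "\<eta> / (h * X) \<le> \<eta> / (X / 2 * X)"
        using X h \<eta> by (intro divide_left_mono mult_right_mono mult_pos_pos) auto
      define r where "r = 1 / (X + \<eta>)"
      define r' where "r' = 1 / (h + \<eta>)"
      have "r' \<le> 1 / ((X + \<eta>) / 2)" unfolding r'_def using X h \<eta> by (intro frac_le) auto
      hence "r' \<le> 2 * r" by (simp add: r_def)
      moreover have "0 \<le> r" "0 \<le> r'" "0 \<le> \<eta> * r'" "\<eta> * r' \<le> 1" using X h \<eta> by (auto simp: r_def r'_def)
      moreover have "0 \<le> \<eta> * r' * r" "\<eta> * r' * r \<le> 1 * r"
        using calculation mult_nonneg_nonneg[of "\<eta> * r'" r] mult_right_mono[of "\<eta> * r'" 1 r] by auto
      ultimately have "\<bar>r + r' - \<eta> * r' * r\<bar> \<le> 3 * r" by linarith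
      thus "\<bar>1 / (X + \<eta>) + 1 / (h + \<eta>) - \<eta> / ((h + \<eta>) * (X + \<eta>))\<bar> \<le> 3 / (X + \<eta>)"
        by (simp add: r_def r'_def)
    qed (use X h \<eta> C in auto)
    also have "\<dots> = 6 * C / b^2 * \<eta> * (\<bar>z\<bar> / (X + \<eta>))"
    proof -
      have "\<bar>z\<bar>^5 = \<bar>z\<bar> * (z^2 * z^2)" by (simp add: power_numeral_reduce power2_eq_square)
      hence "\<bar>z\<bar>^5 / (X * X) = \<bar>z\<bar> / b^2" using False b by (simp add: X_def power2_eq_square)
      moreover have "(C * \<bar>z\<bar>^5) * (\<eta> / (X / 2 * X)) * (3 / (X + \<eta>)) = 6 * C * \<eta> * (\<bar>z\<bar>^5 / (X * X)) / (X + \<eta>)"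
        by simp
      ultimately show ?thesis by simp
    qed
    finally show ?thesis by (simp add: X_def)
  qed (simp add: E_def E0_def H0)
  define K0 where "K0 = integral {-\<delta>..\<delta>} (\<lambda>z. p z * E0 z)"
  define A where "A \<eta> = 2 * (p0 - p2 * \<eta> / b) / sqrt (b * \<eta>) * arctan (\<delta> * sqrt (b / \<eta>)) + 2 * p2 * \<delta> / b" for \<eta>
  define err where "err \<eta> = P * (6 * C / b^2 * \<eta>) * ((ln (b * \<delta>^2 + \<eta>) - ln \<eta>) / b)" for \<eta>
  have main: "\<bar>integral {-\<delta>..\<delta>} (\<lambda>z. p z / (H z + \<eta>)) - A \<eta> - K0\<bar> \<le> err \<eta>" if \<eta>: "\<eta> > 0" for \<eta>
  proof -
    have int_A: "((\<lambda>z. p z / (b * z^2 + \<eta>)) has_integral A \<eta>) {-\<delta>..\<delta>}"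
      unfolding p_def A_def by (rule integral_quadratic_over_quadratic[OF b \<delta> \<eta>])
    have pos: "H z + \<eta> > 0" "b * z^2 + \<eta> > 0" if "\<bar>z\<bar> \<le> \<delta>" for z
      using lower[OF that] \<eta> b by (smt (verit) mult_nonneg_nonneg zero_le_power2 half_gt_zero)+
    have int_H: "(\<lambda>z. p z / (H z + \<eta>)) integrable_on {-\<delta>..\<delta>}"
      unfolding p_def using pos
      by (intro integrable_continuous_real continuous_intros cont) (auto simp: abs_le_iff less_imp_neq[symmetric])
    have eq: "p z / (H z + \<eta>) - p z / (b * z^2 + \<eta>) - p z * E0 z = p z * (E \<eta> z - E0 z)" for z
      by (simp add: E_def right_diff_distrib)
    have "((\<lambda>z. p z / (H z + \<eta>) - p z / (b * z^2 + \<eta>) - p z * E0 z) has_integral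
        integral {-\<delta>..\<delta>} (\<lambda>z. p z / (H z + \<eta>)) - A \<eta> - K0) {-\<delta>..\<delta>}"
      unfolding K0_def by (intro has_integral_diff integrable_integral int_H int_E0 int_A)
    hence hi: "((\<lambda>z. p z * (E \<eta> z - E0 z)) has_integral
        integral {-\<delta>..\<delta>} (\<lambda>z. p z / (H z + \<eta>)) - A \<eta> - K0) {-\<delta>..\<delta>}" by (simp only: eq)
    have "norm (integral {-\<delta>..\<delta>} (\<lambda>z. p z * (E \<eta> z - E0 z)))
        \<le> integral {-\<delta>..\<delta>} (\<lambda>z. P * (6 * C / b^2 * \<eta>) * (\<bar>z\<bar> / (b * z^2 + \<eta>)))"
    proof (rule integral_norm_bound_integral)
      show "(\<lambda>z. p z * (E \<eta> z - E0 z)) integrable_on {-\<delta>..\<delta>}" using hi by blast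
      show "(\<lambda>z. P * (6 * C / b^2 * \<eta>) * (\<bar>z\<bar> / (b * z^2 + \<eta>))) integrable_on {-\<delta>..\<delta>}"
        using has_integral_mult_right[OF integral_abs_over_quadratic[OF b \<delta> \<eta>]] by blast
      fix z assume "z \<in> {-\<delta>..\<delta>}"
      hence z: "\<bar>z\<bar> \<le> \<delta>" by auto
      show "norm (p z * (E \<eta> z - E0 z)) \<le> P * (6 * C / b^2 * \<eta>) * (\<bar>z\<bar> / (b * z^2 + \<eta>))"
        using mult_mono[OF P[OF z] E_diff[OF z \<eta>] P0 abs_ge_zero] by (simp add: abs_mult mult.assoc)
    qed
    also have "\<dots> = err \<eta>"
      unfolding err_def by (rule integral_unique has_integral_mult_right integral_abs_over_quadratic b \<delta> \<eta>)+
    finally show ?thesis using integral_unique[OF hi] by simp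
  qed
  define K where "K = K0 - 2 * p0 / (b * \<delta>) + 2 * p2 * \<delta> / b"
  define M where "M \<eta> = p0 * pi / sqrt b / sqrt \<eta> + K - p2 * pi / (b * sqrt b) * sqrt \<eta>" for \<eta>
  have A_lim: "((\<lambda>\<eta>. (A \<eta> + K0 - M \<eta>) / sqrt \<eta>) \<longlongrightarrow> 0) (at_right 0)"
  proof -
    define \<beta> where "\<beta> = sqrt b"
    have \<beta>: "\<beta> > 0" "b = \<beta>^2" using b by (auto simp: \<beta>_def)
    define c where "c = 1 / (\<delta> * \<beta>)"
    have c: "c > 0" using \<beta> \<delta> by (simp add: c_def)
    define y where "y \<eta> = c * sqrt \<eta>" for \<eta>
    have "((\<lambda>\<eta>. (y \<eta> - arctan (y \<eta>)) / \<eta>) \<longlongrightarrow> 0) (at_right 0)" "((\<lambda>\<eta>. arctan (y \<eta>)) \<longlongrightarrow> 0) (at_right 0)"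
      unfolding y_def using c by real_asymp+
    hence "((\<lambda>\<eta>. 2 * p0 / \<beta> * ((y \<eta> - arctan (y \<eta>)) / \<eta>) + 2 * p2 / (\<beta>^2 * \<beta>) * arctan (y \<eta>))
        \<longlongrightarrow> 2 * p0 / \<beta> * 0 + 2 * p2 / (\<beta>^2 * \<beta>) * 0) (at_right 0)"
      by (intro tendsto_intros)
    moreover have "eventually (\<lambda>\<eta>. 2 * p0 / \<beta> * ((y \<eta> - arctan (y \<eta>)) / \<eta>) + 2 * p2 / (\<beta>^2 * \<beta>) * arctan (y \<eta>)
        = (A \<eta> + K0 - M \<eta>) / sqrt \<eta>) (at_right 0)"
      using eventually_at_right_less[of 0]
    proof eventually_elim
      case (elim \<eta>)
      define r where "r = sqrt \<eta>"
      have r: "r > 0" "\<eta> = r^2" using elim by (auto simp: r_def)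
      have "\<delta> * sqrt (b / \<eta>) = 1 / y \<eta>"
        using \<beta> \<delta> r by (simp add: y_def c_def real_sqrt_divide)
      hence at: "arctan (\<delta> * sqrt (b / \<eta>)) = pi / 2 - arctan (y \<eta>)"
        using arctan_inverse[of "y \<eta>"] c r by (simp add: y_def inverse_eq_divide)
      have "sqrt (b * \<eta>) = \<beta> * r" "sqrt b = \<beta>" using \<beta> r by (auto simp: real_sqrt_mult)
      hence "A \<eta> + K0 - M \<eta> = 2 * (p0 - p2 * r^2 / \<beta>^2) / (\<beta> * r) * (pi / 2 - arctan (y \<eta>))
          + 2 * p0 / (\<beta>^2 * \<delta>) - p0 * pi / \<beta> / r + p2 * pi / (\<beta>^2 * \<beta>) * r"
        unfolding A_def M_def K_def at r_def[symmetric] by (simp add: \<beta>(2) r(2))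
      also have "\<dots> / r = 2 * p0 / \<beta> * ((c * r - arctan (y \<eta>)) / r^2) + 2 * p2 / (\<beta>^2 * \<beta>) * arctan (y \<eta>)"
        using \<beta>(1) r(1) \<delta> by (simp add: c_def divide_simps) (simp add: algebra_simps power2_eq_square)
      finally show ?case using elim by (simp add: y_def r_def)
    qed
    ultimately have "((\<lambda>\<eta>. (A \<eta> + K0 - M \<eta>) / sqrt \<eta>) \<longlongrightarrow> 2 * p0 / \<beta> * 0 + 2 * p2 / (\<beta>^2 * \<beta>) * 0) (at_right 0)"
      by (rule Lim_transform_eventually)
    thus ?thesis by simp
  qed
  have "((\<lambda>\<eta>. (integral {-\<delta>..\<delta>} (\<lambda>z. p z / (H z + \<eta>)) - A \<eta> - K0) / sqrt \<eta>) \<longlongrightarrow> 0) (at_right 0)"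
  proof (rule Lim_null_comparison)
    show "eventually (\<lambda>\<eta>. norm ((integral {-\<delta>..\<delta>} (\<lambda>z. p z / (H z + \<eta>)) - A \<eta> - K0) / sqrt \<eta>) \<le> err \<eta> / sqrt \<eta>) (at_right 0)"
      using eventually_at_right_less[of 0]
      by eventually_elim (use main in \<open>auto simp: abs_divide intro!: divide_right_mono\<close>)
    show "((\<lambda>\<eta>. err \<eta> / sqrt \<eta>) \<longlongrightarrow> 0) (at_right 0)"
      unfolding err_def using b \<delta> by real_asymp
  qed
  from tendsto_add[OF this A_lim]
  have "((\<lambda>\<eta>. (integral {-\<delta>..\<delta>} (\<lambda>z. p z / (H z + \<eta>)) - M \<eta>) / sqrt \<eta>) \<longlongrightarrow> 0) (at_right 0)"
    by (simp add: add_divide_distrib[symmetric] diff_divide_distrib[symmetric])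
  thus ?thesis using that unfolding M_def p_def by blast
qed

section \<open>The total passage time\<close>

text \<open>
  The two coefficients of \<open>x\<close> are chosen to remove the terms of order three and four from the
  quartic Taylor polynomial of \<open>gap\<close>, here with \<open>s = q - 1\<close>. The remainder is kept in closed form
  because only its continuity in \<open>z\<close> matters.
\<close>

lemma inverse_series_cancels:
  fixes s z \<alpha> \<beta> a x :: real
  assumes "\<alpha> = - s / 6" "\<beta> = s * (2 * s + 3) / 72"
  defines "a \<equiv> \<alpha> + \<beta> * z"
  defines "x \<equiv> z + a * z^2"
  shows "x^2 / 2 + s * x^3 / 6 + s * (s - 1) * x^4 / 24 - z^2 / 2 = z^5 *
     (\<alpha> * \<beta> + z * \<beta>^2 / 2 + s * \<beta> / 2 + s / 6 * (3 * a^2 + z * a^3)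
      + s * (s - 1) / 24 * (4 * a + 6 * z * a^2 + 4 * z^2 * a^3 + z^3 * a^4))"
proof -
  have "x^2 / 2 + s * x^3 / 6 + s * (s - 1) * x^4 / 24 - z^2 / 2
      = z^3 * a + z^4 * a^2 / 2 + s / 6 * (z^3 + 3 * (z^4 * a) + z^5 * (3 * a^2 + z * a^3))
        + s * (s - 1) / 24 * (z^4 + z^5 * (4 * a + 6 * z * a^2 + 4 * z^2 * a^3 + z^3 * a^4))"
    unfolding x_def by (simp add: field_simps power_numeral_reduce)
  also have "\<dots> = z^3 * (\<alpha> + s / 6) + z^4 * (\<beta> + \<alpha>^2 / 2 + s * \<alpha> / 2 + s * (s - 1) / 24)
      + z^5 * (\<alpha> * \<beta> + z * \<beta>^2 / 2 + s * \<beta> / 2 + s / 6 * (3 * a^2 + z * a^3)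
        + s * (s - 1) / 24 * (4 * a + 6 * z * a^2 + 4 * z^2 * a^3 + z^3 * a^4))"
  proof -
    have e: "z^3 * a = z^3 * \<alpha> + z^4 * \<beta>" "z^4 * a^2 = z^4 * \<alpha>^2 + z^5 * (2 * \<alpha> * \<beta> + z * \<beta>^2)"
      "z^4 * a = z^4 * \<alpha> + z^5 * \<beta>"
      unfolding a_def by (simp_all add: algebra_simps power_numeral_reduce)
    show ?thesis unfolding e by (simp add: field_simps)
  qed
  also have "\<alpha> + s / 6 = 0" by (simp add: assms(1))
  also have "\<beta> + \<alpha>^2 / 2 + s * \<alpha> / 2 + s * (s - 1) / 24 = 0"
    by (simp add: assms(1,2) power2_eq_square field_simps)
  finally show ?thesis by simp
qed

context hardy_parameter
begin

text \<open>
  In the relative coordinate \<open>x\<close> the powers of \<open>wstar\<close> drop out, because \<open>wstar powr q = 1 / (1 + q)\<close>.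
\<close>

lemma gap_taylor_expansion:
  obtains C where "C \<ge> 0"
    "\<And>x. \<bar>x\<bar> \<le> 1/2 \<Longrightarrow> \<bar>gap (wstar * (1 + x)) - wstar * (x^2 / 2 + (q - 1) * x^3 / 6 + (q - 1) * (q - 2) * x^4 / 24)\<bar> \<le> C * \<bar>x\<bar>^5"
proof -
  \<comment> \<open>from order two on, \<open>cf m * v powr (q + 1 - m)\<close> is the \<open>m\<close>-th derivative of \<open>gap\<close>\<close>
  define cf where "cf m = (q + 1) * (\<Prod>i\<in>{2..<m}. q + 1 - real i)" for m :: nat
  define D where "D m = (if m = 0 then gap else if m = 1 then gap' else (\<lambda>v. cf m * v powr (q + 1 - real m)))" for m :: nat
  have cf_Suc: "cf (Suc m) = cf m * (q + 1 - real m)" if "m \<ge> 2" for m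
    using that by (simp add: cf_def prod.atLeastLessThan_Suc)
  have deriv: "(D m has_real_derivative D (Suc m) v) (at v)" if "v > 0" for m v
  proof -
    consider "m = 0" | "m = 1" | "m \<ge> 2" by linarith
    thus ?thesis
    proof cases
      case 1
      thus ?thesis using gap_deriv[OF that] by (simp add: D_def)
    next
      case 2
      have "(gap' has_real_derivative (q + 1) * v powr (q - 1)) (at v)"
        unfolding gap'_def[abs_def] using that q_nz
        by (auto intro!: derivative_eq_intros simp: field_simps)
      thus ?thesis using 2 by (simp add: D_def cf_def)
    next
      case 3
      have "((\<lambda>v. cf m * v powr (q + 1 - real m)) has_real_derivative
              cf m * ((q + 1 - real m) * v powr (q + 1 - real m - 1))) (at v)"
        using that by (intro DERIV_cmult has_real_derivative_powr)
      also have "q + 1 - real m - 1 = q + 1 - real (Suc m)" by simp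
      finally show ?thesis using 3 by (simp add: D_def cf_Suc mult.assoc)
    qed
  qed
  define I where "I = {wstar / 2 .. 3 / 2 * wstar}"
  have "continuous_on I (D 5)"
    unfolding D_def I_def using wstar_pos by (auto intro!: continuous_intros)
  hence "bounded (D 5 ` I)" unfolding I_def by (intro compact_imp_bounded compact_continuous_image) auto
  then obtain B where B: "\<And>v. v \<in> I \<Longrightarrow> \<bar>D 5 v\<bar> \<le> B" by (auto simp: bounded_iff)
  have B0: "B \<ge> 0" using B[of wstar] wstar_pos by (force simp: I_def)
  have "\<bar>gap (wstar * (1 + x)) - wstar * (x^2 / 2 + (q - 1) * x^3 / 6 + (q - 1) * (q - 2) * x^4 / 24)\<bar>
      \<le> B / 120 * wstar^5 * \<bar>x\<bar>^5" if x: "\<bar>x\<bar> \<le> 1/2" for x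
  proof (cases "x = 0")
    case False
    define v where "v = wstar * (1 + x)"
    have "wstar * (1/2) \<le> wstar * (1 + x)" "wstar * (1 + x) \<le> wstar * (3/2)"
      using x wstar_pos by (intro mult_left_mono; simp add: abs_le_iff)+
    hence v: "v \<in> I" "v \<noteq> wstar" using False wstar_pos by (auto simp: v_def I_def)
    have "\<exists>t. (if v < wstar then v < t \<and> t < wstar else wstar < t \<and> t < v) \<and>
        gap v = (\<Sum>m<5. D m wstar / fact m * (v - wstar)^m) + D 5 t / fact 5 * (v - wstar)^5"
    proof (rule Taylor[where a = "wstar / 2" and b = "3 / 2 * wstar"])
      show "\<forall>m t. m < 5 \<and> wstar / 2 \<le> t \<and> t \<le> 3 / 2 * wstar \<longrightarrow> (D m has_real_derivative D (Suc m) t) (at t)"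
        using wstar_pos by (auto intro!: deriv)
    qed (use v wstar_pos in \<open>auto simp: D_def I_def\<close>)
    then obtain t where t: "if v < wstar then v < t \<and> t < wstar else wstar < t \<and> t < v"
      and eq: "gap v = (\<Sum>m<5. D m wstar / fact m * (v - wstar)^m) + D 5 t / fact 5 * (v - wstar)^5" by blast
    have tI: "t \<in> I" using t v wstar_pos by (auto simp: I_def split: if_splits)
    have vw: "v - wstar = wstar * x" by (simp add: v_def algebra_simps)
    have pw: "(q + 1) * wstar powr (q - real j) = 1 / wstar ^ j" for j
      using wstar_pos q_gt by (simp add: powr_diff wstar_powr powr_realpow add.commute[of q 1])
    have "(\<Sum>m<5. D m wstar / fact m * (v - wstar)^m)
        = wstar * (x^2 / 2 + (q - 1) * x^3 / 6 + (q - 1) * (q - 2) * x^4 / 24)"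
    proof -
      have "{2..<3} = {2::nat}" "{2..<4} = {2, 3::nat}" by auto
      hence cfs: "cf 2 = q + 1" "cf 3 = (q + 1) * (q - 1)" "cf 4 = (q + 1) * ((q - 1) * (q - 2))"
        by (simp_all add: cf_def)
      have D2: "D 2 wstar = 1 / wstar"
        using pw[of 1] by (simp add: D_def cfs)
      have D3: "D 3 wstar = (q - 1) / wstar^2"
      proof -
        have "D 3 wstar = (q - 1) * ((q + 1) * wstar powr (q - real 2))" by (simp add: D_def cfs)
        thus ?thesis unfolding pw by simp
      qed
      have D4: "D 4 wstar = (q - 1) * (q - 2) / wstar^3"
      proof -
        have "D 4 wstar = (q - 1) * (q - 2) * ((q + 1) * wstar powr (q - real 3))" by (simp add: D_def cfs)
        thus ?thesis unfolding pw by simp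
      qed
      have D01: "D 0 wstar = 0" "D 1 wstar = 0" by (simp_all add: D_def gap_wstar gap'_wstar)
      have "{..<5} = {0, 1, 2, 3, 4::nat}" by auto
      hence "(\<Sum>m<5. D m wstar / fact m * (v - wstar)^m)
          = D 2 wstar / 2 * (v - wstar)^2 + D 3 wstar / 6 * (v - wstar)^3 + D 4 wstar / 24 * (v - wstar)^4"
        using D01 by (simp add: fact_numeral)
      also have "\<dots> = wstar * (x^2 / 2 + (q - 1) * x^3 / 6 + (q - 1) * (q - 2) * x^4 / 24)"
        unfolding D2 D3 D4 vw using wstar_pos by (simp add: field_simps power_numeral_reduce)
      finally show ?thesis .
    qed
    hence "gap v - wstar * (x^2 / 2 + (q - 1) * x^3 / 6 + (q - 1) * (q - 2) * x^4 / 24)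
        = D 5 t / 120 * (wstar * x)^5"
      using eq by (simp add: vw fact_numeral)
    hence "\<bar>gap v - wstar * (x^2 / 2 + (q - 1) * x^3 / 6 + (q - 1) * (q - 2) * x^4 / 24)\<bar>
        = \<bar>D 5 t / 120 * (wstar * x)^5\<bar>" by (simp only:)
    also have "\<dots> = \<bar>D 5 t\<bar> / 120 * wstar^5 * \<bar>x\<bar>^5"
      using wstar_pos by (simp add: abs_mult power_mult_distrib power_abs)
    also have "\<dots> \<le> B / 120 * wstar^5 * \<bar>x\<bar>^5"
      using B[OF tI] wstar_pos by (intro mult_right_mono divide_right_mono) auto
    finally show ?thesis by (simp add: v_def)
  qed (simp add: gap_wstar)
  thus ?thesis using that[of "B / 120 * wstar^5"] B0 wstar_pos by simp
qed

text \<open>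
  The relative coordinate \<open>x\<close> as a function of the chart \<open>z = sqrt (2 * gap / wstar)\<close>, with the sign of the
  square root chosen to change at \<open>wstar\<close>: the first three terms of the inverse series.
\<close>

definition norm_coord :: "real \<Rightarrow> real" where
  "norm_coord z = z - (q - 1) / 6 * z^2 + (q - 1) * (2 * q + 1) / 72 * z^3"

lemma gap_normal_form:
  obtains C \<delta> where "C \<ge> 0" "\<delta> > 0"
    "\<And>z. \<bar>z\<bar> \<le> \<delta> \<Longrightarrow> \<bar>gap (wstar * (1 + norm_coord z)) - wstar / 2 * z^2\<bar> \<le> C * \<bar>z\<bar>^5"
proof -
  obtain C where C: "C \<ge> 0"
    "\<And>x. \<bar>x\<bar> \<le> 1/2 \<Longrightarrow> \<bar>gap (wstar * (1 + x)) - wstar * (x^2 / 2 + (q - 1) * x^3 / 6 + (q - 1) * (q - 2) * x^4 / 24)\<bar> \<le> C * \<bar>x\<bar>^5"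
    by (rule gap_taylor_expansion) blast
  define \<alpha> where "\<alpha> = - (q - 1) / 6"
  define \<beta> where "\<beta> = (q - 1) * (2 * (q - 1) + 3) / 72"
  define a where "a z = \<alpha> + \<beta> * z" for z
  define R where "R z = \<alpha> * \<beta> + z * \<beta>^2 / 2 + (q - 1) * \<beta> / 2 + (q - 1) / 6 * (3 * a z^2 + z * a z^3)
      + (q - 1) * ((q - 1) - 1) / 24 * (4 * a z + 6 * z * a z^2 + 4 * z^2 * a z^3 + z^3 * a z^4)" for z
  have nc: "norm_coord z = z + a z * z^2" for z
    by (simp add: norm_coord_def a_def \<alpha>_def \<beta>_def field_simps power2_eq_square power3_eq_cube)
  have "continuous_on {-1..1} R" unfolding R_def a_def by (intro continuous_intros) auto
  hence "bounded (R ` {-1..1})" by (intro compact_imp_bounded compact_continuous_image) auto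
  then obtain B where "\<forall>y\<in>R ` {-1..1}. norm y \<le> B" unfolding bounded_iff by blast
  hence B: "\<bar>R z\<bar> \<le> B" if "z \<in> {-1..1}" for z using that by auto
  have B0: "B \<ge> 0" using B[of 0] by force
  define L where "L = 1 + \<bar>\<alpha>\<bar> + \<bar>\<beta>\<bar>"
  have L: "L \<ge> 1" by (simp add: L_def)
  define \<delta> where "\<delta> = 1 / (2 * L)"
  have \<delta>: "\<delta> > 0" "\<delta> \<le> 1" "L * \<delta> \<le> 1/2" using L by (auto simp: \<delta>_def)
  show ?thesis
  proof (rule that[of "C * L^5 + wstar * B" \<delta>])
    show "C * L^5 + wstar * B \<ge> 0" using C B0 L wstar_pos by simp
    fix z assume z: "\<bar>z\<bar> \<le> \<delta>"
    hence z1: "z \<in> {-1..1}" "\<bar>z\<bar> \<le> 1" using \<delta> by auto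
    have "\<bar>a z\<bar> \<le> \<bar>\<alpha>\<bar> + \<bar>\<beta>\<bar> * \<bar>z\<bar>" unfolding a_def abs_mult[symmetric] by linarith
    also have "\<bar>\<beta>\<bar> * \<bar>z\<bar> \<le> \<bar>\<beta>\<bar>" using z1 by (simp add: mult_left_le)
    finally have az: "\<bar>a z\<bar> \<le> \<bar>\<alpha>\<bar> + \<bar>\<beta>\<bar>" by simp
    have "norm_coord z = z * (1 + a z * z)" by (simp add: nc algebra_simps power2_eq_square)
    hence "\<bar>norm_coord z\<bar> = \<bar>z\<bar> * \<bar>1 + a z * z\<bar>" by (simp add: abs_mult)
    moreover have "\<bar>1 + a z * z\<bar> \<le> L"
    proof -
      have "\<bar>1 + a z * z\<bar> \<le> 1 + \<bar>a z\<bar> * \<bar>z\<bar>" unfolding abs_mult[symmetric] by linarith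
      also have "\<bar>a z\<bar> * \<bar>z\<bar> \<le> (\<bar>\<alpha>\<bar> + \<bar>\<beta>\<bar>) * 1" using az z1 by (intro mult_mono) auto
      finally show ?thesis by (simp add: L_def)
    qed
    ultimately have nz: "\<bar>norm_coord z\<bar> \<le> L * \<bar>z\<bar>"
      using mult_left_mono[of "\<bar>1 + a z * z\<bar>" L "\<bar>z\<bar>"] by (simp add: mult.commute)
    also have "\<dots> \<le> L * \<delta>" using z L by (intro mult_left_mono) auto
    finally have "\<bar>norm_coord z\<bar> \<le> 1/2" using \<delta> by simp
    note taylor = C(2)[OF this]
    have "\<bar>norm_coord z\<bar>^5 \<le> (L * \<bar>z\<bar>)^5" using nz by (intro power_mono) auto
    hence 1: "C * \<bar>norm_coord z\<bar>^5 \<le> C * L^5 * \<bar>z\<bar>^5"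
      using C by (simp add: power_mult_distrib mult_left_mono mult.assoc)
    define T where "T = (norm_coord z)^2 / 2 + (q - 1) * (norm_coord z)^3 / 6 + (q - 1) * (q - 2) * (norm_coord z)^4 / 24"
    have "(norm_coord z)^2 / 2 + (q - 1) * (norm_coord z)^3 / 6 + (q - 1) * ((q - 1) - 1) * (norm_coord z)^4 / 24 - z^2 / 2
        = z^5 * R z"
      unfolding nc a_def R_def by (rule inverse_series_cancels) (simp_all add: \<alpha>_def \<beta>_def)
    hence "T - z^2 / 2 = z^5 * R z" by (simp add: T_def)
    hence 2: "wstar * T - wstar / 2 * z^2 = wstar * (z^5 * R z)"
      by (simp add: right_diff_distrib flip: \<open>T - z^2 / 2 = z^5 * R z\<close>)
    have "\<bar>wstar * (z^5 * R z)\<bar> = wstar * \<bar>R z\<bar> * \<bar>z\<bar>^5" using wstar_pos by (simp add: abs_mult power_abs)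
    also have "\<dots> \<le> wstar * B * \<bar>z\<bar>^5" using B[OF z1(1)] wstar_pos by (intro mult_right_mono mult_left_mono) auto
    finally have 3: "\<bar>wstar * (z^5 * R z)\<bar> \<le> wstar * B * \<bar>z\<bar>^5" .
    show "\<bar>gap (wstar * (1 + norm_coord z)) - wstar / 2 * z^2\<bar> \<le> (C * L^5 + wstar * B) * \<bar>z\<bar>^5"
      using taylor 1 2 3 unfolding T_def[symmetric] distrib_right abs_le_iff by linarith
  qed (use \<delta> in auto)
qed

text \<open>
  The coefficients of \<open>1 / sqrt \<eta>\<close> and \<open>sqrt \<eta>\<close> in the total passage time.
\<close>

definition time_lead :: real where "time_lead = pi * sqrt (2 * wstar)"
definition time_next :: real where "time_next = - time_lead * (q - 1) * (2 * q + 1) / (12 * wstar)"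

text \<open>
  Only a neighbourhood of \<open>wstar\<close> contributes singular terms. There the chart \<open>norm_coord\<close> brings the
  integral into the form of \<open>near_double_zero_integral\<close>; outside, the integral depends smoothly on \<open>\<eta>\<close>.
\<close>

theorem total_passage_time_asymp:
  obtains K where
    "((\<lambda>\<eta>. (passage_time \<eta> 0 - (time_lead / sqrt \<eta> + K + time_next * sqrt \<eta>)) / sqrt \<eta>) \<longlongrightarrow> 0) (at_right 0)"
proof -
  obtain C \<delta>0 where C: "C \<ge> 0" "\<delta>0 > 0"
    "\<And>z. \<bar>z\<bar> \<le> \<delta>0 \<Longrightarrow> \<bar>gap (wstar * (1 + norm_coord z)) - wstar / 2 * z^2\<bar> \<le> C * \<bar>z\<bar>^5"
    by (rule gap_normal_form) blast
  define W where "W z = wstar * (1 + norm_coord z)" for z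
  define p0 where "p0 = wstar"
  define p1 where "p1 = - wstar * (q - 1) / 3"
  define p2 where "p2 = wstar * (q - 1) * (2 * q + 1) / 24"
  define b where "b = wstar / 2"
  have b: "b > 0" using wstar_pos by (simp add: b_def)
  have W_deriv: "(W has_real_derivative p0 + p1 * z + p2 * z^2) (at z)" for z
    unfolding W_def norm_coord_def p0_def p1_def p2_def
    by (auto intro!: derivative_eq_intros simp: field_simps power2_eq_square)
  have W_cont: "continuous_on S W" for S
    unfolding W_def norm_coord_def by (intro continuous_intros)
  have W0: "W 0 = wstar" by (simp add: W_def norm_coord_def)
  have p0: "p0 > 0" using wstar_pos by (simp add: p0_def)
  \<comment> \<open>a neighbourhood on which the chart is admissible\<close>
  have near: "eventually (\<lambda>z. 0 < W z \<and> W z < 1 \<and> 0 < p0 + p1 * z + p2 * z^2) (nhds 0)"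
  proof -
    have "(W \<longlongrightarrow> wstar) (nhds 0)"
      using W_cont[of UNIV] W0 by (metis continuous_on_eq_continuous_at isCont_def open_UNIV UNIV_I tendsto_at_iff_tendsto_nhds)
    moreover have "((\<lambda>z. p0 + p1 * z + p2 * z^2) \<longlongrightarrow> p0 + p1 * 0 + p2 * 0^2) (nhds 0)"
      by (intro tendsto_intros filterlim_ident)
    hence "eventually (\<lambda>z. 0 < p0 + p1 * z + p2 * z^2) (nhds 0)" using p0 by (intro order_tendstoD(1)) auto
    ultimately show ?thesis
      using wstar_pos wstar_less_1 by (intro eventually_conj; blast intro: order_tendstoD)
  qed
  then obtain \<delta>1 where \<delta>1: "\<delta>1 > 0" "\<And>z. \<bar>z\<bar> < \<delta>1 \<Longrightarrow> 0 < W z \<and> W z < 1 \<and> 0 < p0 + p1 * z + p2 * z^2"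
    by (auto simp: eventually_nhds_metric dist_real_def)
  define e where "e = b / (2 * (C + 1))"
  have "e > 0" using b C by (simp add: e_def)
  define \<delta> where "\<delta> = min (min \<delta>0 (\<delta>1 / 2)) (min 1 e)"
  have \<delta>: "\<delta> > 0" "\<delta> \<le> \<delta>0" "\<delta> < \<delta>1" "\<delta> \<le> 1" "\<delta> \<le> e"
    using \<open>e > 0\<close> C(2) \<delta>1(1) unfolding \<delta>_def by linarith+
  have Wrange: "0 < W z" "W z < 1" and W'pos: "0 < p0 + p1 * z + p2 * z^2" if "\<bar>z\<bar> \<le> \<delta>" for z
    using \<delta>1(2)[of z] that \<delta> by auto
  define H where "H z = gap (W z)" for z
  have approx: "\<bar>H z - b * z^2\<bar> \<le> C * \<bar>z\<bar>^5" if "\<bar>z\<bar> \<le> \<delta>" for z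
    using C(3)[of z] that \<delta> by (simp add: H_def W_def b_def)
  have lower: "b / 2 * z^2 \<le> H z" if z: "\<bar>z\<bar> \<le> \<delta>" for z
  proof -
    have "C * \<bar>z\<bar>^3 \<le> C * \<bar>z\<bar>^1" using z \<delta> C by (intro mult_left_mono power_decreasing) auto
    also have "\<dots> \<le> C * e" using z \<delta> C by (intro mult_left_mono) auto
    also have "\<dots> \<le> b / 2" using C b by (simp add: e_def field_simps)
    finally have "C * \<bar>z\<bar>^3 * z^2 \<le> b / 2 * z^2" by (rule mult_right_mono) simp
    moreover have "C * \<bar>z\<bar>^5 = C * \<bar>z\<bar>^3 * z^2"
    proof -
      have "\<bar>z\<bar>^5 = \<bar>z\<bar>^3 * \<bar>z\<bar>^2" using power_add[of "\<bar>z\<bar>" 3 2] by simp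
      thus ?thesis by simp
    qed
    ultimately show ?thesis using approx[OF z] unfolding abs_le_iff by linarith
  qed
  have H_cont: "continuous_on {-\<delta>..\<delta>} H"
    unfolding H_def
    by (rule continuous_on_compose2[OF continuous_on_gap W_cont]) (use Wrange in \<open>force simp: abs_le_iff\<close>)
  obtain K1 where K1:
    "((\<lambda>\<eta>. (integral {-\<delta>..\<delta>} (\<lambda>z. (p0 + p1 * z + p2 * z^2) / (H z + \<eta>))
        - (p0 * pi / sqrt b / sqrt \<eta> + K1 - p2 * pi / (b * sqrt b) * sqrt \<eta>)) / sqrt \<eta>) \<longlongrightarrow> 0) (at_right 0)"
    using near_double_zero_integral[OF b \<delta>(1) C(1) H_cont approx lower] by blast
  have lead: "p0 * pi / sqrt b = time_lead" and sec: "- (p2 * pi / (b * sqrt b)) = time_next"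
  proof -
    define r where "r = sqrt (2 * wstar)"
    have r: "r > 0" "r^2 = 2 * wstar" using wstar_pos by (auto simp: r_def)
    have sb: "sqrt b = r / 2"
    proof (rule real_sqrt_unique)
      show "(r / 2)^2 = b" using r by (simp add: power_divide b_def)
    qed (use r in auto)
    have p0r: "p0 / (r / 2) = r" using r by (simp add: p0_def field_simps power2_eq_square)
    have "p0 * pi / sqrt b = pi * (p0 / (r / 2))" by (simp add: sb)
    thus l: "p0 * pi / sqrt b = time_lead" unfolding p0r by (simp add: time_lead_def r_def)
    have "p2 * pi / (b * sqrt b) = (p0 * pi / sqrt b) * ((q - 1) * (2 * q + 1) / (24 * b))"
      by (simp add: p2_def p0_def mult_ac)
    thus "- (p2 * pi / (b * sqrt b)) = time_next" unfolding l by (simp add: time_next_def b_def)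
  qed
  define l where "l = W (-\<delta>)"
  define r where "r = W \<delta>"
  have lr: "0 < l" "l < wstar" "wstar < r" "r < 1"
  proof -
    show "0 < l" "r < 1" unfolding l_def r_def using Wrange[of "-\<delta>"] Wrange[of \<delta>] \<delta> by auto
    have "W (-\<delta>) < W 0"
      by (rule DERIV_pos_imp_increasing) (use \<delta> W_deriv W'pos in \<open>auto intro!: exI\<close>)
    thus "l < wstar" by (simp add: l_def W0)
    have "W 0 < W \<delta>"
      by (rule DERIV_pos_imp_increasing) (use \<delta> W_deriv W'pos in \<open>auto intro!: exI\<close>)
    thus "wstar < r" by (simp add: r_def W0)
  qed
  define J where "J x y \<eta> = integral {x..y} (\<lambda>w. 1 / (gap w + \<eta>))" for x y \<eta>
  have middle: "J l r \<eta> = integral {-\<delta>..\<delta>} (\<lambda>z. (p0 + p1 * z + p2 * z^2) / (H z + \<eta>))" if \<eta>: "\<eta> > 0" for \<eta>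
  proof -
    have "((\<lambda>z. (p0 + p1 * z + p2 * z^2) *\<^sub>R (1 / (gap (W z) + \<eta>))) has_integral
        integral {W (-\<delta>)..W \<delta>} (\<lambda>w. 1 / (gap w + \<eta>))) {-\<delta>..\<delta>}"
    proof (rule has_integral_substitution[where c = 0 and d = 1])
      show "W ` {-\<delta>..\<delta>} \<subseteq> {0..1}" using Wrange by (force simp: abs_le_iff)
      show "continuous_on {0..1} (\<lambda>w. 1 / (gap w + \<eta>))"
      proof (rule continuous_on_rate)
        show "gap w + \<eta> > 0" if "0 \<le> w" for w using gap_nonneg[OF that] \<eta> by simp
      qed simp
    qed (use \<delta> lr W_deriv in \<open>auto simp: l_def r_def intro: has_field_derivative_at_within\<close>)
    thus ?thesis by (simp add: J_def l_def r_def H_def has_integral_iff)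
  qed
  have split: "passage_time \<eta> 0 = J 0 l \<eta> + J l r \<eta> + J r 1 \<eta>" if \<eta>: "\<eta> > 0" for \<eta>
  proof -
    have pos: "gap w + \<eta> > 0" if "0 \<le> w" for w using gap_nonneg[OF that] \<eta> by simp
    show ?thesis
      using passage_time_split[of 0 l \<eta>] passage_time_split[of l r \<eta>] lr pos
      by (simp add: J_def passage_time_def)
  qed
  have outer: "((\<lambda>\<eta>. (J x y \<eta> - J x y 0) / sqrt \<eta>) \<longlongrightarrow> 0) (at_right 0)"
    if xy: "0 \<le> x" "x \<le> y" "wstar \<notin> {x..y}" for x y
  proof -
    have cont: "continuous_on {x..y} gap" using xy by (intro continuous_on_subset[OF continuous_on_gap]) auto
    obtain m where m: "m \<in> {x..y}" "\<And>w. w \<in> {x..y} \<Longrightarrow> gap m \<le> gap w"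
      using continuous_attains_inf[OF _ _ cont] xy by auto
    have gm: "gap m > 0" using m(1) xy by (intro gap_pos) auto
    have bound: "\<bar>J x y \<eta> - J x y 0\<bar> \<le> (y - x) * (\<eta> / gap m^2)" if "\<eta> > 0" for \<eta>
      using integral_rate_perturb[OF xy(2) cont m(2) gm, of \<eta>] that by (simp add: J_def)
    show ?thesis
    proof (rule Lim_null_comparison)
      show "eventually (\<lambda>\<eta>. norm ((J x y \<eta> - J x y 0) / sqrt \<eta>) \<le> (y - x) * (\<eta> / gap m^2) / sqrt \<eta>) (at_right 0)"
        using eventually_at_right_less[of 0]
      proof eventually_elim
        case (elim \<eta>)
        have "\<bar>J x y \<eta> - J x y 0\<bar> / sqrt \<eta> \<le> (y - x) * (\<eta> / gap m^2) / sqrt \<eta>"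
          using elim by (intro divide_right_mono bound) auto
        thus ?case using elim by (simp add: abs_divide)
      qed
      show "((\<lambda>\<eta>. (y - x) * (\<eta> / gap m^2) / sqrt \<eta>) \<longlongrightarrow> 0) (at_right 0)"
        using gm by real_asymp
    qed
  qed
  define K where "K = K1 + J 0 l 0 + J r 1 0"
  have "((\<lambda>\<eta>. (integral {-\<delta>..\<delta>} (\<lambda>z. (p0 + p1 * z + p2 * z^2) / (H z + \<eta>))
        - (p0 * pi / sqrt b / sqrt \<eta> + K1 - p2 * pi / (b * sqrt b) * sqrt \<eta>)) / sqrt \<eta>
        + (J 0 l \<eta> - J 0 l 0) / sqrt \<eta> + (J r 1 \<eta> - J r 1 0) / sqrt \<eta>) \<longlongrightarrow> 0 + 0 + 0) (at_right 0)"
    by (intro tendsto_add K1 outer) (use lr in auto)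
  moreover have "eventually (\<lambda>\<eta>. (integral {-\<delta>..\<delta>} (\<lambda>z. (p0 + p1 * z + p2 * z^2) / (H z + \<eta>))
        - (p0 * pi / sqrt b / sqrt \<eta> + K1 - p2 * pi / (b * sqrt b) * sqrt \<eta>)) / sqrt \<eta>
        + (J 0 l \<eta> - J 0 l 0) / sqrt \<eta> + (J r 1 \<eta> - J r 1 0) / sqrt \<eta>
        = (passage_time \<eta> 0 - (time_lead / sqrt \<eta> + K + time_next * sqrt \<eta>)) / sqrt \<eta>) (at_right 0)"
    using eventually_at_right_less[of 0]
  proof eventually_elim
    case (elim \<eta>)
    show ?case
      unfolding split[OF elim] middle[OF elim] K_def lead sec[symmetric]
      by (simp add: add_divide_distrib diff_divide_distrib)
  qed
  ultimately have "((\<lambda>\<eta>. (passage_time \<eta> 0 - (time_lead / sqrt \<eta> + K + time_next * sqrt \<eta>)) / sqrt \<eta>) \<longlongrightarrow> 0 + 0 + 0) (at_right 0)"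
    by (rule Lim_transform_eventually)
  thus ?thesis using that by simp
qed

end

section \<open>Reading off the coefficients\<close>

text \<open>
  For \<open>y = ln N + const\<close> and \<open>\<mu> = mustar\<close>, the factor \<open>1 / \<mu> - 1 / (\<mu> + \<eta>)\<close> is the distance of \<open>\<lambda>\<close> from the
  limit constant; multiplied by \<open>y^2\<close> it has a finite limit, and the three-term expansion of \<open>y\<close> is just
  long enough to give it up to \<open>o(\<eta>)\<close>.
\<close>

lemma square_expansion:
  fixes y :: "real \<Rightarrow> real" and P K Q \<mu> B :: real
  assumes P: "P > 0" and \<mu>: "\<mu> > 0"
    and y: "((\<lambda>\<eta>. (y \<eta> - (P / sqrt \<eta> + K + Q * sqrt \<eta>)) / sqrt \<eta>) \<longlongrightarrow> 0) (at_right 0)"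
  shows "((\<lambda>\<eta>. sqrt \<eta> * y \<eta>) \<longlongrightarrow> P) (at_right 0)"
    and "((\<lambda>\<eta>. ((1 / \<mu> - 1 / (\<mu> + \<eta>)) * y \<eta>^2 - B / y \<eta>^2
            - (P^2 / \<mu>^2 + 2 * P * K / \<mu>^2 * sqrt \<eta> + ((K^2 + 2 * P * Q) / \<mu>^2 - P^2 / \<mu>^3 - B / P^2) * \<eta>)) / \<eta>)
          \<longlongrightarrow> 0) (at_right 0)"
proof -
  define w where "w \<eta> = (y \<eta> - (P / sqrt \<eta> + K + Q * sqrt \<eta>)) / sqrt \<eta>" for \<eta>
  have w: "(w \<longlongrightarrow> 0) (at_right 0)" unfolding w_def by (rule y)
  define u where "u \<eta> = P + K * sqrt \<eta> + (Q + w \<eta>) * \<eta>" for \<eta>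
  have s0: "((\<lambda>\<eta>. sqrt \<eta>) \<longlongrightarrow> 0) (at_right 0)" by real_asymp
  have id0: "((\<lambda>\<eta>::real. \<eta>) \<longlongrightarrow> 0) (at_right 0)" by real_asymp
  have "(u \<longlongrightarrow> P + K * 0 + (Q + 0) * 0) (at_right 0)"
    unfolding u_def by (intro tendsto_intros w s0 id0)
  hence u: "(u \<longlongrightarrow> P) (at_right 0)" by simp
  have u_eq: "sqrt \<eta> * y \<eta> = u \<eta>" if "\<eta> > 0" for \<eta>
  proof -
    define s where "s = sqrt \<eta>"
    have s: "s > 0" "\<eta> = s * s" using that by (auto simp: s_def)
    have "y \<eta> = P / s + K + Q * s + w \<eta> * s" using s(1) by (simp add: w_def s_def[symmetric])
    hence "s * y \<eta> = P + K * s + (Q + w \<eta>) * (s * s)" using s(1) by (simp add: algebra_simps)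
    thus ?thesis by (simp add: u_def s_def[symmetric] flip: s(2))
  qed
  have ev: "eventually (\<lambda>\<eta>::real. \<eta> > 0) (at_right 0)" by (rule eventually_at_right_less)
  show "((\<lambda>\<eta>. sqrt \<eta> * y \<eta>) \<longlongrightarrow> P) (at_right 0)"
    by (rule Lim_transform_eventually[OF u]) (use ev in \<open>eventually_elim, simp add: u_eq\<close>)
  define r where "r \<eta> = 2 * P * w \<eta> + 2 * K * sqrt \<eta> * (Q + w \<eta>) + \<eta> * (Q + w \<eta>)^2" for \<eta>
  have "(r \<longlongrightarrow> 2 * P * 0 + 2 * K * 0 * (Q + 0) + 0 * (Q + 0)^2) (at_right 0)"
    unfolding r_def by (intro tendsto_intros w s0 id0)
  hence r: "(r \<longlongrightarrow> 0) (at_right 0)" by simp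
  have "((\<lambda>\<eta>. r \<eta> / \<mu>^2 - (u \<eta>^2 / (\<mu>^2 * (\<mu> + \<eta>)) - P^2 / \<mu>^3) - (B / u \<eta>^2 - B / P^2))
      \<longlongrightarrow> 0 / \<mu>^2 - (P^2 / (\<mu>^2 * (\<mu> + 0)) - P^2 / \<mu>^3) - (B / P^2 - B / P^2)) (at_right 0)"
    by (intro tendsto_intros r u id0) (use P \<mu> in auto)
  hence lim: "((\<lambda>\<eta>. r \<eta> / \<mu>^2 - (u \<eta>^2 / (\<mu>^2 * (\<mu> + \<eta>)) - P^2 / \<mu>^3) - (B / u \<eta>^2 - B / P^2)) \<longlongrightarrow> 0) (at_right 0)"
    using \<mu> by (simp add: power3_eq_cube power2_eq_square)
  show "((\<lambda>\<eta>. ((1 / \<mu> - 1 / (\<mu> + \<eta>)) * y \<eta>^2 - B / y \<eta>^2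
            - (P^2 / \<mu>^2 + 2 * P * K / \<mu>^2 * sqrt \<eta> + ((K^2 + 2 * P * Q) / \<mu>^2 - P^2 / \<mu>^3 - B / P^2) * \<eta>)) / \<eta>)
          \<longlongrightarrow> 0) (at_right 0)"
  proof (rule Lim_transform_eventually[OF lim], use ev in eventually_elim)
    case (elim \<eta>)
    define s where "s = sqrt \<eta>"
    have s: "s > 0" "\<eta> = s^2" using elim by (auto simp: s_def)
    have yu: "y \<eta> = u \<eta> / s" using u_eq[OF elim] s(1) by (simp add: s_def field_simps)
    have e: "1 / \<mu> - 1 / (\<mu> + \<eta>) = \<eta> * (1 / \<mu>^2 - \<eta> / (\<mu>^2 * (\<mu> + \<eta>)))"
      using elim \<mu> by (simp add: divide_simps) (simp add: algebra_simps power2_eq_square)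
    have u2: "u \<eta>^2 = P^2 + 2 * P * K * s + (K^2 + 2 * P * Q) * \<eta> + r \<eta> * \<eta>"
      unfolding u_def r_def s_def[symmetric] unfolding s(2) by (simp add: algebra_simps power2_eq_square)
    have "(1 / \<mu> - 1 / (\<mu> + \<eta>)) * y \<eta>^2 = u \<eta>^2 / \<mu>^2 - \<eta> * (u \<eta>^2 / (\<mu>^2 * (\<mu> + \<eta>)))"
    proof -
      have "y \<eta>^2 = u \<eta>^2 / \<eta>" unfolding yu using s by (simp add: power_divide)
      thus ?thesis unfolding e using elim by (simp add: left_diff_distrib)
    qed
    moreover have "B / y \<eta>^2 = \<eta> * (B / u \<eta>^2)" unfolding yu using s by (simp add: power_divide)
    moreover have "u \<eta>^2 / \<mu>^2 = P^2 / \<mu>^2 + 2 * P * K / \<mu>^2 * s + (K^2 + 2 * P * Q) / \<mu>^2 * \<eta> + r \<eta> / \<mu>^2 * \<eta>"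
    proof -
      define L where "L = K^2 + 2 * P * Q"
      show ?thesis unfolding u2 L_def[symmetric] by (simp add: add_divide_distrib)
    qed
    ultimately have "(1 / \<mu> - 1 / (\<mu> + \<eta>)) * y \<eta>^2 - B / y \<eta>^2
        - (P^2 / \<mu>^2 + 2 * P * K / \<mu>^2 * s + ((K^2 + 2 * P * Q) / \<mu>^2 - P^2 / \<mu>^3 - B / P^2) * \<eta>)
      = \<eta> * (r \<eta> / \<mu>^2 - (u \<eta>^2 / (\<mu>^2 * (\<mu> + \<eta>)) - P^2 / \<mu>^3) - (B / u \<eta>^2 - B / P^2))"
      by (simp add: algebra_simps)
    thus ?case using elim by (simp add: s_def)
  qed
qed

text \<open>
  Uniqueness of the coefficients of an expansion in powers of \<open>sqrt \<eta>\<close>.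
\<close>

lemma vanishing_expansion:
  fixes a b c :: real
  assumes "((\<lambda>\<eta>. (a + b * sqrt \<eta> + c * \<eta>) / \<eta>) \<longlongrightarrow> 0) (at_right 0)"
  shows "a = 0" "b = 0" "c = 0"
proof -
  have ev: "eventually (\<lambda>\<eta>::real. \<eta> > 0) (at_right 0)" by (rule eventually_at_right_less)
  have s0: "((\<lambda>\<eta>. sqrt \<eta>) \<longlongrightarrow> 0) (at_right 0)" by real_asymp
  have id0: "((\<lambda>\<eta>::real. \<eta>) \<longlongrightarrow> 0) (at_right 0)" by real_asymp
  have "((\<lambda>\<eta>. (a + b * sqrt \<eta> + c * \<eta>) / \<eta> * \<eta>) \<longlongrightarrow> 0 * 0) (at_right 0)"
    by (intro tendsto_mult assms id0)
  hence "((\<lambda>\<eta>. a + b * sqrt \<eta> + c * \<eta>) \<longlongrightarrow> 0 * 0) (at_right 0)"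
    by (rule Lim_transform_eventually) (use ev in \<open>eventually_elim, simp\<close>)
  moreover have "((\<lambda>\<eta>. a + b * sqrt \<eta> + c * \<eta>) \<longlongrightarrow> a + b * 0 + c * 0) (at_right 0)"
    by (intro tendsto_intros s0 id0)
  ultimately show a: "a = 0" using tendsto_unique[OF trivial_limit_at_right_real] by fastforce
  have "((\<lambda>\<eta>. (a + b * sqrt \<eta> + c * \<eta>) / \<eta> * sqrt \<eta>) \<longlongrightarrow> 0 * 0) (at_right 0)"
    by (intro tendsto_mult assms s0)
  hence "((\<lambda>\<eta>. b + c * sqrt \<eta>) \<longlongrightarrow> 0 * 0) (at_right 0)"
  proof (rule Lim_transform_eventually, use ev in eventually_elim)
    case (elim \<eta>)
    define s where "s = sqrt \<eta>"
    have "s > 0" "\<eta> = s * s" using elim by (auto simp: s_def)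
    thus ?case unfolding a s_def[symmetric] by (simp add: field_simps)
  qed
  moreover have "((\<lambda>\<eta>. b + c * sqrt \<eta>) \<longlongrightarrow> b + c * 0) (at_right 0)"
    by (intro tendsto_intros s0)
  ultimately show b: "b = 0" using tendsto_unique[OF trivial_limit_at_right_real] by fastforce
  have "((\<lambda>\<eta>. c) \<longlongrightarrow> 0) (at_right (0::real))"
    by (rule Lim_transform_eventually[OF assms]) (use ev in \<open>eventually_elim, simp add: a b\<close>)
  thus "c = 0" by (simp add: tendsto_const_iff trivial_limit_at_right_real)
qed

context hardy_parameter
begin

lemma time_lead_pos: "time_lead > 0" using wstar_pos by (simp add: time_lead_def)

lemma ln_extinction_expansion:
  obtains K where
    "((\<lambda>\<eta>. (ln (real (extinction \<eta>)) - (time_lead / sqrt \<eta> + K + time_next * sqrt \<eta>)) / sqrt \<eta>) \<longlongrightarrow> 0) (at_right 0)"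
proof -
  obtain K1 where "((\<lambda>\<eta>. (ln (real (extinction \<eta>)) - passage_time \<eta> 0 - K1) / sqrt \<eta>) \<longlongrightarrow> 0) (at_right 0)"
    by (rule ln_extinction_asymp)
  moreover obtain K2 where
    "((\<lambda>\<eta>. (passage_time \<eta> 0 - (time_lead / sqrt \<eta> + K2 + time_next * sqrt \<eta>)) / sqrt \<eta>) \<longlongrightarrow> 0) (at_right 0)"
    by (rule total_passage_time_asymp)
  ultimately have *: "((\<lambda>\<eta>. (ln (real (extinction \<eta>)) - passage_time \<eta> 0 - K1) / sqrt \<eta>
      + (passage_time \<eta> 0 - (time_lead / sqrt \<eta> + K2 + time_next * sqrt \<eta>)) / sqrt \<eta>) \<longlongrightarrow> 0 + 0) (at_right 0)"
    by (rule tendsto_add)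
  hence "((\<lambda>\<eta>. (ln (real (extinction \<eta>)) - (time_lead / sqrt \<eta> + (K1 + K2) + time_next * sqrt \<eta>)) / sqrt \<eta>) \<longlongrightarrow> 0) (at_right 0)"
  proof -
    have "(a - t - K1) / r + (t - (x + K2 + z)) / r = (a - (x + (K1 + K2) + z)) / r" for a t x z r :: real
      by (simp add: diff_divide_distrib add_divide_distrib)
    with * show ?thesis by (simp only: add_0_left)
  qed
  thus ?thesis using that by blast
qed

text \<open>
  The hypothesis on the finite Hardy constants for \<open>L = 4\<close>, rewritten in terms of \<open>\<eta>\<close> along indices whose
  logarithm is of the order of \<open>1 / sqrt \<eta>\<close>: an error \<open>O(ln N ^ -5)\<close>, multiplied by \<open>y^2\<close>, is \<open>o(\<eta>)\<close>.
\<close>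

lemma expansion_along:
  fixes \<kappa> :: "real \<Rightarrow> real" and A :: "nat \<Rightarrow> real \<Rightarrow> real" and M :: "real \<Rightarrow> nat"
  assumes exp: "hardy_expansion \<kappa> A"
    and M: "filterlim M at_top (at_right 0)"
    and lnM: "((\<lambda>\<eta>. sqrt \<eta> * ln (real (M \<eta>))) \<longlongrightarrow> P) (at_right 0)" and P: "P > 0"
  defines "y \<equiv> \<lambda>\<eta>. ln (real (M \<eta>)) + \<kappa> q"
  shows "((\<lambda>\<eta>. ((hardy_limit q - hardy_lambda (M \<eta>) q) * y \<eta>^2 - A 2 q - A 4 q / y \<eta>^2) / \<eta>) \<longlongrightarrow> 0) (at_right 0)"
proof -
  have "compact {q}" "{q} \<subseteq> {-1<..}" "(2::nat) \<le> 4" using q_gt by auto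
  with exp obtain C where "\<forall>\<^sub>F N in sequentially. \<forall>x\<in>{q}.
      \<bar>hardy_limit x - hardy_lambda N x - (\<Sum>j=2..4. A j x / (ln (real N) + \<kappa> x) ^ j)\<bar> \<le> C / ln (real N) ^ (4 + 1)"
    unfolding hardy_expansion_def by blast
  moreover have "A 3 q = 0" using exp q_gt unfolding hardy_expansion_def by blast
  hence "(\<Sum>j=2..4. A j q / z ^ j) = A 2 q / z^2 + A 4 q / z^4" for z
    by (simp add: numeral_eq_Suc)
  ultimately have "\<forall>\<^sub>F N in sequentially. \<bar>hardy_limit q - hardy_lambda N q
      - (A 2 q / (ln (real N) + \<kappa> q)^2 + A 4 q / (ln (real N) + \<kappa> q)^4)\<bar> \<le> C / ln (real N) ^ 5"
    by simp
  with M have bound: "\<forall>\<^sub>F \<eta> in at_right 0. \<bar>hardy_limit q - hardy_lambda (M \<eta>) q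
      - (A 2 q / y \<eta>^2 + A 4 q / y \<eta>^4)\<bar> \<le> C / ln (real (M \<eta>)) ^ 5"
    unfolding y_def filterlim_iff by blast
  have s0: "((\<lambda>\<eta>. sqrt \<eta>) \<longlongrightarrow> 0) (at_right 0)" by real_asymp
  have "((\<lambda>\<eta>. sqrt \<eta> * ln (real (M \<eta>)) + sqrt \<eta> * \<kappa> q) \<longlongrightarrow> P + 0 * \<kappa> q) (at_right 0)"
    by (intro tendsto_intros lnM s0)
  hence sy: "((\<lambda>\<eta>. sqrt \<eta> * y \<eta>) \<longlongrightarrow> P) (at_right 0)" by (simp add: y_def algebra_simps)
  have "\<forall>\<^sub>F \<eta> in at_right 0. sqrt \<eta> * y \<eta> > 0" using order_tendstoD(1)[OF sy P] .
  moreover have "\<forall>\<^sub>F \<eta> in at_right 0. sqrt \<eta> * ln (real (M \<eta>)) > 0" using order_tendstoD(1)[OF lnM P] .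
  moreover have "\<forall>\<^sub>F \<eta>::real in at_right 0. \<eta> > 0" by (rule eventually_at_right_less)
  ultimately have "\<forall>\<^sub>F \<eta> in at_right 0. norm (((hardy_limit q - hardy_lambda (M \<eta>) q) * y \<eta>^2 - A 2 q - A 4 q / y \<eta>^2) / \<eta>)
      \<le> C * sqrt \<eta> * (sqrt \<eta> * y \<eta>)^2 / (sqrt \<eta> * ln (real (M \<eta>))) ^ 5"
    using bound
  proof eventually_elim
    case (elim \<eta>)
    define s where "s = sqrt \<eta>"
    define l where "l = ln (real (M \<eta>))"
    have s: "s > 0" "\<eta> = s^2" using elim by (auto simp: s_def)
    have l: "l > 0" and y: "y \<eta> > 0" using elim s by (auto simp: s_def[symmetric] l_def zero_less_mult_iff)
    define d where "d = hardy_limit q - hardy_lambda (M \<eta>) q"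
    have "d * y \<eta>^2 - A 2 q - A 4 q / y \<eta>^2 = (d - (A 2 q / y \<eta>^2 + A 4 q / y \<eta>^4)) * y \<eta>^2"
    proof -
      have "A 4 q / y \<eta>^4 * y \<eta>^2 = A 4 q / y \<eta>^2" using y by (simp add: field_simps power_numeral_reduce)
      thus ?thesis using y by (simp add: left_diff_distrib distrib_right)
    qed
    hence "\<bar>d * y \<eta>^2 - A 2 q - A 4 q / y \<eta>^2\<bar> = \<bar>d - (A 2 q / y \<eta>^2 + A 4 q / y \<eta>^4)\<bar> * y \<eta>^2"
      by (simp add: abs_mult)
    also have "\<dots> \<le> C / l^5 * y \<eta>^2"
      using elim(4) by (intro mult_right_mono) (auto simp: d_def l_def)
    finally have "\<bar>d * y \<eta>^2 - A 2 q - A 4 q / y \<eta>^2\<bar> / \<eta> \<le> C / l^5 * y \<eta>^2 / \<eta>"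
      using s by (intro divide_right_mono) auto
    also have "\<dots> = C * s * (s * y \<eta>)^2 / (s * l)^5"
      unfolding s(2) using s(1) l by (simp add: field_simps power_mult_distrib power_numeral_reduce)
    finally show ?case using elim by (simp add: abs_divide d_def l_def s_def)
  qed
  moreover have "((\<lambda>\<eta>. C * sqrt \<eta> * (sqrt \<eta> * y \<eta>)^2 / (sqrt \<eta> * ln (real (M \<eta>))) ^ 5) \<longlongrightarrow> C * 0 * P^2 / P^5) (at_right 0)"
    by (intro tendsto_intros s0 sy lnM) (use P in auto)
  hence "((\<lambda>\<eta>. C * sqrt \<eta> * (sqrt \<eta> * y \<eta>)^2 / (sqrt \<eta> * ln (real (M \<eta>))) ^ 5) \<longlongrightarrow> 0) (at_right 0)" by simp
  ultimately show ?thesis by (rule Lim_null_comparison)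
qed

text \<open>
  With \<open>N\<close> the extinction index, \<open>1 / (mustar + \<eta>)\<close> lies between the finite Hardy constants for \<open>N - 1\<close>
  and \<open>N\<close>. The logarithms of these two indices differ by far less than \<open>sqrt \<eta>\<close>, so both sides have the
  same expansion and squeeze the expansion with the unknown coefficients to zero.
\<close>

theorem hardy_expansion_coefficients:
  fixes \<kappa> :: "real \<Rightarrow> real" and A :: "nat \<Rightarrow> real \<Rightarrow> real"
  assumes exp: "hardy_expansion \<kappa> A"
  shows "A 2 q = time_lead^2 / mustar^2"
    and "A 4 q = time_lead^2 * (2 * time_lead * time_next / mustar^2 - time_lead^2 / mustar^3)"
proof -
  define P where "P = time_lead"
  define Q where "Q = time_next"
  have P: "P > 0" by (simp add: P_def time_lead_pos)
  obtain K0 where K0: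
    "((\<lambda>\<eta>. (ln (real (extinction \<eta>)) - (P / sqrt \<eta> + K0 + Q * sqrt \<eta>)) / sqrt \<eta>) \<longlongrightarrow> 0) (at_right 0)"
    unfolding P_def Q_def by (rule ln_extinction_expansion)
  define N where "N = extinction"
  define N' where "N' \<eta> = N \<eta> - 1" for \<eta>
  define K where "K = K0 + \<kappa> q"
  define y where "y \<eta> = ln (real (N \<eta>)) + \<kappa> q" for \<eta>
  define y' where "y' \<eta> = ln (real (N' \<eta>)) + \<kappa> q" for \<eta>
  note ev = eventually_at_right_less[of "0::real"]
  have lnN: "((\<lambda>\<eta>. sqrt \<eta> * ln (real (N \<eta>))) \<longlongrightarrow> P) (at_right 0)"
    using square_expansion(1)[OF P mustar_pos K0] by (simp add: N_def)
  have "filterlim (\<lambda>\<eta>. (sqrt \<eta> * ln (real (N \<eta>))) * (1 / sqrt \<eta>)) at_top (at_right 0)"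
    by (rule filterlim_tendsto_pos_mult_at_top[OF lnN P]) real_asymp
  hence "filterlim (\<lambda>\<eta>. ln (real (N \<eta>))) at_top (at_right 0)"
    by (rule filterlim_cong[THEN iffD1, OF refl refl, rotated]) (use ev in \<open>eventually_elim, simp\<close>)
  hence exp_ln: "filterlim (\<lambda>\<eta>. exp (ln (real (N \<eta>)))) at_top (at_right 0)"
    by (rule filterlim_compose[OF exp_at_top])
  have le: "exp (ln (real n)) \<le> real n + 1" for n :: nat by (cases "n = 0") auto
  have "filterlim (\<lambda>\<eta>. real (N \<eta>) + 1) at_top (at_right 0)"
    by (rule filterlim_at_top_mono[OF exp_ln always_eventually]) (use le in blast)
  hence "filterlim (\<lambda>\<eta>. -1 + (real (N \<eta>) + 1)) at_top (at_right 0)"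
    by (rule filterlim_tendsto_add_at_top[OF tendsto_const])
  hence N: "filterlim N at_top (at_right 0)"
    by (simp add: filterlim_sequentially_iff_filterlim_real)
  have N': "filterlim N' at_top (at_right 0)"
    unfolding N'_def by (rule filterlim_compose[OF filterlim_minus_const_nat_at_top N])
  have N2: "\<forall>\<^sub>F \<eta> in at_right 0. N \<eta> \<ge> 2" using N by (simp add: filterlim_at_top)
  have diff: "((\<lambda>\<eta>. (ln (real (N' \<eta>)) - ln (real (N \<eta>))) / sqrt \<eta>) \<longlongrightarrow> 0) (at_right 0)"
  proof (rule Lim_null_comparison)
    have "((\<lambda>n. ln (real n) / (real n - 1)) \<longlongrightarrow> 0) sequentially" by real_asymp
    hence "((\<lambda>\<eta>. ln (real (N \<eta>)) / (real (N \<eta>) - 1)) \<longlongrightarrow> 0) (at_right 0)"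
      using N by (rule filterlim_compose)
    from tendsto_divide[OF this lnN] P
    show "((\<lambda>\<eta>. ln (real (N \<eta>)) / (real (N \<eta>) - 1) / (sqrt \<eta> * ln (real (N \<eta>)))) \<longlongrightarrow> 0) (at_right 0)" by simp
    show "\<forall>\<^sub>F \<eta> in at_right 0. norm ((ln (real (N' \<eta>)) - ln (real (N \<eta>))) / sqrt \<eta>)
        \<le> ln (real (N \<eta>)) / (real (N \<eta>) - 1) / (sqrt \<eta> * ln (real (N \<eta>)))"
      using N2 ev
    proof eventually_elim
      case (elim \<eta>)
      obtain k where k: "N \<eta> = Suc k" "k \<ge> 1" using elim(1) by (cases "N \<eta>") auto
      have "\<bar>ln (real k) - ln (real (Suc k))\<bar> \<le> 1 / real k" using ln_Suc_diff_bounds[OF k(2)]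
        by (smt (verit) divide_nonneg_nonneg of_nat_0_le_iff)
      hence "\<bar>ln (real k) - ln (real (Suc k))\<bar> / sqrt \<eta> \<le> 1 / real k / sqrt \<eta>"
        using elim by (intro divide_right_mono) auto
      moreover have "ln (real (Suc k)) > 0" using k(2) by simp
      ultimately show ?case using elim by (simp add: N'_def k(1) abs_divide)
    qed
  qed
  have lnN': "((\<lambda>\<eta>. sqrt \<eta> * ln (real (N' \<eta>))) \<longlongrightarrow> P) (at_right 0)"
    and ey': "((\<lambda>\<eta>. (y' \<eta> - (P / sqrt \<eta> + K + Q * sqrt \<eta>)) / sqrt \<eta>) \<longlongrightarrow> 0) (at_right 0)"
  proof -
    have e: "((\<lambda>\<eta>. (ln (real (N' \<eta>)) - (P / sqrt \<eta> + K0 + Q * sqrt \<eta>)) / sqrt \<eta>) \<longlongrightarrow> 0) (at_right 0)"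
    proof -
      have "(a - t) / r + (b - a) / r = (b - t) / r" for a b r t :: real by (simp add: diff_divide_distrib)
      with tendsto_add[OF K0[folded N_def] diff] show ?thesis by (simp only: add_0_left)
    qed
    show "((\<lambda>\<eta>. sqrt \<eta> * ln (real (N' \<eta>))) \<longlongrightarrow> P) (at_right 0)"
      by (rule square_expansion(1)[OF P mustar_pos e])
    show "((\<lambda>\<eta>. (y' \<eta> - (P / sqrt \<eta> + K + Q * sqrt \<eta>)) / sqrt \<eta>) \<longlongrightarrow> 0) (at_right 0)"
      using e by (simp add: y'_def K_def algebra_simps)
  qed
  have ey: "((\<lambda>\<eta>. (y \<eta> - (P / sqrt \<eta> + K + Q * sqrt \<eta>)) / sqrt \<eta>) \<longlongrightarrow> 0) (at_right 0)"
    using K0 by (simp add: y_def K_def N_def algebra_simps)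
  define Z where "Z \<eta> = P^2 / mustar^2 + 2 * P * K / mustar^2 * sqrt \<eta>
      + ((K^2 + 2 * P * Q) / mustar^2 - P^2 / mustar^3 - A 4 q / P^2) * \<eta>" for \<eta>
  define \<epsilon> where "\<epsilon> \<eta> = 1 / mustar - 1 / (mustar + \<eta>)" for \<eta>
  note sq = square_expansion(2)[OF P mustar_pos ey, of "A 4 q", folded Z_def \<epsilon>_def]
  note sq' = square_expansion(2)[OF P mustar_pos ey', of "A 4 q", folded Z_def \<epsilon>_def]
  note al = expansion_along[OF exp N lnN P, folded y_def]
  note al' = expansion_along[OF exp N' lnN' P, folded y'_def]
  \<comment> \<open>the extinction index brackets the finite Hardy constant\<close>
  have below: "hardy_limit q - hardy_lambda (N \<eta>) q \<le> \<epsilon> \<eta>" if \<eta>: "\<eta> > 0" for \<eta>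
  proof -
    have "N \<eta> \<noteq> 0" using extinction(1)[OF \<eta>] by (cases "N \<eta>") (auto simp: N_def)
    hence "1 / (mustar + \<eta>) \<le> hardy_lambda (N \<eta>) q"
      using extinction[OF \<eta>] mustar_pos \<eta> unfolding N_def
      by (intro hardy_const_ge[OF q_gt q_nz, where k = "extinction \<eta>"]) auto
    thus ?thesis by (simp add: \<epsilon>_def hardy_limit_eq)
  qed
  have above: "\<epsilon> \<eta> \<le> hardy_limit q - hardy_lambda (N' \<eta>) q" if \<eta>: "\<eta> > 0" "N \<eta> \<ge> 2" for \<eta>
  proof -
    have "hardy_lambda (N' \<eta>) q \<le> 1 / (mustar + \<eta>)"
      using extinction(2)[OF \<eta>(1)] mustar_pos \<eta> unfolding N_def N'_def
      by (intro hardy_const_le[OF q_gt q_nz]) auto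
    thus ?thesis by (simp add: \<epsilon>_def hardy_limit_eq)
  qed
  have "((\<lambda>\<eta>. (Z \<eta> - A 2 q) / \<eta>) \<longlongrightarrow> 0) (at_right 0)"
  proof (rule tendsto_sandwich)
    let ?low = "\<lambda>\<eta>. ((hardy_limit q - hardy_lambda (N \<eta>) q) * y \<eta>^2 - A 2 q - A 4 q / y \<eta>^2) / \<eta>
      - (\<epsilon> \<eta> * y \<eta>^2 - A 4 q / y \<eta>^2 - Z \<eta>) / \<eta>"
    let ?up = "\<lambda>\<eta>. ((hardy_limit q - hardy_lambda (N' \<eta>) q) * y' \<eta>^2 - A 2 q - A 4 q / y' \<eta>^2) / \<eta>
      - (\<epsilon> \<eta> * y' \<eta>^2 - A 4 q / y' \<eta>^2 - Z \<eta>) / \<eta>"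
    show "\<forall>\<^sub>F \<eta> in at_right 0. ?low \<eta> \<le> (Z \<eta> - A 2 q) / \<eta>"
      using ev
    proof eventually_elim
      case (elim \<eta>)
      have "(hardy_limit q - hardy_lambda (N \<eta>) q) * y \<eta>^2 \<le> \<epsilon> \<eta> * y \<eta>^2"
        by (rule mult_right_mono[OF below[OF elim]]) simp
      thus ?case using elim unfolding diff_divide_distrib[symmetric] by (intro divide_right_mono) auto
    qed
    show "\<forall>\<^sub>F \<eta> in at_right 0. (Z \<eta> - A 2 q) / \<eta> \<le> ?up \<eta>"
      using ev N2
    proof eventually_elim
      case (elim \<eta>)
      have "\<epsilon> \<eta> * y' \<eta>^2 \<le> (hardy_limit q - hardy_lambda (N' \<eta>) q) * y' \<eta>^2"
        by (rule mult_right_mono[OF above[OF elim]]) simp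
      thus ?case using elim unfolding diff_divide_distrib[symmetric] by (intro divide_right_mono) auto
    qed
    show "(?low \<longlongrightarrow> 0) (at_right 0)" using tendsto_diff[OF al sq] by simp
    show "(?up \<longlongrightarrow> 0) (at_right 0)" using tendsto_diff[OF al' sq'] by simp
  qed
  hence "((\<lambda>\<eta>. ((P^2 / mustar^2 - A 2 q) + 2 * P * K / mustar^2 * sqrt \<eta>
      + ((K^2 + 2 * P * Q) / mustar^2 - P^2 / mustar^3 - A 4 q / P^2) * \<eta>) / \<eta>) \<longlongrightarrow> 0) (at_right 0)"
    by (simp add: Z_def algebra_simps)
  note coeffs = vanishing_expansion[OF this]
  show "A 2 q = time_lead^2 / mustar^2" using coeffs(1) by (simp add: P_def)
  \<comment> \<open>so \<open>\<kappa>\<close> is the negative of the constant in the expansion of \<open>ln N\<close>\<close>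
  have "K = 0" using coeffs(2) P mustar_pos by simp
  hence "A 4 q / P^2 = 2 * P * Q / mustar^2 - P^2 / mustar^3" using coeffs(3) by simp
  thus "A 4 q = time_lead^2 * (2 * time_lead * time_next / mustar^2 - time_lead^2 / mustar^3)"
    using P by (simp add: P_def Q_def field_simps)
qed

end

section \<open>Closed forms and the exponent zero\<close>

context hardy_parameter
begin

lemma second_coefficient_closed: "time_lead^2 / mustar^2 = 2 * pi^2 * ((1 + q)^2 / wstar)"
  using wstar_pos q_gt by (simp add: time_lead_def mustar_def power_mult_distrib field_simps power2_eq_square)

lemma fourth_coefficient_closed:
  "time_lead^2 * (2 * time_lead * time_next / mustar^2 - time_lead^2 / mustar^3)
     = - (2 * pi^4 / 3) * (2 * q^2 + 5 * q + 5) * ((1 + q)^2 / wstar)"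
proof -
  define w where "w = wstar"
  have w: "w > 0" and m: "mustar = w / (1 + q)" using wstar_pos by (simp_all add: w_def mustar_def)
  have l2: "time_lead^2 = 2 * pi^2 * w" using w by (simp add: time_lead_def power_mult_distrib w_def)
  have "2 * time_lead * time_next = - (time_lead^2 * ((q - 1) * (2 * q + 1)) / (6 * w))"
    by (simp add: time_next_def w_def power2_eq_square)
  also have "\<dots> = - (pi^2 * ((q - 1) * (2 * q + 1)) / 3)" using w by (simp add: l2)
  finally have ls: "2 * time_lead * time_next = - (pi^2 * ((q - 1) * (2 * q + 1)) / 3)" .
  have "1 + q \<noteq> 0" using q_gt by simp
  hence "2 * time_lead * time_next / mustar^2 - time_lead^2 / mustar^3
      = (1 + q)^2 / w^2 * (- (pi^2 * ((q - 1) * (2 * q + 1)) / 3) - 2 * pi^2 * (1 + q))"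
    unfolding ls l2 m using w by (simp add: field_simps power2_eq_square power3_eq_cube)
  also have "- (pi^2 * ((q - 1) * (2 * q + 1)) / 3) - 2 * pi^2 * (1 + q) = - (pi^2 / 3) * (2 * q^2 + 5 * q + 5)"
    by (simp add: field_simps power2_eq_square)
  finally have diff: "2 * time_lead * time_next / mustar^2 - time_lead^2 / mustar^3
      = (1 + q)^2 / w^2 * (- (pi^2 / 3) * (2 * q^2 + 5 * q + 5))" .
  have "2 * pi^2 * w * (a / w^2 * (- (pi^2 / 3) * b)) = - (2 * pi^4 / 3) * b * (a / w)" for a b
    using w by (simp add: power2_eq_square power4_eq_xxxx mult_ac)
  thus ?thesis unfolding diff unfolding l2 w_def[symmetric] .
qed

end

lemma coefficients_in_exponent:
  fixes t :: real
  assumes exp: "hardy_expansion \<kappa> A" and t: "t < 1" "t \<noteq> 0"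
  shows "A 2 (t / (1 - t)) = 2 * pi^2 * (1 - t) powr (- 1 / t - 1)"
    and "A 4 (t / (1 - t)) = - (2 * pi^4 / 3) * (2 * t^2 - 5 * t + 5) * (1 - t) powr (- 1 / t - 3)"
proof -
  define q where "q = t / (1 - t)"
  have q1: "1 + q = 1 / (1 - t)" using t by (simp add: q_def field_simps)
  interpret hardy_parameter q
  proof
    have "1 + q > 0" unfolding q1 using t by simp
    thus "q > -1" by simp
    show "q \<noteq> 0" using t by (simp add: q_def)
  qed
  have e: "1 / q = 1 / t - 1" using t by (simp add: q_def field_simps)
  have "wstar = (1 - t) powr (1 / q)"
    unfolding wstar_def q1 using t by (simp add: powr_divide powr_minus_divide)
  hence w: "wstar = (1 - t) powr (1 / t - 1)" unfolding e .
  have base: "(1 + q)^2 / wstar = (1 - t) powr (- 1 / t - 1)"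
  proof -
    have sq: "(1 + q)^2 = (1 - t) powr (- 2)" unfolding q1 using t by (simp add: powr_minus_divide power_divide powr_numeral)
    have "(1 + q)^2 / wstar = (1 - t) powr (- 2 - (1 / t - 1))" unfolding sq w by (rule powr_diff[symmetric])
    also have "- 2 - (1 / t - 1) = - 1 / t - 1" by simp
    finally show ?thesis .
  qed
  show "A 2 (t / (1 - t)) = 2 * pi^2 * (1 - t) powr (- 1 / t - 1)"
    using hardy_expansion_coefficients(1)[OF exp] unfolding second_coefficient_closed base by (simp add: q_def)
  have "2 * q^2 + 5 * q + 5 = (2 * t^2 - 5 * t + 5) / (1 - t)^2"
    using t by (simp add: q_def divide_simps) (simp add: algebra_simps power2_eq_square)
  also have "\<dots> = (2 * t^2 - 5 * t + 5) * (1 - t) powr (- 2)"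
    using t by (simp add: powr_minus_divide powr_numeral)
  finally have "(2 * q^2 + 5 * q + 5) * ((1 + q)^2 / wstar)
      = (2 * t^2 - 5 * t + 5) * ((1 - t) powr (- 2) * (1 - t) powr (- 1 / t - 1))"
    unfolding base by simp
  also have "(1 - t) powr (- 2) * (1 - t) powr (- 1 / t - 1) = (1 - t) powr (- 2 + (- 1 / t - 1))"
    by (rule powr_add[symmetric])
  also have "- 2 + (- 1 / t - 1) = - 1 / t - 3" by simp
  finally have p: "(2 * q^2 + 5 * q + 5) * ((1 + q)^2 / wstar) = (2 * t^2 - 5 * t + 5) * (1 - t) powr (- 1 / t - 3)" .
  show "A 4 (t / (1 - t)) = - (2 * pi^4 / 3) * (2 * t^2 - 5 * t + 5) * (1 - t) powr (- 1 / t - 3)"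
    using trans[OF hardy_expansion_coefficients(2)[OF exp] fourth_coefficient_closed]
    unfolding q_def[symmetric] mult.assoc p .
qed

lemma real_analytic_on_imp_isCont:
  assumes "real_analytic_on f S" "x \<in> S"
  shows "isCont f x"
proof -
  obtain F where "(\<lambda>h. f (x + h)) has_fps_expansion F" using assms unfolding real_analytic_on_def by blast
  hence "isCont (\<lambda>h. f (x + h)) 0" by (rule has_fps_expansion_imp_continuous)
  thus ?thesis by (simp add: isCont_iff isCont_def)
qed

text \<open>
  Continuity of an analytic coefficient transports the formula for nonzero exponents to \<open>t = 0\<close>.
\<close>

lemma coefficient_tendsto_at_0:
  fixes F :: "real \<Rightarrow> real"
  assumes "real_analytic_on f {-1<..}" and "\<And>t. t < 1 \<Longrightarrow> t \<noteq> 0 \<Longrightarrow> f (t / (1 - t)) = F t"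
  shows "(F \<longlongrightarrow> f 0) (at 0)"
proof -
  have "isCont f 0" by (rule real_analytic_on_imp_isCont[OF assms(1)]) auto
  moreover have "((\<lambda>t::real. t / (1 - t)) \<longlongrightarrow> 0 / (1 - 0)) (at 0)" by (intro tendsto_intros) auto
  hence "((\<lambda>t::real. t / (1 - t)) \<longlongrightarrow> 0) (at 0)" by simp
  ultimately have "((\<lambda>t. f (t / (1 - t))) \<longlongrightarrow> f 0) (at 0)" by (rule isCont_tendsto_compose)
  moreover have "eventually (\<lambda>t::real. t < 1 \<and> t \<noteq> 0) (at 0)"
    by (auto simp: eventually_at intro!: exI[of _ 1])
  hence "eventually (\<lambda>t. f (t / (1 - t)) = F t) (at 0)"
    by eventually_elim (use assms(2) in auto)
  ultimately show ?thesis by (rule Lim_transform_eventually)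
qed

text \<open>
  Raising the entries to the power \<open>s\<close> permutes the positive tuples and turns the power mean with
  exponent \<open>1 / s\<close> into a power of the arithmetic mean.
\<close>

lemma hardy_quotient_substitution:
  fixes s :: real
  assumes s: "s \<noteq> 0"
  shows "(\<lambda>a. (\<Sum>n=1..N. ((\<Sum>k=1..n. a k) / real n) powr s) / (\<Sum>n=1..N. a n powr s)) ` pos_tuples N
       = (\<lambda>x. (\<Sum>n=1..N. power_mean (1 / s) n x) / (\<Sum>n=1..N. x n)) ` pos_tuples N"
proof -
  define f where "f a = (\<Sum>n=1..N. ((\<Sum>k=1..n. a k) / real n) powr s) / (\<Sum>n=1..N. a n powr s)" for a
  define g where "g x = (\<Sum>n=1..N. power_mean (1 / s) n x) / (\<Sum>n=1..N. x n)" for x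
  have fg: "f a = g (\<lambda>k. a k powr s)" if a: "a \<in> pos_tuples N" for a
  proof -
    have "power_mean (1 / s) n (\<lambda>k. a k powr s) = ((\<Sum>k=1..n. a k) / real n) powr s" if "n \<in> {1..N}" for n
    proof -
      have "a k > 0" if "k \<in> {1..n}" for k using a that \<open>n \<in> {1..N}\<close> by (auto simp: pos_tuples_def)
      hence "(\<Sum>k=1..n. (a k powr s) powr (1 / s)) = (\<Sum>k=1..n. a k)"
        using s by (intro sum.cong) (auto simp: powr_powr less_imp_le)
      thus ?thesis using s by (simp add: power_mean_def)
    qed
    thus ?thesis by (simp add: f_def g_def)
  qed
  have "f ` pos_tuples N = g ` pos_tuples N"
  proof (intro equalityI subsetI)
    fix z assume "z \<in> f ` pos_tuples N"
    then obtain a where a: "a \<in> pos_tuples N" "z = f a" by blast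
    moreover have "(\<lambda>k. a k powr s) \<in> pos_tuples N" using a(1) by (auto simp: pos_tuples_def)
    ultimately show "z \<in> g ` pos_tuples N" using fg by blast
  next
    fix z assume "z \<in> g ` pos_tuples N"
    then obtain x where x: "x \<in> pos_tuples N" "z = g x" by blast
    define a where "a k = x k powr (1 / s)" for k
    have a: "a \<in> pos_tuples N" using x(1) by (auto simp: pos_tuples_def a_def)
    have inv: "a k powr s = x k" if "k \<in> {1..N}" for k
    proof -
      have "x k > 0" using x(1) that by (auto simp: pos_tuples_def)
      thus ?thesis using s by (simp add: a_def powr_powr)
    qed
    have "g (\<lambda>k. a k powr s) = g x"
    proof -
      have "power_mean (1 / s) n (\<lambda>k. a k powr s) = power_mean (1 / s) n x" if "n \<in> {1..N}" for n
      proof -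
        have "(\<Sum>k=1..n. (a k powr s) powr (1 / s)) = (\<Sum>k=1..n. x k powr (1 / s))"
          using that by (intro sum.cong) (auto simp: inv)
        thus ?thesis using s by (simp add: power_mean_def)
      qed
      thus ?thesis by (simp add: g_def inv)
    qed
    thus "z \<in> f ` pos_tuples N" by (intro image_eqI[of _ _ a]) (use fg[OF a] a x(2) in auto)
  qed
  thus ?thesis unfolding f_def[abs_def] g_def[abs_def] .
qed

lemma hardy_const_substitution:
  fixes s :: real
  assumes "s \<noteq> 0"
  defines "quot \<equiv> \<lambda>N (a :: nat \<Rightarrow> real). (\<Sum>n=1..N. ((\<Sum>k=1..n. a k) / real n) powr s) / (\<Sum>n=1..N. a n powr s)"
  shows "bdd_above (quot N ` pos_tuples N)" "hardy_const N (1 / s) = (SUP a\<in>pos_tuples N. quot N a)"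
  unfolding quot_def hardy_quotient_substitution[OF assms(1)] hardy_const_def
  using hardy_quotients_bdd_above by auto

theorem corollary1p3:
  fixes \<kappa> :: "real \<Rightarrow> real" and A :: "nat \<Rightarrow> real \<Rightarrow> real"
  assumes "hardy_expansion \<kappa> A"
  defines "F2 \<equiv> \<lambda>t::real. 2 * pi ^ 2 * (1 - t) powr (- 1 / t - 1)"
    and "F4 \<equiv> \<lambda>t::real. - (2 * pi ^ 4 / 3) * (2 * t ^ 2 - 5 * t + 5) * (1 - t) powr (- 1 / t - 3)"
  shows "(\<forall>t<1. t \<noteq> 0 \<longrightarrow> A 2 (t / (1 - t)) = F2 t \<and> A 4 (t / (1 - t)) = F4 t)
    \<and> (F2 \<longlongrightarrow> A 2 0) (at 0) \<and> (F4 \<longlongrightarrow> A 4 0) (at 0)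
    \<and> (\<forall>p>1. \<forall>N\<ge>1.
         let quot = (\<lambda>a::nat \<Rightarrow> real. (\<Sum>n=1..N. ((\<Sum>k=1..n. a k) / real n) powr p)
                                     / (\<Sum>n=1..N. a n powr p))
         in bdd_above (quot ` pos_tuples N) \<and> hardy_const N (1 / p) = (SUP a\<in>pos_tuples N. quot a))
    \<and> (\<lambda>N. exp 1 - hardy_const N 0
           - (2 * exp 1 * pi ^ 2 / (ln (real N) + \<kappa> 0) ^ 2
              - (10 * exp 1 * pi ^ 4 / 3) / (ln (real N) + \<kappa> 0) ^ 4))
        \<in> O(\<lambda>N. 1 / ln (real N) ^ 5)
    \<and> (\<forall>r>0. \<forall>N\<ge>1.
         let quot = (\<lambda>a::nat \<Rightarrow> real. (\<Sum>n=1..N. ((\<Sum>k=1..n. a k) / real n) powr (- r))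
                                     / (\<Sum>n=1..N. a n powr (- r)))
         in bdd_above (quot ` pos_tuples N) \<and> hardy_const N (- 1 / r) = (SUP a\<in>pos_tuples N. quot a))
    \<and> A 2 1 = 16 * pi ^ 2 \<and> A 4 1 = - 64 * pi ^ 4"
proof -
  have an: "real_analytic_on (A 2) {-1<..}" "real_analytic_on (A 4) {-1<..}"
    using assms(1) unfolding hardy_expansion_def by auto
  have closed: "A 2 (t / (1 - t)) = F2 t" "A 4 (t / (1 - t)) = F4 t" if "t < 1" "t \<noteq> 0" for t
    using coefficients_in_exponent[OF assms(1) that] by (simp_all add: F2_def F4_def)
  have F2: "(F2 \<longlongrightarrow> A 2 0) (at 0)" by (rule coefficient_tendsto_at_0[OF an(1) closed(1)])
  have F4: "(F4 \<longlongrightarrow> A 4 0) (at 0)" by (rule coefficient_tendsto_at_0[OF an(2) closed(2)])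
  have "(F2 \<longlongrightarrow> 2 * pi^2 * exp 1) (at 0)" unfolding F2_def by real_asymp
  hence A20: "A 2 0 = 2 * exp 1 * pi^2" using tendsto_unique[OF _ F2] by auto
  have "(F4 \<longlongrightarrow> - (2 * pi^4 / 3) * 5 * exp 1) (at 0)" unfolding F4_def by real_asymp
  hence A40: "A 4 0 = - (10 * exp 1 * pi^4 / 3)" using tendsto_unique[OF _ F4] by fastforce
  have A1: "A 2 1 = 16 * pi^2" "A 4 1 = - 64 * pi^4"
    using closed[of "1/2"] by (simp_all add: F2_def F4_def powr_minus powr_numeral power2_eq_square power_divide)
  have O: "(\<lambda>N. exp 1 - hardy_const N 0
           - (2 * exp 1 * pi ^ 2 / (ln (real N) + \<kappa> 0) ^ 2
              - (10 * exp 1 * pi ^ 4 / 3) / (ln (real N) + \<kappa> 0) ^ 4)) \<in> O(\<lambda>N. 1 / ln (real N) ^ 5)"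
  proof -
    have "compact {0::real}" "{0::real} \<subseteq> {-1<..}" "(2::nat) \<le> 4" by auto
    with assms(1) obtain C where C: "\<forall>\<^sub>F N in sequentially. \<forall>x\<in>{0}.
        \<bar>hardy_limit x - hardy_lambda N x - (\<Sum>j=2..4. A j x / (ln (real N) + \<kappa> x) ^ j)\<bar> \<le> C / ln (real N) ^ (4 + 1)"
      unfolding hardy_expansion_def by blast
    have A3: "A 3 0 = 0" using assms(1) unfolding hardy_expansion_def by auto
    have sum: "(\<Sum>j=2..4. A j 0 / z ^ j) = 2 * exp 1 * pi^2 / z^2 - (10 * exp 1 * pi^4 / 3) / z^4" for z
      using A3 A20 A40 by (simp add: numeral_eq_Suc)
    show ?thesis
    proof (rule bigoI)
      show "\<forall>\<^sub>F N in sequentially. norm (exp 1 - hardy_const N 0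
           - (2 * exp 1 * pi ^ 2 / (ln (real N) + \<kappa> 0) ^ 2
              - (10 * exp 1 * pi ^ 4 / 3) / (ln (real N) + \<kappa> 0) ^ 4)) \<le> \<bar>C\<bar> * norm (1 / ln (real N) ^ 5)"
        using C
      proof eventually_elim
        case (elim N)
        have "C * (1 / ln (real N) ^ 5) \<le> \<bar>C\<bar> * norm (1 / ln (real N) ^ 5)"
          by (metis abs_ge_self abs_mult real_norm_def)
        moreover have "\<bar>hardy_limit 0 - hardy_lambda N 0 - (\<Sum>j=2..4. A j 0 / (ln (real N) + \<kappa> 0) ^ j)\<bar> \<le> C * (1 / ln (real N) ^ 5)"
          using elim by simp
        ultimately show ?case unfolding sum by (simp add: hardy_limit_def hardy_lambda_def)
      qed
    qed
  qed
  have neg: "- 1 / r = 1 / (- r)" for r :: real by simp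
  show ?thesis
    unfolding Let_def
  proof (intro conjI allI impI)
    fix p :: real and N :: nat assume "p > 1"
    hence "p \<noteq> 0" by simp
    note subst = hardy_const_substitution[OF this]
    show "bdd_above ((\<lambda>a. (\<Sum>n=1..N. ((\<Sum>k=1..n. a k) / real n) powr p) / (\<Sum>n=1..N. a n powr p)) ` pos_tuples N)"
      by (rule subst(1))
    show "hardy_const N (1 / p)
        = (SUP a\<in>pos_tuples N. (\<Sum>n=1..N. ((\<Sum>k=1..n. a k) / real n) powr p) / (\<Sum>n=1..N. a n powr p))"
      by (rule subst(2))
  next
    fix r :: real and N :: nat assume "r > 0"
    hence "- r \<noteq> 0" by simp
    note subst = hardy_const_substitution[OF this]
    show "bdd_above ((\<lambda>a. (\<Sum>n=1..N. ((\<Sum>k=1..n. a k) / real n) powr - r) / (\<Sum>n=1..N. a n powr - r)) ` pos_tuples N)"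
      by (rule subst(1))
    show "hardy_const N (- 1 / r)
        = (SUP a\<in>pos_tuples N. (\<Sum>n=1..N. ((\<Sum>k=1..n. a k) / real n) powr - r) / (\<Sum>n=1..N. a n powr - r))"
      unfolding neg by (rule subst(2))
  qed (use closed F2 F4 O A1 in auto)
qed

end
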